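(* Let $X\subseteq\mathbb{P}^{n+1}$ be an algebraic statistical model, i.e. an algebraic variety contained in the hyperplane $p_0+p_1+\cdots+p_n-p_s=0$. Let $X_{sing}$ be its singular locus, let $X^*$ be its dual variety, let $\mathcal{H}$ be the union of the coordinate hyperplanes $\{p_0p_1\cdots p_np_s=0\}$, let $\mathrm{DS}(X)$ be the (maximum likelihood) data singular locus of $X$, and let $*$ denote the Hadamard product with respect to the hypersurface $p_0b_0+\cdots+p_nb_n+p_sb_s=0$. Then the following two inclusions hold: \[ (X_{sing}\setminus \mathcal{H})*[1:\ldots:1:-1]\ \subseteq\ \mathrm{DS}(X)\ \subseteq\ (X_{sing}\setminus \mathcal{H})*X^*. \]
   Context: All varieties are over $\mathbb{C}$. Three copies of $\mathbb{P}^{n+1}$ are used, denoted $\mathbb{P}^{n+1}_p,\mathbb{P}^{n+1}_b,\mathbb{P}^{n+1}_u$, with homogeneous coordinates $[p_0:\dots:p_n:p_s]$, $[b_0:\dots:b_n:b_s]$, $[u_0:\dots:u_n:u_s]$ respectively (the last coordinate carries the index $s$). Algebraic statistical model: an algebraic variety $X\subseteq\mathbb{P}^{n+1}_p$ (not necessarily irreducible, with its radical ideal) contained in the hyperplane $p_0+\cdots+p_n-p_s=0$. $X_{reg}$ is the set of nonsingular points of $X$ and $X_{sing}=X\setminus X_{reg}$ is the singular locus. $\mathcal{H}\subset\mathbb{P}^{n+1}_p$ is the zero set of $p_0p_1\cdots p_np_s$; thus $X_{sing}\setminus\mathcal{H}$ is the set of singular points of $X$ all of whose homogeneous coordinates are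 nonzero (it may be empty). Conormal variety: \[ \mathcal{N}_X:=\overline{\{([p],[b])\in\mathbb{P}^{n+1}_p\times\mathbb{P}^{n+1}_b : p\in X_{reg},\ b\perp T_pX\}} \] (Zariski closure), where $b\perp T_pX$ means $\sum_i b_iv_i=0$ (sum over $i\in\{0,\dots,n,s\}$) for all $v$ in the linear subspace of $\mathbb{C}^{n+2}$ underlying the embedded projective tangent space of $X$ at $p$ (the tangent space to the affine cone over $X$ at a representative of $p$). The dual variety is $X^*:=\pi_b(\mathcal{N}_X)\subseteq\mathbb{P}^{n+1}_b$, the image under projection to the $b$-coordinates. Extended likelihood correspondence: \[ \mathcal{E}_X:=\overline{\{(p,b,u)\in\mathbb{P}^{n+1}_p\times\mathbb{P}^{n+1}_b\times\mathbb{P}^{n+1}_u : (p,b)\in\mathcal{N}_X,\ [p_0b_0:\cdots:p_nb_n:p_sb_s]=[u_0:\cdots:u_n:u_s]\}} \] (Zariski closure), where the condition is imposed only on pairs $(p,b)$ for which the products $p_0b_0,\dots,p_nb_n,p_sb_s$ are not all zero. Data singular locus: with $\pi_p,\pi_u$ the projections from $\mathbb{P}^{n+1}_p\times\mathbb{P}^{n+1}_b\times\mathbb{P}^{n+1}_u$ to $\mathbb{P}^{n+1}_p$ and $\mathbb{P}^{n+1}_u$, set $\mathcal{S}:=\pi_p^{-1}(X_{sing}\setminus\mathcal{H})$ and \[ \mathrm{DS}(X):=\pi_u(\mathcal{S}\cap\mathcal{E}_X)\subseteq\mathbb{P}^{n+1}_u . \] Hadamard product (with respect to the hypersurface $p_0b_0+\cdots+p_nb_n+p_sb_s=0$):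 for subsets $A\subseteq\mathbb{P}^{n+1}_p$ and $B\subseteq\mathbb{P}^{n+1}_b$, $A*B\subseteq\mathbb{P}^{n+1}_u$ is the image of \[ \{(p,b)\in A\times B : p_0b_0+\cdots+p_nb_n+p_sb_s=0\} \] under the map $([p_0:\cdots:p_n:p_s],[b_0:\cdots:b_n:b_s])\mapsto[p_0b_0:\cdots:p_nb_n:p_sb_s]$. (This map is everywhere defined when $A$ is disjoint from $\mathcal{H}$.) A point such as $[1:\ldots:1:-1]$ (entries $1$ in positions $0,\dots,n$ and $-1$ in position $s$) is identified with the one-element set containing it. All inclusions are inclusions of sets of points. *)

theory Defs
  imports "HOL-Analysis.Analysis" "HOL-Library.Poly_Mapping" "HOL-Library.Extended_Nat"
begin

type_synonym 'v cpoly = "('v \<Rightarrow>\<^sub>0 nat) \<Rightarrow>\<^sub>0 complex"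

definition peval :: "('v \<Rightarrow> complex) \<Rightarrow> 'v cpoly \<Rightarrow> complex" where
  "peval x f = (\<Sum>m\<in>Poly_Mapping.keys f. Poly_Mapping.lookup f m *
                  (\<Prod>i\<in>Poly_Mapping.keys m. x i ^ Poly_Mapping.lookup m i))"

text \<open>Formal partial derivative. The subtraction of exponents is truncated, but only where the
  coefficient \<open>Poly_Mapping.lookup m i\<close> is zero anyway.\<close>

definition pdiff :: "'v \<Rightarrow> 'v cpoly \<Rightarrow> 'v cpoly" where
  "pdiff i f = (\<Sum>m\<in>Poly_Mapping.keys f.
     Poly_Mapping.single (m - Poly_Mapping.single i 1)
       (of_nat (Poly_Mapping.lookup m i) * Poly_Mapping.lookup f m))"

text \<open>Homogeneous of degree \<open>d\<close> in the group of variables \<open>A\<close>; the zero polynomial is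
  homogeneous of every degree.\<close>

definition homog_in :: "'v set \<Rightarrow> nat \<Rightarrow> 'v cpoly \<Rightarrow> bool" where
  "homog_in A d f \<longleftrightarrow>
     (\<forall>m\<in>Poly_Mapping.keys f. (\<Sum>i\<in>A. Poly_Mapping.lookup m i) = d)"

text \<open>Complex projective space with homogeneous coordinates indexed by the finite type \<open>'i\<close>.\<close>

definition proj_rel :: "complex ^ 'i \<Rightarrow> complex ^ 'i \<Rightarrow> bool" where
  "proj_rel v w \<longleftrightarrow> v \<noteq> 0 \<and> w \<noteq> 0 \<and> (\<exists>c. w = c *s v)"

lemma proj_rel_refl: "v \<noteq> 0 \<Longrightarrow> proj_rel v v"
  unfolding proj_rel_def by (metis vec.scale_one)

quotient_type 'i proj = "complex ^ ('i::finite)" / partial: proj_rel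
proof (rule part_equivpI)
  have "axis undefined 1 \<noteq> (0 :: complex ^ 'i)"
    by (simp add: axis_eq_0_iff)
  then show "\<exists>x :: complex ^ 'i. proj_rel x x"
    using proj_rel_refl by blast
  show "symp (proj_rel :: complex ^ 'i \<Rightarrow> _)"
  proof (rule sympI)
    fix v w :: "complex ^ 'i"
    assume "proj_rel v w"
    then obtain c where c: "v \<noteq> 0" "w \<noteq> 0" "w = c *s v"
      unfolding proj_rel_def by blast
    then have "c \<noteq> 0" by force
    then have "v = inverse c *s w" using c(3) by (simp add: vector_smult_assoc)
    with c show "proj_rel w v" unfolding proj_rel_def by blast
  qed
  show "transp (proj_rel :: complex ^ 'i \<Rightarrow> _)"
    unfolding proj_rel_def by (rule transpI) (metis vector_smult_assoc)
qed

text \<open>The point \<open>[v]\<close>; meaningful only for \<open>v \<noteq> 0\<close>, so every use below is guarded.\<close>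

definition pt :: "complex ^ 'i \<Rightarrow> ('i::finite) proj" where
  "pt v = abs_proj v"

lemma pt_eq_iff:
  assumes "v \<noteq> 0" "w \<noteq> 0"
  shows "pt v = pt w \<longleftrightarrow> (\<exists>c. w = c *s v)"
proof -
  have "pt v = pt w \<longleftrightarrow> proj_rel v w"
    using Quotient_rel[OF Quotient_proj, of v w] proj_rel_refl[OF assms(1)]
      proj_rel_refl[OF assms(2)]
    unfolding pt_def by metis
  then show ?thesis using assms by (simp add: proj_rel_def)
qed

text \<open>The affine cone over a set of points, with the origin removed.\<close>

definition reps :: "('i::finite) proj set \<Rightarrow> (complex ^ 'i) set" where
  "reps A = {v. v \<noteq> 0 \<and> pt v \<in> A}"

text \<open>Closed sets of the Zariski topology on products of projective spaces are the zero sets of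
  multihomogeneous polynomials; the groups of variables are the summands of the index type.
  The Zariski closure of \<open>A\<close> is \<open>zclosed hull A\<close> (respectively \<open>zclosed2\<close>, \<open>zclosed3\<close>).\<close>

definition zclosed :: "('i::finite) proj set \<Rightarrow> bool" where
  "zclosed C \<longleftrightarrow>
     (\<exists>F. (\<forall>f\<in>F. \<exists>d. homog_in UNIV d f) \<and>
        C = {pt p |p. p \<noteq> 0 \<and> (\<forall>f\<in>F. peval (($) p) f = 0)})"

definition zclosed2 :: "(('i::finite) proj \<times> ('j::finite) proj) set \<Rightarrow> bool" where
  "zclosed2 C \<longleftrightarrow>
     (\<exists>F. (\<forall>f\<in>F. \<exists>d e. homog_in (range Inl) d f \<and> homog_in (range Inr) e f) \<and>
        C = {(pt p, pt b) |p b. p \<noteq> 0 \<and> b \<noteq> 0 \<and>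
              (\<forall>f\<in>F. peval (case_sum (($) p) (($) b)) f = 0)})"

definition zclosed3 ::
  "(('i::finite) proj \<times> ('j::finite) proj \<times> ('k::finite) proj) set \<Rightarrow> bool" where
  "zclosed3 C \<longleftrightarrow>
     (\<exists>F. (\<forall>f\<in>F. \<exists>d e h. homog_in (range Inl) d f \<and> homog_in (range (Inr \<circ> Inl)) e f \<and>
              homog_in (range (Inr \<circ> Inr)) h f) \<and>
        C = {(pt p, pt b, pt u) |p b u. p \<noteq> 0 \<and> b \<noteq> 0 \<and> u \<noteq> 0 \<and>
              (\<forall>f\<in>F. peval (case_sum (($) p) (case_sum (($) b) (($) u))) f = 0)})"

definition zirreducible :: "('i::finite) proj set \<Rightarrow> bool" where
  "zirreducible Z \<longleftrightarrow> zclosed Z \<and> Z \<noteq> {} \<and>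
     (\<forall>A B. zclosed A \<and> zclosed B \<and> Z = A \<union> B \<longrightarrow> Z = A \<or> Z = B)"

definition zcomponents :: "('i::finite) proj set \<Rightarrow> 'i proj set set" where
  "zcomponents X = {Z. zirreducible Z \<and> Z \<subseteq> X \<and>
     (\<forall>W. zirreducible W \<and> Z \<subseteq> W \<and> W \<subseteq> X \<longrightarrow> W = Z)}"

text \<open>The fractions \<open>f i / g i\<close> for \<open>i < r\<close> are elements of the function field of the irreducible
  variety \<open>Z\<close> (quotients of forms of equal degree, the denominator not vanishing identically
  on \<open>Z\<close>), and they are algebraically independent over the complex numbers. A rational function
  on \<open>Z\<close> is zero iff it vanishes at all points of \<open>Z\<close> where the denominators do not.\<close>

definition alg_indep_fractions ::
  "('i::finite) proj set \<Rightarrow> nat \<Rightarrow> (nat \<Rightarrow> 'i cpoly) \<Rightarrow> (nat \<Rightarrow> 'i cpoly) \<Rightarrow> bool" where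
  "alg_indep_fractions Z r f g \<longleftrightarrow>
     (\<forall>i<r. (\<exists>d. homog_in UNIV d (f i) \<and> homog_in UNIV d (g i)) \<and>
            (\<exists>p\<in>reps Z. peval (($) p) (g i) \<noteq> 0)) \<and>
     (\<forall>F :: nat cpoly. (\<forall>m\<in>Poly_Mapping.keys F. Poly_Mapping.keys m \<subseteq> {..<r}) \<and>
        (\<forall>p\<in>reps Z. (\<forall>i<r. peval (($) p) (g i) \<noteq> 0) \<longrightarrow>
           peval (\<lambda>i. peval (($) p) (f i) / peval (($) p) (g i)) F = 0)
        \<longrightarrow> F = 0)"

text \<open>The dimension of an irreducible variety is the transcendence degree of its function field;
  the dimension of a variety at a point is the largest dimension of a component through it.\<close>

definition irred_dim :: "('i::finite) proj set \<Rightarrow> enat" where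
  "irred_dim Z = Sup {enat r |r. \<exists>f g. alg_indep_fractions Z r f g}"

definition local_dim :: "('i::finite) proj set \<Rightarrow> 'i proj \<Rightarrow> enat" where
  "local_dim X P = Sup {irred_dim Z |Z. Z \<in> zcomponents X \<and> P \<in> Z}"

text \<open>For nonempty \<open>X\<close> this is the homogeneous radical ideal of \<open>X\<close>: as the cone is stable under
  scaling, all homogeneous parts of a member are members.\<close>

definition vanishing_ideal :: "('i::finite) proj set \<Rightarrow> 'i cpoly set" where
  "vanishing_ideal X = {f. \<forall>v\<in>reps X. peval (($) v) f = 0}"

definition cone_tangent :: "('i::finite) proj set \<Rightarrow> complex ^ 'i \<Rightarrow> (complex ^ 'i) set" where
  "cone_tangent X p =
     {v. \<forall>f\<in>vanishing_ideal X. (\<Sum>i\<in>UNIV. peval (($) p) (pdiff i f) * v $ i) = 0}"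

text \<open>A point is nonsingular iff the embedded projective tangent space, whose dimension is one less
  than that of the tangent space of the cone, has the dimension of the variety at that point.\<close>

definition reg_points :: "('i::finite) proj set \<Rightarrow> 'i proj set" where
  "reg_points X = {pt p |p. p \<in> reps X \<and>
     enat (vec.dim (cone_tangent X p)) = local_dim X (pt p) + 1}"

definition sing_points :: "('i::finite) proj set \<Rightarrow> 'i proj set" where
  "sing_points X = X - reg_points X"

definition conormal :: "('i::finite) proj set \<Rightarrow> ('i proj \<times> 'i proj) set" where
  "conormal X = zclosed2 hull {(pt p, pt b) |p b. p \<in> reps (reg_points X) \<and> b \<noteq> 0 \<and>
     (\<forall>v\<in>cone_tangent X p. (\<Sum>i\<in>UNIV. b $ i * v $ i) = 0)}"

definition dual_variety :: "('i::finite) proj set \<Rightarrow> 'i proj set" where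
  "dual_variety X = snd ` conormal X"

text \<open>Below, \<open>p * b\<close> is the componentwise product of vectors.\<close>

definition ext_likelihood ::
  "('i::finite) proj set \<Rightarrow> ('i proj \<times> 'i proj \<times> 'i proj) set" where
  "ext_likelihood X = zclosed3 hull {(pt p, pt b, pt u) |p b u. p \<noteq> 0 \<and> b \<noteq> 0 \<and> u \<noteq> 0 \<and>
     (pt p, pt b) \<in> conormal X \<and> p * b \<noteq> 0 \<and> pt (p * b) = pt u}"

definition coord_hyperplanes :: "('i::finite) proj set" where
  "coord_hyperplanes = {pt p |p. p \<noteq> 0 \<and> (\<Prod>i\<in>UNIV. p $ i) = 0}"

definition data_singular_locus :: "('i::finite) proj set \<Rightarrow> 'i proj set" where
  "data_singular_locus X = (\<lambda>(P, B, U). U) `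
     ({(P, B, U). P \<in> sing_points X - coord_hyperplanes} \<inter> ext_likelihood X)"

definition hadamard :: "('i::finite) proj set \<Rightarrow> 'i proj set \<Rightarrow> 'i proj set" where
  "hadamard A B = {pt (p * b) |p b. p \<in> reps A \<and> b \<in> reps B \<and>
     (\<Sum>i\<in>UNIV. p $ i * b $ i) = 0 \<and> p * b \<noteq> 0}"

text \<open>In statistical models the coordinates \<open>0, \<dots>, n\<close> are indexed by a finite type \<open>'n\<close> with
  \<open>n + 1\<close> elements, and the coordinate \<open>s\<close> is \<open>None\<close>.\<close>

definition stat_model :: "('n::finite) option proj set \<Rightarrow> bool" where
  "stat_model X \<longleftrightarrow> zclosed X \<and>
     X \<subseteq> {pt p |p. p \<noteq> 0 \<and> (\<Sum>i\<in>UNIV. p $ Some i) - p $ None = 0}"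

definition ones_point :: "('n::finite) option proj" where
  "ones_point = pt (\<chi> i. case i of Some _ \<Rightarrow> 1 | None \<Rightarrow> - 1)"

end

theory Submission
  imports Defs
begin

text \<open>
  Both inclusions follow from the fact that closed conditions pass to Zariski closures; the substance
  lies in the density of the nonsingular points.

  For the second inclusion, three closed conditions hold on the generators of the likelihood
  correspondence and hence on all of it: \<open>(p, b)\<close> lies in the conormal variety, \<open>u\<close> is proportional to
  the coordinatewise product of \<open>p\<close> and \<open>b\<close> (vanishing of minors), and \<open>p\<close> and \<open>b\<close> are orthogonal. The
  last one holds because the radial direction is tangent to the cone over \<open>X\<close>, by the relation of
  Euler. If no coordinate of \<open>p\<close> is zero, the product is nonzero and determines the point of \<open>u\<close>.

  For the first inclusion, the linear equation of the model shows that the vector with entries \<open>1\<close> and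
  last entry \<open>-1\<close> is orthogonal to every tangent space. A singular point \<open>p\<close>, paired with this vector,
  therefore lies in the conormal variety as soon as \<open>p\<close> is a limit of nonsingular points
  (\<open>conormal_if_perp_everywhere\<close>). That the nonsingular points are dense in every closed set, reducible
  or not, is \<open>regular_points_dense\<close>.

  The proof of density is by commutative algebra over the polynomial ring. Noetherianity
  (\<open>wf_zclosed\<close>, by leading monomials and the lemma of Dickson) shrinks the problem to an irreducible
  \<open>Z\<close>. Let \<open>P\<close> be its prime ideal and \<open>S\<close> a maximal set of coordinates that are algebraically independent
  modulo \<open>P\<close>. Two numbers must be identified with \<open>card S\<close>.

  One is the dimension of \<open>Z\<close> plus one (\<open>irred_dim_eq\<close>). The upper bound for the transcendence degree
  is obtained by counting: modulo \<open>P\<close>, the polynomials of degree at most \<open>m\<close> span a space whose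
  dimension grows at most like \<open>m\<close> to the power \<open>card S\<close> (\<open>dependence_by_counting\<close>).

  The other is the dimension of the tangent space of the cone at a general point
  (\<open>cone_tangent_dim\<close>). Every other coordinate \<open>j\<close> satisfies a separable relation \<open>G j \<in> P\<close> over the
  coordinates in \<open>S\<close>, which bounds the dimension from above. For the lower bound one needs enough
  derivations that preserve \<open>P\<close>. Implicit differentiation provides derivations that kill all \<open>G j\<close>, and
  such a derivation preserves \<open>P\<close> (\<open>stable_prime\<close>): the largest stable ideal inside \<open>P\<close> is again prime,
  as the characteristic is zero, and cannot be smaller than \<open>P\<close>, because modulo it everything is still
  algebraic over the coordinates in \<open>S\<close>.
\<close>

section \<open>Polynomials: evaluation, derivatives, supports\<close>

abbreviation (input) keys where "keys \<equiv> Poly_Mapping.keys"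
abbreviation (input) lookup where "lookup \<equiv> Poly_Mapping.lookup"
abbreviation (input) single where "single \<equiv> Poly_Mapping.single"

definition Var :: "'v \<Rightarrow> 'v cpoly" where
  "Var i = single (single i 1) 1"

definition Const :: "complex \<Rightarrow> 'v cpoly" where
  "Const c = single 0 c"

definition meval :: "('v \<Rightarrow> complex) \<Rightarrow> ('v \<Rightarrow>\<^sub>0 nat) \<Rightarrow> complex" where
  "meval x m = (\<Prod>i\<in>keys m. x i ^ lookup m i)"

lemma keys_mult_cases:
  assumes "m \<in> keys (f * g)"
  obtains a b where "a \<in> keys f" "b \<in> keys g" "m = a + b"
  using assms keys_mult[of f g] by blast

lemma keys_add_cases:
  assumes "m \<in> keys (f + g)"
  shows "m \<in> keys f \<or> m \<in> keys g"
  using assms Poly_Mapping.keys_add[of f g] by blast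

lemma keys_uminus_cpoly [simp]: "keys (- f :: 'v cpoly) = keys f"
  by (auto simp: in_keys_iff)

lemma keys_minus_cases:
  fixes f :: "'v cpoly"
  assumes "m \<in> keys (f - g)"
  shows "m \<in> keys f \<or> m \<in> keys g"
  using assms by (auto simp: in_keys_iff lookup_minus)

lemma keys_sum_cases:
  assumes "m \<in> keys (sum f I)"
  obtains i where "i \<in> I" "m \<in> keys (f i)"
  using assms
proof (induction I arbitrary: thesis rule: infinite_finite_induct)
  case (insert j I)
  then show ?case by (auto dest!: keys_add_cases)
qed auto

lemma sum_single: "f = (\<Sum>m\<in>keys f. single m (lookup f m))"
  by (rule poly_mapping_eqI)
    (simp add: lookup_sum lookup_single when_def in_keys_iff)

lemma cpoly_induct [case_names zero mono add]:
  fixes f :: "'a \<Rightarrow>\<^sub>0 'b::comm_monoid_add"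
  assumes "P 0" "\<And>m c. P (single m c)" "\<And>f g. P f \<Longrightarrow> P g \<Longrightarrow> P (f + g)"
  shows "P f"
proof -
  have "P (\<Sum>m\<in>M. single m (lookup f m))" if "finite M" for M
    using that by (induction M) (auto intro: assms)
  then show ?thesis by (metis sum_single finite_keys)
qed

lemma meval_superset:
  assumes "finite B" "keys m \<subseteq> B"
  shows "meval x m = (\<Prod>i\<in>B. x i ^ lookup m i)"
  unfolding meval_def using assms
  by (intro prod.mono_neutral_left) (auto simp: in_keys_iff)

lemma meval_0 [simp]: "meval x 0 = 1"
  by (simp add: meval_def)

lemma meval_single [simp]: "meval x (single i k) = x i ^ k"
  by (subst meval_superset[of "{i}"]) auto

lemma meval_add: "meval x (m + n) = meval x m * meval x n"
  by (subst (1 2 3) meval_superset[of "keys m \<union> keys n"])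
    (auto simp: lookup_add power_add prod.distrib dest: keys_add_cases)

lemma meval_sum: "meval x (sum f I) = (\<Prod>i\<in>I. meval x (f i))"
  by (induction I rule: infinite_finite_induct) (auto simp: meval_add)

lemma peval_superset:
  assumes "finite A" "keys f \<subseteq> A"
  shows "peval x f = (\<Sum>m\<in>A. lookup f m * meval x m)"
  unfolding peval_def meval_def using assms
  by (intro sum.mono_neutral_left) (auto simp: in_keys_iff)

lemma peval_0 [simp]: "peval x 0 = 0"
  by (simp add: peval_def)

lemma peval_single: "peval x (single m c) = c * meval x m"
  by (subst peval_superset[of "{m}"]) auto

lemma peval_add [simp]: "peval x (f + g) = peval x f + peval x g"
  by (subst (1 2 3) peval_superset[of "keys f \<union> keys g"])
    (auto simp: lookup_add algebra_simps sum.distrib dest: keys_add_cases)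

lemma peval_mult [simp]: "peval x (f * g) = peval x f * peval x g"
proof (induction f rule: cpoly_induct)
  case (mono m c)
  show ?case
    by (induction g rule: cpoly_induct)
      (auto simp: mult_single peval_single meval_add algebra_simps)
qed (auto simp: algebra_simps)

lemma peval_Var [simp]: "peval x (Var i) = x i"
  by (simp add: Var_def peval_single)

lemma peval_Const [simp]: "peval x (Const c) = c"
  by (simp add: Const_def peval_single)

lemma peval_1 [simp]: "peval x 1 = 1"
  by (metis peval_single meval_0 mult_1 single_one)

lemma peval_uminus [simp]: "peval x (- f) = - peval x f"
  by (metis add.inverse_inverse add_eq_0_iff peval_0 peval_add)

lemma peval_diff [simp]: "peval x (f - g) = peval x f - peval x g"
  by (metis diff_conv_add_uminus peval_add peval_uminus)

lemma peval_sum [simp]: "peval x (sum f I) = (\<Sum>i\<in>I. peval x (f i))"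
  by (induction I rule: infinite_finite_induct) auto

lemma peval_prod [simp]: "peval x (prod f I) = (\<Prod>i\<in>I. peval x (f i))"
  by (induction I rule: infinite_finite_induct) auto

lemma peval_power [simp]: "peval x (f ^ n) = peval x f ^ n"
  by (induction n) auto

lemma Var_power: "Var i ^ k = single (single i k) 1"
  by (induction k) (auto simp: Var_def mult_single simp flip: single_add)

lemma Const_mult: "Const c * single m d = single m (c * d)"
  by (simp add: Const_def mult_single)

lemma Const_times: "Const c * Const d = Const (c * d)"
  by (simp add: Const_def mult_single)

lemma Const_1: "Const 1 = 1"
  by (simp add: Const_def)

lemma Const_0 [simp]: "Const 0 = 0"
  by (simp add: Const_def)

lemma Const_sum: "(\<Sum>i\<in>I. Const (c i)) = Const (\<Sum>i\<in>I. c i)"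
  by (induction I rule: infinite_finite_induct) (auto simp: Const_def single_add)

lemma of_nat_Const: "of_nat n = Const (of_nat n)"
  by (simp add: Const_def)

lemma lookup_Const_mult: "lookup (Const c * f) m = c * lookup f m"
proof (induction f rule: cpoly_induct)
  case (mono n d)
  then show ?case by (simp add: Const_mult lookup_single when_def)
qed (auto simp: lookup_add algebra_simps)

lemma pdiff_superset:
  assumes "finite A" "keys f \<subseteq> A"
  shows "pdiff i f = (\<Sum>m\<in>A. single (m - single i 1) (of_nat (lookup m i) * lookup f m))"
  unfolding pdiff_def using assms
  by (intro sum.mono_neutral_left) (auto simp: in_keys_iff)

lemma pdiff_0 [simp]: "pdiff i 0 = 0"
  by (simp add: pdiff_def)

lemma pdiff_single: "pdiff i (single m c) = single (m - single i 1) (of_nat (lookup m i) * c)"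
  by (subst pdiff_superset[of "{m}"]) auto

lemma pdiff_add [simp]: "pdiff i (f + g) = pdiff i f + pdiff i g"
  by (subst (1 2 3) pdiff_superset[of "keys f \<union> keys g"])
    (auto simp: lookup_add algebra_simps sum.distrib single_add dest: keys_add_cases)

lemma minus_single_add:
  fixes m n :: "'v \<Rightarrow>\<^sub>0 nat"
  assumes "lookup m i \<noteq> 0"
  shows "m + n - single i 1 = (m - single i 1) + n"
  by (rule poly_mapping_eqI) (use assms in \<open>auto simp: lookup_add lookup_minus lookup_single when_def\<close>)

lemma pdiff_mult [simp]: "pdiff i (f * g) = pdiff i f * g + f * pdiff i g"
proof (induction f rule: cpoly_induct)
  case (mono m c)
  show ?case
  proof (induction g rule: cpoly_induct)
    case (mono n d)
    have 1: "single (m + n - single i 1) (of_nat (lookup m i) * (c * d))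
           = single (m - single i 1 + n) (of_nat (lookup m i) * (c * d))"
      using minus_single_add[of m i n] by (cases "lookup m i = 0") auto
    have 2: "single (m + n - single i 1) (of_nat (lookup n i) * (c * d))
           = single (m + (n - single i 1)) (of_nat (lookup n i) * (c * d))"
      using minus_single_add[of n i m] by (cases "lookup n i = 0") (auto simp: add.commute)
    have "pdiff i (single m c * single n d)
        = single (m + n - single i 1) (of_nat (lookup m i) * (c * d))
        + single (m + n - single i 1) (of_nat (lookup n i) * (c * d))"
      by (simp add: mult_single pdiff_single lookup_add distrib_right flip: single_add)
    then show ?case
      unfolding 1 2 by (simp add: mult_single pdiff_single ac_simps)
  qed (auto simp: algebra_simps)
qed (auto simp: algebra_simps)

lemma pdiff_Var: "pdiff i (Var j) = (if i = j then 1 else 0)"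
  by (auto simp: Var_def pdiff_single lookup_single when_def)

lemma pdiff_sum: "pdiff i (sum f I) = (\<Sum>j\<in>I. pdiff i (f j))"
  by (induction I rule: infinite_finite_induct) auto

lemma pdiff_Const [simp]: "pdiff i (Const c) = 0"
  by (simp add: Const_def pdiff_single)

lemma pdiff_not_in_vars:
  assumes "\<And>m. m \<in> keys f \<Longrightarrow> lookup m i = 0"
  shows "pdiff i f = 0"
  unfolding pdiff_def by (intro sum.neutral) (simp add: assms)

lemma lookup_pdiff:
  "lookup (pdiff i f) m = of_nat (lookup m i + 1) * lookup f (m + single i 1)"
proof (induction f rule: cpoly_induct)
  case (mono n c)
  have "n - single i 1 = m \<longleftrightarrow> n = m + single i 1" if "lookup n i \<noteq> 0"
    using that minus_single_add[of n i 0]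
    by (auto simp: poly_mapping_eq_iff fun_eq_iff lookup_add lookup_minus lookup_single when_def)
  moreover have "lookup n i \<noteq> 0" if "n = m + single i 1"
    using that by (simp add: lookup_add)
  ultimately show ?case
    by (auto simp: pdiff_single lookup_single when_def lookup_add)
qed (auto simp: lookup_add algebra_simps)

definition boxed :: "('v \<Rightarrow> nat) \<Rightarrow> 'v cpoly \<Rightarrow> bool" where
  "boxed b f \<longleftrightarrow> (\<forall>m\<in>keys f. \<forall>i. lookup m i \<le> b i)"

definition in_vars :: "'v set \<Rightarrow> 'v cpoly \<Rightarrow> bool" where
  "in_vars S f \<longleftrightarrow> (\<forall>m\<in>keys f. keys m \<subseteq> S)"

lemma boxed_0 [simp]: "boxed b 0" by (simp add: boxed_def)

lemma boxed_single: "(\<And>i. lookup m i \<le> b i) \<Longrightarrow> boxed b (single m c)"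
  by (auto simp: boxed_def)

lemma boxed_Const [simp]: "boxed b (Const c)" 
  by (auto simp: Const_def intro: boxed_single)

lemma boxed_1 [simp]: "boxed b 1" 
  by (metis boxed_Const Const_1)

lemma boxed_add: "boxed b f \<Longrightarrow> boxed b g \<Longrightarrow> boxed b (f + g)"
  by (auto simp: boxed_def dest!: keys_add_cases)

lemma boxed_uminus: "boxed b f \<Longrightarrow> boxed b (- f)"
  by (auto simp: boxed_def)

lemma boxed_mono: "boxed b f \<Longrightarrow> (\<And>i. b i \<le> c i) \<Longrightarrow> boxed c f"
  unfolding boxed_def by (meson order_trans)

lemma boxed_mult: "boxed b f \<Longrightarrow> boxed c g \<Longrightarrow> boxed (\<lambda>i. b i + c i) (f * g)"
  by (auto simp: boxed_def lookup_add add_mono elim!: keys_mult_cases)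

lemma boxed_mult': 
  "boxed b f \<Longrightarrow> boxed c g \<Longrightarrow> (\<And>i. b i + c i \<le> d i) \<Longrightarrow> boxed d (f * g)"
  by (rule boxed_mono[OF boxed_mult])

lemma boxed_power: "boxed b f \<Longrightarrow> boxed (\<lambda>i. n * b i) (f ^ n)"
  by (induction n) (auto intro: boxed_mult)

lemma boxed_prod: 
  "(\<And>i. i \<in> I \<Longrightarrow> boxed (b i) (f i)) \<Longrightarrow> boxed (\<lambda>j. \<Sum>i\<in>I. b i j) (prod f I)"
  by (induction I rule: infinite_finite_induct) (auto intro: boxed_mult)

lemma boxed_exists: "\<exists>b. boxed (\<lambda>_. b) (f :: 'v::finite cpoly)"
proof -
  let ?A = "\<Union>m\<in>keys f. range (lookup m)"
  have "lookup m i \<le> Max ?A" if "m \<in> keys f" for m i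
    using that by (intro Max_ge) auto
  then show ?thesis unfolding boxed_def by blast
qed

lemma in_vars_0 [simp]: "in_vars S 0" by (simp add: in_vars_def)

lemma in_vars_single: "keys m \<subseteq> S \<Longrightarrow> in_vars S (single m c)"
  by (auto simp: in_vars_def)

lemma in_vars_Var [simp]: "i \<in> S \<Longrightarrow> in_vars S (Var i)"
  by (auto simp: Var_def intro!: in_vars_single)

lemma in_vars_add: "in_vars S f \<Longrightarrow> in_vars S g \<Longrightarrow> in_vars S (f + g)"
  by (auto simp: in_vars_def dest!: keys_add_cases)

lemma in_vars_sum: "(\<And>i. i \<in> I \<Longrightarrow> in_vars S (f i)) \<Longrightarrow> in_vars S (sum f I)"
  by (induction I rule: infinite_finite_induct) (auto intro: in_vars_add)

lemma in_vars_pdiff: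
  assumes "in_vars S f" shows "in_vars S (pdiff i f)"
  unfolding pdiff_def
proof (intro in_vars_sum in_vars_single)
  fix m assume "m \<in> keys f"
  then have "keys m \<subseteq> S" using assms by (auto simp: in_vars_def)
  then show "keys (m - single i 1) \<subseteq> S"
    by (auto simp: in_keys_iff lookup_minus subset_iff)
qed

lemma homog_in_0 [simp]: "homog_in A d 0" by (simp add: homog_in_def)

lemma homog_in_single: "(\<Sum>i\<in>A. lookup m i) = d \<Longrightarrow> homog_in A d (single m c)"
  by (auto simp: homog_in_def)

lemma homog_in_Const [simp]: "homog_in A 0 (Const c)"
  by (auto simp: Const_def intro: homog_in_single)

lemma homog_in_1 [simp]: "homog_in A 0 1"
  by (metis homog_in_Const Const_1)

lemma homog_in_Var: "finite A \<Longrightarrow> homog_in A (if i \<in> A then 1 else 0) (Var i)"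
  by (auto simp: Var_def lookup_single when_def sum.delta intro!: homog_in_single)

lemma homog_in_Var_UNIV [simp]: "homog_in UNIV 1 (Var (i :: 'v::finite))" 
  using homog_in_Var[of UNIV i] by simp

lemma homog_in_add: "homog_in A d f \<Longrightarrow> homog_in A d g \<Longrightarrow> homog_in A d (f + g)"
  by (auto simp: homog_in_def dest!: keys_add_cases)

lemma homog_in_diff: "homog_in A d f \<Longrightarrow> homog_in A d g \<Longrightarrow> homog_in A d (f - g)"
  by (auto simp: homog_in_def dest!: keys_minus_cases)

lemma homog_in_sum: "(\<And>i. i \<in> I \<Longrightarrow> homog_in A d (f i)) \<Longrightarrow> homog_in A d (sum f I)"
  by (induction I rule: infinite_finite_induct) (auto intro: homog_in_add)

lemma homog_in_mult: "homog_in A d f \<Longrightarrow> homog_in A e g \<Longrightarrow> homog_in A (d + e) (f * g)"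
  by (auto simp: homog_in_def lookup_add sum.distrib elim!: keys_mult_cases)

lemma homog_in_power: "homog_in A d f \<Longrightarrow> homog_in A (n * d) (f ^ n)"
  by (induction n) (auto intro: homog_in_mult)

lemma homog_in_prod: 
  "(\<And>i. i \<in> I \<Longrightarrow> homog_in A (d i) (f i)) \<Longrightarrow> homog_in A (\<Sum>i\<in>I. d i) (prod f I)"
  by (induction I rule: infinite_finite_induct) (auto intro: homog_in_mult)

lemma peval_homog_scale:
  assumes "finite A" "homog_in A d f"
  shows "peval (\<lambda>i. if i \<in> A then c * x i else x i) f = c ^ d * peval x f"
proof -
  have "meval (\<lambda>i. if i \<in> A then c * x i else x i) m = c ^ d * meval x m" if "m \<in> keys f" for m
  proof -
    let ?B = "A \<union> keys m"
    have "(\<Prod>i\<in>?B. (if i \<in> A then c * x i else x i) ^ lookup m i)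
        = (\<Prod>i\<in>?B. (if i \<in> A then c ^ lookup m i else 1) * x i ^ lookup m i)"
      by (intro prod.cong) (auto simp: power_mult_distrib)
    also have "\<dots> = (\<Prod>i\<in>?B. if i \<in> A then c ^ lookup m i else 1) * meval x m"
      using assms(1) by (subst meval_superset[of ?B]) (auto simp: prod.distrib)
    also have "(\<Prod>i\<in>?B. if i \<in> A then c ^ lookup m i else 1) = (\<Prod>i\<in>A. c ^ lookup m i)"
      using assms(1) by (intro prod.mono_neutral_cong_right) auto
    also have "\<dots> = c ^ d"
      using assms(2) that by (auto simp: homog_in_def simp flip: power_sum)
    finally show ?thesis
      using assms(1) by (subst meval_superset[of ?B]) auto
  qed
  then show ?thesis
    by (simp add: peval_superset[OF finite_keys subset_refl] sum_distrib_left mult_ac cong: sum.cong)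
qed

lemma peval_scale:
  assumes "homog_in UNIV d f"
  shows "peval (($) (c *s v)) f = c ^ d * peval (($) v) f"
proof -
  have "(($) (c *s v)) = (\<lambda>i. if i \<in> UNIV then c * v $ i else v $ i)" by auto
  then show ?thesis using peval_homog_scale[of UNIV d f c "($) v"] assms by simp
qed

definition psubst :: "('v \<Rightarrow> 'w cpoly) \<Rightarrow> 'v cpoly \<Rightarrow> 'w cpoly" where
  "psubst \<phi> f = (\<Sum>m\<in>keys f. Const (lookup f m) * (\<Prod>i\<in>keys m. \<phi> i ^ lookup m i))"

lemma peval_psubst: "peval x (psubst \<phi> f) = peval (\<lambda>i. peval x (\<phi> i)) f"
  unfolding psubst_def peval_sum peval_mult peval_prod peval_power peval_Const
  by (simp add: peval_def[of _ f])

lemma homog_in_psubst: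
  assumes "homog_in B d f" "finite B"
    and "\<And>i. i \<in> B \<Longrightarrow> homog_in A 1 (\<phi> i)" "\<And>i. i \<notin> B \<Longrightarrow> homog_in A 0 (\<phi> i)"
  shows "homog_in A d (psubst \<phi> f)"
  unfolding psubst_def
proof (intro homog_in_sum)
  fix m assume m: "m \<in> keys f"
  have "homog_in A (lookup m i * (if i \<in> B then 1 else 0)) (\<phi> i ^ lookup m i)" for i
    using assms(3,4) by (intro homog_in_power) auto
  then have "homog_in A (0 + (\<Sum>i\<in>keys m. lookup m i * (if i \<in> B then 1 else 0)))
     (Const (lookup f m) * (\<Prod>i\<in>keys m. \<phi> i ^ lookup m i))"
    by (intro homog_in_mult homog_in_prod) auto
  also have "(\<Sum>i\<in>keys m. lookup m i * (if i \<in> B then 1 else 0)) = (\<Sum>i\<in>keys m \<union> B. lookup m i * (if i \<in> B then 1 else 0))"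
    using assms(2) by (intro sum.mono_neutral_left) (auto simp: in_keys_iff)
  also have "\<dots> = (\<Sum>i\<in>B. lookup m i)"
    using assms(2) by (intro sum.mono_neutral_cong_right) auto
  also have "\<dots> = d" using assms(1) m by (auto simp: homog_in_def)
  finally show "homog_in A d (Const (lookup f m) * (\<Prod>i\<in>keys m. \<phi> i ^ lookup m i))" by simp
qed

section \<open>Prime ideals and algebraic dependence\<close>

text \<open>Elimination of one unknown at a time. Index sets of variable size are needed below because the
  numbers of unknowns and of equations grow with a degree bound.\<close>

lemma homogeneous_linear_system:
  fixes c :: "'a \<Rightarrow> 'b \<Rightarrow> complex"
  assumes "finite B" "finite A" "card B < card A"
  shows "\<exists>x. (\<exists>i\<in>A. x i \<noteq> 0) \<and> (\<forall>j\<in>B. (\<Sum>i\<in>A. x i * c i j) = 0)"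
  using assms
proof (induction B arbitrary: A c rule: finite_induct)
  case empty
  then have "A \<noteq> {}" by auto
  then show ?case by (auto intro!: exI[of _ "\<lambda>_. 1"])
next
  case (insert b B)
  show ?case
  proof (cases "\<forall>i\<in>A. c i b = 0")
    case True
    obtain x where "\<exists>i\<in>A. x i \<noteq> 0" "\<forall>j\<in>B. (\<Sum>i\<in>A. x i * c i j) = 0"
      using insert.IH[of A c] insert.prems insert.hyps by auto
    with True show ?thesis by (intro exI[of _ x]) auto
  next
    case False
    then obtain k where k: "k \<in> A" "c k b \<noteq> 0" by auto
    \<comment> \<open>Solve equation \<open>b\<close> for unknown \<open>k\<close> and substitute into the other equations.\<close>
    define A' where "A' = A - {k}"
    have A': "finite A'" "card B < card A'" "A = insert k A'" "k \<notin> A'"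
      using insert.prems insert.hyps k by (auto simp: A'_def)
    obtain x where x: "\<exists>i\<in>A'. x i \<noteq> 0"
      "\<forall>j\<in>B. (\<Sum>i\<in>A'. x i * (c i j - c i b / c k b * c k j)) = 0"
      using insert.IH[OF A'(1,2), of "\<lambda>i j. c i j - c i b / c k b * c k j"] by auto
    define y where "y = x(k := - (\<Sum>i\<in>A'. x i * c i b) / c k b)"
    have y: "(\<Sum>i\<in>A. y i * c i j) = y k * c k j + (\<Sum>i\<in>A'. x i * c i j)" for j
    proof -
      have "(\<Sum>i\<in>A'. y i * c i j) = (\<Sum>i\<in>A'. x i * c i j)"
        using A'(4) by (intro sum.cong) (auto simp: y_def)
      then show ?thesis using A' by simp
    qed
    have "(\<Sum>i\<in>A. y i * c i j) = 0" if "j \<in> B" for j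
    proof -
      have "0 = (\<Sum>i\<in>A'. x i * c i j - x i * c i b * (c k j / c k b))"
        using x(2) that by (auto simp: algebra_simps)
      also have "\<dots> = (\<Sum>i\<in>A'. x i * c i j) - (\<Sum>i\<in>A'. x i * c i b) * (c k j / c k b)"
        by (simp add: sum_subtractf sum_distrib_right sum_divide_distrib)
      finally show ?thesis unfolding y by (simp add: y_def)
    qed
    moreover have "(\<Sum>i\<in>A. y i * c i b) = 0" unfolding y using k by (simp add: y_def)
    moreover have "\<exists>i\<in>A. y i \<noteq> 0" using x(1) A' by (auto simp: y_def)
    ultimately show ?thesis by (intro exI[of _ y]) auto
  qed
qed

lemma monomials_in_box:
  fixes b :: "'v \<Rightarrow> nat"
  assumes "finite S"
  defines "M \<equiv> {m :: 'v \<Rightarrow>\<^sub>0 nat. keys m \<subseteq> S \<and> (\<forall>i\<in>S. lookup m i \<le> b i)}"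
  shows "finite M" "card M = (\<Prod>i\<in>S. b i + 1)"
proof -
  have *: "lookup (\<Sum>i\<in>S. single i (f i)) j = (if j \<in> S then f j else 0)" for f :: "'v \<Rightarrow> nat" and j
    using assms(1) by (auto simp: lookup_sum lookup_single when_def sum.delta)
  have "bij_betw (\<lambda>m. restrict (lookup m) S) M (PiE S (\<lambda>i. {..b i}))"
  proof (rule bij_betw_byWitness[where f' = "\<lambda>f. \<Sum>i\<in>S. single i (f i)"])
    show "\<forall>m\<in>M. (\<Sum>i\<in>S. single i (restrict (lookup m) S i)) = m"
      by (auto simp: M_def poly_mapping_eq_iff fun_eq_iff * in_keys_iff)
    show "\<forall>f\<in>PiE S (\<lambda>i. {..b i}). restrict (lookup (\<Sum>i\<in>S. single i (f i))) S = f"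
      by (auto simp: fun_eq_iff * PiE_def extensional_def)
    show "(\<lambda>m. restrict (lookup m) S) ` M \<subseteq> PiE S (\<lambda>i. {..b i})"
      by (auto simp: M_def)
    show "(\<lambda>f. \<Sum>i\<in>S. single i (f i)) ` PiE S (\<lambda>i. {..b i}) \<subseteq> M"
      by (auto simp: M_def * in_keys_iff PiE_iff split: if_splits)
  qed
  from bij_betw_finite[OF this] bij_betw_same_card[OF this]
  show "finite M" "card M = (\<Prod>i\<in>S. b i + 1)"
    using assms(1) by (simp_all add: finite_PiE card_PiE)
qed

text \<open>Ideals are plain sets, so that the vanishing ideal of a variety and the largest differential
  ideal inside it can be interpreted side by side.\<close>

locale prime_cpoly_ideal =
  fixes Q :: "'v cpoly set"
  assumes zero [simp, intro]: "0 \<in> Q"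
    and add [intro]: "a \<in> Q \<Longrightarrow> b \<in> Q \<Longrightarrow> a + b \<in> Q"
    and mult [intro]: "a \<in> Q \<Longrightarrow> c * a \<in> Q"
    and one [simp]: "1 \<notin> Q"
    and prime: "a * b \<in> Q \<Longrightarrow> a \<in> Q \<or> b \<in> Q"
begin

lemma uminus: "a \<in> Q \<Longrightarrow> - a \<in> Q"
  using mult[of a "- 1"] by simp

lemma diff: "a \<in> Q \<Longrightarrow> b \<in> Q \<Longrightarrow> a - b \<in> Q"
  using add[OF _ uminus, of a b] by simp

lemma mult_right: "a \<in> Q \<Longrightarrow> a * c \<in> Q"
  by (metis mult mult.commute)

lemma sum_mem: "(\<And>i. i \<in> I \<Longrightarrow> f i \<in> Q) \<Longrightarrow> sum f I \<in> Q"
  by (induction I rule: infinite_finite_induct) auto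

lemma power_mem: "a ^ n \<in> Q \<Longrightarrow> a \<in> Q"
  by (induction n) (auto dest: prime)

lemma prod_mem: "prod f I \<in> Q \<Longrightarrow> \<exists>i\<in>I. f i \<in> Q"
  by (induction I rule: infinite_finite_induct) (auto dest: prime)

lemma Const_mem: "Const c \<in> Q \<Longrightarrow> c = 0"
  using mult[of "Const c" "Const (1 / c)"] by (cases "c = 0") (auto simp: Const_times Const_1)

lemma of_nat_mem: "of_nat k * a \<in> Q \<Longrightarrow> k \<noteq> 0 \<Longrightarrow> a \<in> Q"
  using prime[of "of_nat k" a] Const_mem[of "of_nat k"] by (auto simp: of_nat_Const)

text \<open>The coordinates in \<open>S\<close> are algebraically independent modulo \<open>Q\<close>; a maximal such \<open>S\<close> is a
  transcendence basis of the field of fractions modulo \<open>Q\<close>.\<close>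

definition independent :: "'v set \<Rightarrow> bool" where
  "independent S \<longleftrightarrow> (\<forall>F. in_vars S F \<longrightarrow> F \<in> Q \<longrightarrow> F = 0)"

lemma independent_Var:
  assumes "independent S" "i \<in> S" shows "Var i \<notin> Q"
proof
  assume "Var i \<in> Q"
  then have "Var i = (0 :: 'v cpoly)" using assms by (auto simp: independent_def)
  then have "peval (\<lambda>_. 1) (Var i :: 'v cpoly) = 0" by simp
  then show False by simp
qed

text \<open>An algebraic dependence of the coordinate \<open>j\<close> on those in \<open>S\<close>, sorted by powers of the coordinate
  \<open>j\<close>. By independence its leading coefficient does not vanish modulo \<open>Q\<close>, so it can be used to
  lower powers of that coordinate.\<close>

lemma leading_coefficient:
  assumes "independent S" "j \<notin> S" "G \<in> Q" "in_vars (insert j S) G" "G \<noteq> 0"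
  shows "\<exists>lc rest e. in_vars S lc \<and> lc \<notin> Q \<and> e > 0 \<and> in_vars (insert j S) rest \<and>
    (\<forall>m\<in>keys rest. lookup m j < e) \<and> lc * Var j ^ e + rest \<in> Q"
proof -
  define e where "e = Max ((\<lambda>m. lookup m j) ` keys G)"
  have "keys G \<noteq> {}" using assms(5) by (metis sum_single sum.empty)
  then have "e \<in> (\<lambda>m. lookup m j) ` keys G"
    unfolding e_def by (intro Max_in) auto
  then obtain m0 where m0: "m0 \<in> keys G" "lookup m0 j = e" by auto
  have le: "lookup m j \<le> e" if "m \<in> keys G" for m
    unfolding e_def using that by (intro Max_ge) auto
  have vars: "keys m \<subseteq> insert j S" if "m \<in> keys G" for m
    using assms(4) that by (auto simp: in_vars_def)
  define A where "A = {m \<in> keys G. lookup m j = e}"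
  define B where "B = {m \<in> keys G. lookup m j < e}"
  define lc where "lc = (\<Sum>m\<in>A. single (m - single j e) (lookup G m))"
  define rest where "rest = (\<Sum>m\<in>B. single m (lookup G m))"
  have recover: "(m - single j e) + single j e = m" if "m \<in> A" for m
    using that by (auto simp: A_def poly_mapping_eq_iff fun_eq_iff lookup_add lookup_minus lookup_single when_def)
  have "G = (\<Sum>m\<in>A. single m (lookup G m)) + rest"
  proof -
    have "keys G = A \<union> B" "A \<inter> B = {}" "finite A" "finite B"
      using le by (force simp: A_def B_def)+
    then show ?thesis unfolding rest_def
      by (subst sum_single[of G]) (simp add: sum.union_disjoint)
  qed
  also have "(\<Sum>m\<in>A. single m (lookup G m)) = lc * Var j ^ e"
    unfolding lc_def Var_power sum_distrib_right mult_single
    by (intro sum.cong) (auto simp: recover)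
  finally have G: "G = lc * Var j ^ e + rest" .
  have lcS: "in_vars S lc" unfolding lc_def
  proof (intro in_vars_sum in_vars_single)
    fix m assume "m \<in> A"
    then show "keys (m - single j e) \<subseteq> S"
      using vars[of m] by (auto simp: A_def in_keys_iff lookup_minus lookup_single when_def subset_iff split: if_splits)
  qed
  have "lookup lc (m0 - single j e) = lookup G m0"
  proof -
    have "lookup lc (m0 - single j e) = (\<Sum>m\<in>A. if m = m0 then lookup G m else 0)"
      unfolding lc_def lookup_sum lookup_single when_def
    proof (intro sum.cong if_cong refl)
      fix m assume "m \<in> A"
      moreover have "m0 \<in> A" using m0 by (auto simp: A_def)
      ultimately show "(m - single j e = m0 - single j e) = (m = m0)" using recover by metis
    qed
    also have "\<dots> = lookup G m0" using m0 by (simp add: A_def)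
    finally show ?thesis .
  qed
  then have "lc \<noteq> 0" using m0 by (auto simp: in_keys_iff)
  then have lcQ: "lc \<notin> Q" using assms(1) lcS by (auto simp: independent_def)
  have "e > 0"
  proof (rule ccontr)
    assume "\<not> e > 0"
    then have "B = {}" by (auto simp: B_def)
    then have "G = lc" using G \<open>\<not> e > 0\<close> by (simp add: rest_def)
    then show False using lcQ assms(3) by simp
  qed
  have restS: "in_vars (insert j S) rest" unfolding rest_def
    by (intro in_vars_sum in_vars_single vars) (auto simp: B_def)
  have "lookup m j < e" if "m \<in> keys rest" for m
    using that unfolding rest_def by (auto simp: B_def elim!: keys_sum_cases split: if_splits)
  then show ?thesis using lcS lcQ \<open>e > 0\<close> restS G assms(3) by metis
qed

end

text \<open>Powers of a coordinate outside \<open>S\<close> are lowered by means of its relation, at the price of a factor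
  that is nonzero modulo \<open>Q\<close>. Each multiplication by a coordinate costs one
  factor equal to the product of all leading coefficients and raises the exponents in \<open>S\<close> by a
  bounded amount, so the exponents in \<open>S\<close> grow only linearly with the degree. This is the upper
  bound for the growth of the coordinate ring by a power of exponent \<open>card S\<close>.\<close>

lemma (in prime_cpoly_ideal) reduction_bound:
  fixes S :: "'v set"
  assumes fin: "finite (UNIV :: 'v set)"
    and e: "\<And>j. j \<notin> S \<Longrightarrow> e j > 0"
    and lcQ: "\<And>j. j \<notin> S \<Longrightarrow> lc j \<notin> Q"
    and lc: "\<And>j. j \<notin> S \<Longrightarrow> boxed (\<lambda>i. if i \<in> S then a else 0) (lc j)"
    and rest: "\<And>j. j \<notin> S \<Longrightarrow>
          boxed (\<lambda>i. if i \<in> S then a else if i = j then e j - 1 else 0) (rest j)"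
    and G: "\<And>j. j \<notin> S \<Longrightarrow> lc j * Var j ^ e j + rest j \<in> Q"
  shows "\<exists>A. \<forall>M. \<exists>E. E \<notin> Q \<and> (\<forall>f. boxed (\<lambda>_. M) f \<longrightarrow>
           (\<exists>g. boxed (\<lambda>i. if i \<in> S then A * M else e i - 1) g \<and> E * f - g \<in> Q))"
proof -
  define bx where "bx K = (\<lambda>i. if i \<in> S then K else e i - 1)" for K :: nat
  define Red where "Red K = {f. \<exists>g. boxed (bx K) g \<and> f - g \<in> Q}" for K
  define N where "N = card (UNIV :: 'v set)"
  define E where "E = (\<Prod>j\<in>-S. lc j)"
  \<comment> \<open>An increment that covers one factor \<open>E\<close>, one use of a relation, and one more coordinate.\<close>
  define A where "A = N * a + a + 1"
  have finS: "finite (- S)" by (rule finite_subset[OF subset_UNIV fin])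
  have EQ: "E \<notin> Q" unfolding E_def using prod_mem[of lc "- S"] lcQ by auto
  have EN: "card I * a \<le> N * a" for I :: "'v set"
    unfolding N_def by (intro mult_right_mono card_mono fin subset_UNIV) simp
  have boxprod: "boxed (\<lambda>i. if i \<in> S then N * a else 0) (\<Prod>j\<in>I. lc j)" if "I \<subseteq> - S" for I
  proof -
    have "boxed (\<lambda>i. \<Sum>j\<in>I. if i \<in> S then a else 0) (\<Prod>j\<in>I. lc j)"
      using that lc by (intro boxed_prod) auto
    then show ?thesis by (rule boxed_mono) (use EN[of I] in simp)
  qed
  have Ebox: "boxed (\<lambda>i. if i \<in> S then N * a else 0) E"
    unfolding E_def by (rule boxprod) auto
  have RedE: "\<exists>g. boxed (bx K) g \<and> f - g \<in> Q" if "f \<in> Red K" for f K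
    using that unfolding Red_def by blast
  have Red_add: "f + g \<in> Red K" if "f \<in> Red K" "g \<in> Red K" for f g K
  proof -
    from RedE[OF that(1)] RedE[OF that(2)] obtain f' g' where *: "boxed (bx K) f'" "f - f' \<in> Q" "boxed (bx K) g'" "g - g' \<in> Q" by blast
    have "(f + g) - (f' + g') = (f - f') + (g - g')" by (simp add: algebra_simps)
    with * show ?thesis unfolding Red_def
      by (intro CollectI exI[of _ "f' + g'"] conjI boxed_add) (simp_all only: add)
  qed
  have Red_0: "0 \<in> Red K" for K
    unfolding Red_def by (auto intro!: exI[of _ 0])
  have Red_sum: "sum f I \<in> Red K" if "\<And>i. i \<in> I \<Longrightarrow> f i \<in> Red K" for f and I :: "('v \<Rightarrow>\<^sub>0 nat) set" and K
    using that by (induction I rule: infinite_finite_induct) (auto intro: Red_0 Red_add)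
  have Red_cong: "f \<in> Red K" if "g \<in> Red K" "f - g \<in> Q" for f g K
  proof -
    from RedE[OF that(1)] obtain g' where *: "boxed (bx K) g'" "g - g' \<in> Q" by blast
    have "f - g' = (f - g) + (g - g')" by (simp add: algebra_simps)
    then have "f - g' \<in> Q" using *(2) that(2) by (simp only: add)
    with * show ?thesis unfolding Red_def by blast
  qed
  have Red_boxed: "f \<in> Red K" if "boxed (bx K) f" for f K
    unfolding Red_def using that by (auto intro!: exI[of _ f])
  have step_mono: "E * Var j * single m c \<in> Red (K + A)"
    if m: "\<And>i. lookup m i \<le> bx K i" for m c j K
  proof (cases "j \<in> S \<or> lookup m j + 1 < e j")
    case True
    have "boxed (\<lambda>i. lookup m i + (if i = j then 1 else 0)) (Var j * single m c)"
      unfolding Var_def mult_single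
      by (rule boxed_single) (auto simp: lookup_add lookup_single when_def)
    with Ebox have "boxed (bx (K + A)) (E * (Var j * single m c))"
    proof (rule boxed_mult')
      fix i show "(if i \<in> S then N * a else 0) + (lookup m i + (if i = j then 1 else 0)) \<le> bx (K + A) i"
        using m[of i] True by (auto simp: bx_def A_def split: if_splits)
    qed
    then show ?thesis by (intro Red_boxed) (simp add: mult.assoc)
  next
    case False
    then have j: "j \<notin> S" "lookup m j = e j - 1" using m[of j] e[of j] by (auto simp: bx_def)
    \<comment> \<open>The product contains the power \<open>e j\<close> of the coordinate, which the relation for \<open>j\<close> rewrites.\<close>
    define m' where "m' = m - single j (e j - 1)"
    have m': "lookup m' i = (if i = j then 0 else lookup m i)" for i
      using j by (auto simp: m'_def lookup_minus lookup_single when_def)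
    have "single j 1 + m = single j (e j) + m'"
      using j e[OF j(1)] 
      by (auto simp: poly_mapping_eq_iff fun_eq_iff lookup_add lookup_single when_def m')
    then have V: "Var j * single m c = Var j ^ e j * single m' c"
      unfolding Var_power by (simp add: Var_def mult_single)
    define E' where "E' = (\<Prod>l\<in>-S - {j}. lc l)"
    have E: "E = lc j * E'" unfolding E_def E'_def using j finS by (intro prod.remove) auto
    have bx: "boxed (bx (K + A)) (E' * (single m' c * (- rest j)))"
    proof (rule boxed_mult'[OF boxprod[of "-S - {j}", folded E'_def] boxed_mult])
      show "boxed (lookup m') (single m' c)" by (rule boxed_single) simp
      show "boxed (\<lambda>i. if i \<in> S then a else if i = j then e j - 1 else 0) (- rest j)"
        using rest j boxed_uminus by blast
      fix i
      show "(if i \<in> S then N * a else 0) + (lookup m' i + (if i \<in> S then a else if i = j then e j - 1 else 0))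
         \<le> bx (K + A) i"
        using m[of i] j by (auto simp: bx_def A_def m')
    qed auto
    have "E * Var j * single m c - E' * (single m' c * (- rest j))
       = (E' * single m' c) * (lc j * Var j ^ e j + rest j)"
    proof -
      have "E * Var j * single m c = lc j * E' * (Var j ^ e j * single m' c)"
        unfolding E V[symmetric] by (simp add: mult_ac)
      then show ?thesis by (simp add: algebra_simps)
    qed
    also have "\<dots> \<in> Q" by (rule mult[OF G[OF j(1)]])
    finally show ?thesis by (rule Red_cong[OF Red_boxed[OF bx]])
  qed
  have step: "E * Var j * f \<in> Red (K + A)" if "f \<in> Red K" for f j K
  proof -
    from RedE[OF that] obtain g where g: "boxed (bx K) g" "f - g \<in> Q" by blast
    have "E * Var j * g = (\<Sum>m\<in>keys g. E * Var j * single m (lookup g m))"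
      by (subst sum_single[of g]) (simp add: sum_distrib_left)
    also have "\<dots> \<in> Red (K + A)"
      using g(1) by (intro Red_sum step_mono) (auto simp: boxed_def)
    finally have "E * Var j * g \<in> Red (K + A)" .
    moreover have "E * Var j * f - E * Var j * g \<in> Q"
      using mult[OF g(2), of "E * Var j"] by (simp add: algebra_simps)
    ultimately show ?thesis by (rule Red_cong)
  qed
  have stepE: "E * f \<in> Red (K + A)" if "f \<in> Red K" for f K
  proof -
    from RedE[OF that] obtain g where g: "boxed (bx K) g" "f - g \<in> Q" by blast
    from Ebox g(1) have "boxed (bx (K + A)) (E * g)"
      by (rule boxed_mult') (auto simp: bx_def A_def)
    moreover have "E * f - E * g \<in> Q"
      using mult[OF g(2), of "E"] by (simp add: algebra_simps)
    ultimately show ?thesis using Red_boxed Red_cong by blast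
  qed
  have mono: "E ^ n * single m c \<in> Red (A * n)" if "sum (lookup m) UNIV = n" for n m c
    using that
  proof (induction n arbitrary: m)
    case 0
    then have "\<And>i. lookup m i = 0" using fin by simp
    then show ?case by (intro Red_boxed) (auto intro: boxed_single)
  next
    case (Suc n)
    then obtain j where j: "lookup m j \<noteq> 0" by (metis sum.neutral nat.distinct(1))
    define m' where "m' = m - single j 1"
    have m: "m = single j 1 + m'"
      using j by (auto simp: m'_def poly_mapping_eq_iff fun_eq_iff lookup_add lookup_minus lookup_single when_def)
    have "sum (lookup m') UNIV = n"
    proof -
      have "sum (lookup m) UNIV = (\<Sum>i\<in>UNIV. (if i = j then 1 else 0) + lookup m' i)"
        by (intro sum.cong) (auto simp: m lookup_add lookup_single when_def)
      also have "\<dots> = 1 + sum (lookup m') UNIV" using fin by (simp add: sum.distrib)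
      finally show ?thesis using Suc.prems by simp
    qed
    then have "E * Var j * (E ^ n * single m' c) \<in> Red (A * n + A)"
      using Suc.IH step by blast
    moreover have "E * Var j * (E ^ n * single m' c) = E ^ Suc n * single m c"
    proof -
      have "single m c = Var j * single m' c" by (simp add: m Var_def mult_single)
      then show ?thesis by (simp add: mult_ac)
    qed
    ultimately show ?case by (simp add: algebra_simps)
  qed
  have power: "E ^ k * f \<in> Red (K + A * k)" if "f \<in> Red K" for f K k
  proof (induction k)
    case (Suc k)
    then show ?case using stepE[OF Suc] by (simp add: algebra_simps)
  qed (use that in auto)
  have main: "E ^ (N * M) * f \<in> Red (A * N * M)" if "boxed (\<lambda>_. M) f" for M f
  proof -
    have "E ^ (N * M) * single m (lookup f m) \<in> Red (A * N * M)" if m: "m \<in> keys f" for m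
    proof -
      define n where "n = sum (lookup m) UNIV"
      have "n \<le> N * M" unfolding n_def N_def
        using \<open>boxed _ f\<close> m by (intro sum_bounded_above[of UNIV "lookup m" M, simplified]) (auto simp: boxed_def)
      then have N: "N * M = (N * M - n) + n" by simp
      have "E ^ (N * M - n) * (E ^ n * single m (lookup f m)) \<in> Red (A * n + A * (N * M - n))"
        by (intro power mono) (simp add: n_def)
      also have "A * n + A * (N * M - n) = A * N * M"
        using \<open>n \<le> N * M\<close> by (simp add: mult.assoc flip: distrib_left)
      also have "E ^ (N * M - n) * (E ^ n * single m (lookup f m)) = E ^ (N * M) * single m (lookup f m)"
        by (subst (2) N) (simp add: power_add mult.assoc)
      finally show ?thesis .
    qed
    then have "(\<Sum>m\<in>keys f. E ^ (N * M) * single m (lookup f m)) \<in> Red (A * N * M)"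
      by (rule Red_sum)
    then show ?thesis by (subst sum_single[of f]) (simp add: sum_distrib_left)
  qed
  have "E ^ (N * M) \<notin> Q" for M using power_mem EQ by blast
  moreover have "\<exists>g. boxed (\<lambda>i. if i \<in> S then A * N * M else e i - 1) g \<and> E ^ (N * M) * f - g \<in> Q"
    if "boxed (\<lambda>_. M) f" for M f
    using main[OF that] by (auto simp: Red_def bx_def)
  ultimately show ?thesis by (intro exI[of _ "A * N"]) blast
qed

text \<open>The transcendence degree is at most \<open>card S\<close>, in a form that avoids fields of fractions and the
  exchange property: by the preceding bound, polynomials of degree linear in \<open>m\<close> span modulo \<open>Q\<close> a
  space of dimension of order \<open>m\<close> to the power \<open>card S\<close>, so \<open>(m + 1) ^ (card S + 1)\<close> of them are
  dependent for large \<open>m\<close>.\<close>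

lemma (in prime_cpoly_ideal) dependence_by_counting:
  fixes S :: "'v set" and D :: nat
  assumes fin: "finite (UNIV :: 'v set)"
    and ind: "independent S"
    and alg: "\<And>j. j \<notin> S \<Longrightarrow> \<exists>G\<in>Q. in_vars (insert j S) G \<and> G \<noteq> 0"
  shows "\<exists>m. \<forall>T (p :: 't \<Rightarrow> 'v cpoly). finite T \<longrightarrow> card T = (m + 1) ^ (card S + 1) \<longrightarrow>
      (\<forall>t\<in>T. boxed (\<lambda>_. m * D) (p t)) \<longrightarrow>
      (\<exists>x. (\<exists>t\<in>T. x t \<noteq> 0) \<and> (\<Sum>t\<in>T. Const (x t) * p t) \<in> Q)"
proof -
  have "\<forall>j. \<exists>lc rest e. j \<notin> S \<longrightarrow> in_vars S lc \<and> lc \<notin> Q \<and> e > 0 \<and> in_vars (insert j S) rest \<and>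
    (\<forall>m\<in>keys rest. lookup m j < e) \<and> lc * Var j ^ e + rest \<in> Q"
    using alg leading_coefficient[OF ind] by metis
  then obtain lc rest e where *: "\<And>j. j \<notin> S \<Longrightarrow> in_vars S (lc j) \<and> lc j \<notin> Q \<and> e j > 0 \<and>
    in_vars (insert j S) (rest j) \<and>
    (\<forall>m\<in>keys (rest j). lookup m j < e j) \<and> lc j * Var j ^ e j + rest j \<in> Q" by metis
  define a where "a = Max (insert 0 (\<Union>j. \<Union>f\<in>{lc j, rest j}. \<Union>m\<in>keys f. lookup m ` UNIV))"
  have a: "lookup m i \<le> a" if "m \<in> keys (lc j) \<or> m \<in> keys (rest j)" for m i j
  proof -
    have "lookup m i \<in> insert 0 (\<Union>j. \<Union>f\<in>{lc j, rest j}. \<Union>m\<in>keys f. lookup m ` UNIV)"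
      using that by blast
    then show ?thesis unfolding a_def using fin by (intro Max_ge) auto
  qed
  have "\<exists>A. \<forall>M. \<exists>E. E \<notin> Q \<and> (\<forall>f. boxed (\<lambda>_. M) f \<longrightarrow>
           (\<exists>g. boxed (\<lambda>i. if i \<in> S then A * M else e i - 1) g \<and> E * f - g \<in> Q))"
  proof (rule reduction_bound[OF fin, of S e lc a rest])
    fix j assume j: "j \<notin> S"
    show "boxed (\<lambda>i. if i \<in> S then a else 0) (lc j)"
      unfolding boxed_def
    proof (intro ballI allI)
      fix m i assume m: "m \<in> keys (lc j)"
      then have "keys m \<subseteq> S" using *[OF j] by (auto simp: in_vars_def)
      then show "lookup m i \<le> (if i \<in> S then a else 0)"
        using a[of m j i] m by (auto simp: in_keys_iff)
    qed
    have "lookup m i \<le> (if i \<in> S then a else if i = j then e j - 1 else 0)" if m: "m \<in> keys (rest j)" for m i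
    proof -
      have "lookup m j < e j" "keys m \<subseteq> insert j S" using *[OF j] m by (auto simp: in_vars_def)
      then show ?thesis using a[of m j i] m by (auto simp: in_keys_iff)
    qed
    then show "boxed (\<lambda>i. if i \<in> S then a else if i = j then e j - 1 else 0) (rest j)"
      by (auto simp: boxed_def)
  qed (use * in auto)
  then obtain A where A: "\<And>M. \<exists>E. E \<notin> Q \<and> (\<forall>f. boxed (\<lambda>_. M) f \<longrightarrow>
           (\<exists>g. boxed (\<lambda>i. if i \<in> S then A * M else e i - 1) g \<and> E * f - g \<in> Q))" by blast
  \<comment> \<open>The box has at most \<open>W * (A * (m * D) + 1) ^ card S\<close> monomials, and \<open>m\<close> is chosen so that the additional factor \<open>m + 1\<close> beats the constants.\<close>
  define W where "W = (\<Prod>j\<in>-S. e j)"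
  define m where "m = (A * D + 1) ^ card S * W"
  define b where "b = (\<lambda>i. if i \<in> S then A * (m * D) else e i - 1)"
  define Box where "Box = {n :: 'v \<Rightarrow>\<^sub>0 nat. keys n \<subseteq> UNIV \<and> (\<forall>i\<in>UNIV. lookup n i \<le> b i)}"
  have Box: "finite Box" "card Box = (\<Prod>i\<in>UNIV. b i + 1)"
    unfolding Box_def using monomials_in_box[OF fin] by blast+
  have "card Box < (m + 1) ^ (card S + 1)"
  proof -
    have "card Box = (\<Prod>i\<in>S. b i + 1) * (\<Prod>i\<in>-S. b i + 1)"
      unfolding Box(2) using finite_subset[OF subset_UNIV fin]
      by (subst prod.union_disjoint[symmetric]) auto
    also have "(\<Prod>i\<in>-S. b i + 1) = W"
      unfolding W_def using * by (intro prod.cong) (auto simp: b_def)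
    also have "(\<Prod>i\<in>S. b i + 1) = (A * (m * D) + 1) ^ card S"
      by (simp add: b_def)
    also have "\<dots> * W \<le> ((A * D + 1) * (m + 1)) ^ card S * W"
      by (intro mult_right_mono power_mono) (auto simp: algebra_simps)
    also have "\<dots> = m * (m + 1) ^ card S" by (simp only: power_mult_distrib m_def mult_ac)
    also have "\<dots> < (m + 1) ^ (card S + 1)" by simp
    finally show ?thesis .
  qed
  note small = this
  show ?thesis
  proof (intro exI[of _ m] allI impI)
    fix T :: "'t set" and p :: "'t \<Rightarrow> 'v cpoly"
    assume T: "finite T" "card T = (m + 1) ^ (card S + 1)" "\<forall>t\<in>T. boxed (\<lambda>_. m * D) (p t)"
    obtain E where E: "E \<notin> Q" "\<And>f. boxed (\<lambda>_. m * D) f \<Longrightarrow>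
           (\<exists>g. boxed b g \<and> E * f - g \<in> Q)"
      using A[of "m * D"] unfolding b_def by blast
    have "\<forall>t\<in>T. \<exists>g. boxed b g \<and> E * p t - g \<in> Q"
      using E(2) T(3) by blast
    then obtain g where "\<forall>t\<in>T. boxed b (g t) \<and> E * p t - g t \<in> Q"
      by (rule bchoice[THEN exE])
    then have g: "\<And>t. t \<in> T \<Longrightarrow> boxed b (g t)" "\<And>t. t \<in> T \<Longrightarrow> E * p t - g t \<in> Q"
      by auto
    obtain x where x: "\<exists>t\<in>T. x t \<noteq> 0" "\<forall>n\<in>Box. (\<Sum>t\<in>T. x t * lookup (g t) n) = 0"
      using homogeneous_linear_system[OF Box(1) T(1), of "\<lambda>t. lookup (g t)"] small T(2) by auto
    have "(\<Sum>t\<in>T. Const (x t) * g t) = 0"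
    proof (rule poly_mapping_eqI)
      fix n
      have "(\<Sum>t\<in>T. x t * lookup (g t) n) = 0"
      proof (cases "n \<in> Box")
        case False
        then have "lookup (g t) n = 0" if "t \<in> T" for t
          using g(1)[OF that] by (auto simp: boxed_def Box_def in_keys_iff)
        then show ?thesis by simp
      qed (use x in auto)
      then show "lookup (\<Sum>t\<in>T. Const (x t) * g t) n = lookup 0 n"
        by (simp add: lookup_sum lookup_Const_mult)
    qed
    moreover have "(\<Sum>t\<in>T. Const (x t) * (E * p t - g t))
        = E * (\<Sum>t\<in>T. Const (x t) * p t) - (\<Sum>t\<in>T. Const (x t) * g t)"
      by (simp add: sum_distrib_left right_diff_distrib sum_subtractf mult.left_commute)
    ultimately have "E * (\<Sum>t\<in>T. Const (x t) * p t) = (\<Sum>t\<in>T. Const (x t) * (E * p t - g t))"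
      by simp
    also have "\<dots> \<in> Q" using g(2) by (intro sum_mem mult) auto
    finally have "(\<Sum>t\<in>T. Const (x t) * p t) \<in> Q" using prime E(1) by blast
    with x(1) show "\<exists>x. (\<exists>t\<in>T. x t \<noteq> 0) \<and> (\<Sum>t\<in>T. Const (x t) * p t) \<in> Q" by blast
  qed
qed

section \<open>Derivations preserve prime ideals\<close>

text \<open>The examples that matter are linear combinations of partial derivatives with polynomial
  coefficients, that is, polynomial vector fields.\<close>

locale cpoly_derivation =
  fixes D :: "'v cpoly \<Rightarrow> 'v cpoly"
  assumes add: "D (a + b) = D a + D b"
    and mult: "D (a * b) = D a * b + a * D b"
begin

lemma zero: "D 0 = 0"
  using add[of 0 0] by simp

lemma iterate_add: "(D ^^ n) (a + b) = (D ^^ n) a + (D ^^ n) b"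
  by (induction n) (auto simp: add)

lemma iterate_0: "(D ^^ n) 0 = 0"
  by (induction n) (auto simp: zero)

lemma iterate_mult_mem:
  assumes "prime_cpoly_ideal P" "\<And>j. j \<le> k \<Longrightarrow> (D ^^ j) b \<in> P"
  shows "(D ^^ k) (a * b) \<in> P"
  using assms(2)
proof (induction k arbitrary: a b)
  case 0
  from 0[of 0] show ?case using prime_cpoly_ideal.mult[OF assms(1)] by auto
next
  case (Suc k)
  have "(D ^^ j) (D b) \<in> P" if "j \<le> k" for j
    using Suc.prems[of "Suc j"] that by (simp add: funpow_swap1)
  then have "(D ^^ k) (D a * b) \<in> P" "(D ^^ k) (a * D b) \<in> P"
    using Suc.prems by (auto intro!: Suc.IH)
  then show ?case
    using prime_cpoly_ideal.add[OF assms(1)] by (simp add: funpow_swap1 mult iterate_add)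
qed

text \<open>If \<open>n\<close> and \<open>m\<close> are the numbers of derivations that \<open>a\<close> and \<open>b\<close> stay in \<open>P\<close>, then by the rule of
  Leibniz every term of the derivative of order \<open>n + m\<close> of the product lies in \<open>P\<close>, except the one
  displayed. Splitting off one derivation at a time gives the binomial coefficient by the rule of
  Pascal.\<close>

lemma iterate_mult_leading_term:
  assumes "prime_cpoly_ideal P"
    and "\<And>i. i < n \<Longrightarrow> (D ^^ i) a \<in> P" "\<And>j. j < m \<Longrightarrow> (D ^^ j) b \<in> P"
  shows "(D ^^ (n + m)) (a * b) - of_nat ((n + m) choose n) * ((D ^^ n) a * (D ^^ m) b) \<in> P"
  using assms(2,3)
proof (induction "n + m" arbitrary: n m a b)
  case 0
  then show ?case using prime_cpoly_ideal.zero[OF assms(1)] by simp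
next
  case (Suc N)
  interpret P: prime_cpoly_ideal P by fact
  have Da: "(D ^^ i) (D a) \<in> P" if "Suc i < n" for i
    using Suc.prems(1)[of "Suc i"] that by (simp add: funpow_swap1)
  have Db: "(D ^^ i) (D b) \<in> P" if "Suc i < m" for i
    using Suc.prems(2)[of "Suc i"] that by (simp add: funpow_swap1)
  have eq: "(D ^^ (n + m)) (a * b) = (D ^^ N) (D a * b) + (D ^^ N) (a * D b)"
    by (simp add: Suc.hyps(2)[symmetric] funpow_swap1 mult iterate_add)
  let ?z = "(D ^^ n) a * (D ^^ m) b"
  have left: "(D ^^ N) (D a * b) - of_nat (if n = 0 then 0 else N choose (n - 1)) * ?z \<in> P"
  proof (cases n)
    case 0
    have "(D ^^ N) (D a * b) \<in> P"
      by (rule iterate_mult_mem[OF assms(1)]) (use Suc 0 in auto)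
    then show ?thesis using 0 by simp
  next
    case (Suc n')
    have "(D ^^ (n' + m)) (D a * b) - of_nat ((n' + m) choose n') * ((D ^^ n') (D a) * (D ^^ m) b) \<in> P"
      using Suc Suc.hyps(2) \<open>Suc N = n + m\<close> Da Suc.prems by (intro Suc.hyps(1)) auto
    then show ?thesis using Suc \<open>Suc N = n + m\<close> by (simp add: funpow_swap1)
  qed
  have right: "(D ^^ N) (a * D b) - of_nat (if m = 0 then 0 else N choose n) * ?z \<in> P"
  proof (cases m)
    case 0
    have "(D ^^ N) (D b * a) \<in> P"
      by (rule iterate_mult_mem[OF assms(1)]) (use Suc 0 in auto)
    then show ?thesis using 0 by (simp add: mult.commute)
  next
    case (Suc m')
    have "(D ^^ (n + m')) (a * D b) - of_nat ((n + m') choose n) * ((D ^^ n) a * (D ^^ m') (D b)) \<in> P"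
      using Suc Suc.hyps(2) \<open>Suc N = n + m\<close> Db Suc.prems by (intro Suc.hyps(1)) auto
    then show ?thesis using Suc \<open>Suc N = n + m\<close> by (simp add: funpow_swap1)
  qed
  have "(if n = 0 then 0 else N choose (n - 1)) + (if m = 0 then 0 else N choose n) = (n + m) choose n"
    using Suc.hyps(2) by (cases n; cases m) (auto simp: binomial_eq_0)
  then have "of_nat ((n + m) choose n) = (of_nat (if n = 0 then 0 else N choose (n - 1))
      + of_nat (if m = 0 then 0 else N choose n) :: 'v cpoly)"
    by (metis of_nat_add)
  then have "(D ^^ (n + m)) (a * b) - of_nat ((n + m) choose n) * ?z
    = ((D ^^ N) (D a * b) - of_nat (if n = 0 then 0 else N choose (n - 1)) * ?z)
    + ((D ^^ N) (a * D b) - of_nat (if m = 0 then 0 else N choose n) * ?z)"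
    unfolding eq by (simp only: algebra_simps)
  then show ?case using P.add[OF left right] by (simp only:)
qed

text \<open>The argument of Gauss's lemma with orders of derivatives in the role of degrees; characteristic
  zero makes the binomial coefficient invertible.\<close>

lemma prime_differential_core:
  assumes "prime_cpoly_ideal P"
  shows "prime_cpoly_ideal {a. \<forall>n. (D ^^ n) a \<in> P}"
proof -
  interpret P: prime_cpoly_ideal P by fact
  show ?thesis
  proof
    show "0 \<in> {a. \<forall>n. (D ^^ n) a \<in> P}" by (simp add: iterate_0)
  next
    fix a b assume "a \<in> {a. \<forall>n. (D ^^ n) a \<in> P}" "b \<in> {a. \<forall>n. (D ^^ n) a \<in> P}"
    then show "a + b \<in> {a. \<forall>n. (D ^^ n) a \<in> P}" by (auto simp: iterate_add)
  next
    fix a c assume "a \<in> {a. \<forall>n. (D ^^ n) a \<in> P}"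
    then show "c * a \<in> {a. \<forall>n. (D ^^ n) a \<in> P}"
      using iterate_mult_mem[OF assms] by auto
  next
    have "(D ^^ 0) 1 \<notin> P" by simp
    then show "1 \<notin> {a. \<forall>n. (D ^^ n) a \<in> P}" by blast
  next
    fix a b assume ab: "a * b \<in> {a. \<forall>n. (D ^^ n) a \<in> P}"
    show "a \<in> {a. \<forall>n. (D ^^ n) a \<in> P} \<or> b \<in> {a. \<forall>n. (D ^^ n) a \<in> P}"
    proof (rule ccontr)
      assume "\<not> ?thesis"
      then have ex: "\<exists>n. (D ^^ n) a \<notin> P" "\<exists>n. (D ^^ n) b \<notin> P" by auto
      define n where "n = (LEAST n. (D ^^ n) a \<notin> P)"
      define m where "m = (LEAST n. (D ^^ n) b \<notin> P)"
      have n: "(D ^^ n) a \<notin> P" "\<And>i. i < n \<Longrightarrow> (D ^^ i) a \<in> P"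
        using LeastI_ex[OF ex(1)] not_less_Least unfolding n_def by blast+
      have m: "(D ^^ m) b \<notin> P" "\<And>i. i < m \<Longrightarrow> (D ^^ i) b \<in> P"
        using LeastI_ex[OF ex(2)] not_less_Least unfolding m_def by blast+
      let ?z = "of_nat ((n + m) choose n) * ((D ^^ n) a * (D ^^ m) b)"
      have "(D ^^ (n + m)) (a * b) \<in> P" using ab by simp
      moreover have "(D ^^ (n + m)) (a * b) - ?z \<in> P"
        by (rule iterate_mult_leading_term[OF assms]) (use n m in auto)
      ultimately have "(D ^^ (n + m)) (a * b) - ((D ^^ (n + m)) (a * b) - ?z) \<in> P" by (rule P.diff)
      then have "?z \<in> P" by simp
      then have "(D ^^ n) a * (D ^^ m) b \<in> P" by (rule P.of_nat_mem) auto
      then show False using P.prime n(1) m(1) by blast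
    qed
  qed
qed

text \<open>The largest ideal inside \<open>P\<close> that is stable under \<open>D\<close> is prime and contains all relations \<open>G j\<close>, so
  modulo it every polynomial is still algebraic over the coordinates in \<open>S\<close>. If some \<open>a \<in> P\<close> were
  outside, the constant term of an algebraic equation of \<open>a\<close> would be a nonzero element of \<open>P\<close> in
  the coordinates \<open>S\<close>. Thus this ideal is \<open>P\<close> itself. This replaces the extension of derivations to
  algebraic field extensions.\<close>

lemma stable_prime:
  fixes S :: "'v set"
  assumes fin: "finite (UNIV :: 'v set)"
    and P: "prime_cpoly_ideal P"
    and ind: "prime_cpoly_ideal.independent P S"
    and G: "\<And>j. j \<notin> S \<Longrightarrow> G j \<in> P \<and> in_vars (insert j S) (G j) \<and> G j \<noteq> 0 \<and> D (G j) = 0"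
    and a: "a \<in> P"
  shows "D a \<in> P"
proof (rule ccontr)
  assume contra: "D a \<notin> P"
  define Q where "Q = {a. \<forall>n. (D ^^ n) a \<in> P}"
  interpret P: prime_cpoly_ideal P by fact
  interpret Q: prime_cpoly_ideal Q unfolding Q_def by (rule prime_differential_core[OF P])
  have QP: "Q \<subseteq> P"
  proof
    fix x assume "x \<in> Q"
    then have "(D ^^ 0) x \<in> P" unfolding Q_def by blast
    then show "x \<in> P" by simp
  qed
  have aQ: "a \<notin> Q"
  proof
    assume "a \<in> Q"
    then have "(D ^^ 1) a \<in> P" unfolding Q_def by blast
    then show False using contra by simp
  qed
  have indQ: "Q.independent S"
    using ind QP by (auto simp: P.independent_def Q.independent_def)
  have GQ: "G j \<in> Q" if j: "j \<notin> S" for j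
  proof -
    have "(D ^^ n) (G j) \<in> P" for n
      using G[OF j] by (cases n) (auto simp: funpow_swap1 iterate_0)
    then show ?thesis by (simp add: Q_def)
  qed
  obtain b where b: "boxed (\<lambda>_. b) a"
  proof -
    let ?b = "Max (insert 0 (\<Union>m\<in>keys a. lookup m ` UNIV))"
    have "\<forall>m\<in>keys a. \<forall>i. lookup m i \<le> ?b"
      using fin by (intro ballI allI Max_ge) auto
    then show ?thesis by (intro that[of ?b]) (simp add: boxed_def)
  qed
  have finS: "finite S" by (rule finite_subset[OF subset_UNIV fin])
  have algQ: "\<exists>G\<in>Q. in_vars (insert j S) G \<and> G \<noteq> 0" if "j \<notin> S" for j
    using GQ[OF that] G[OF that] by (intro bexI[of _ "G j"]) auto
  from Q.dependence_by_counting[OF fin indQ algQ, of "b + 1"]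
  obtain m where m: "\<forall>T (p :: ('v \<Rightarrow>\<^sub>0 nat) \<times> nat \<Rightarrow> 'v cpoly). finite T \<longrightarrow> card T = (m + 1) ^ (card S + 1) \<longrightarrow>
      (\<forall>t\<in>T. boxed (\<lambda>_. m * (b + 1)) (p t)) \<longrightarrow>
      (\<exists>x. (\<exists>t\<in>T. x t \<noteq> 0) \<and> (\<Sum>t\<in>T. Const (x t) * p t) \<in> Q)"
    by (rule exE)
  define M where "M = {n :: 'v \<Rightarrow>\<^sub>0 nat. keys n \<subseteq> S \<and> (\<forall>i\<in>S. lookup n i \<le> m)}"
  have M: "finite M" "card M = (m + 1) ^ card S"
    using monomials_in_box[OF finS, of "\<lambda>_. m"] by (simp_all add: M_def)
  have "\<exists>x. (\<exists>t\<in>M \<times> {..m}. x t \<noteq> 0) \<and>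
     (\<Sum>t\<in>M \<times> {..m}. Const (x t) * (case t of (n, l) \<Rightarrow> single n 1 * a ^ l)) \<in> Q"
  proof (rule m[THEN spec, THEN spec, THEN mp, THEN mp, THEN mp])
    show "finite (M \<times> {..m})" using M by simp
    show "card (M \<times> {..m}) = (m + 1) ^ (card S + 1)"
      using M by (simp add: card_cartesian_product)
    have "boxed (\<lambda>_. m * (b + 1)) (single n 1 * a ^ l)" if "n \<in> M" "l \<le> m" for n l
    proof (rule boxed_mult')
      show "boxed (\<lambda>_. m) (single n 1)"
      proof (rule boxed_single)
        fix i show "lookup n i \<le> m"
          using that(1) by (cases "lookup n i = 0") (auto simp: M_def in_keys_iff subset_iff)
      qed
      show "boxed (\<lambda>_. l * b) (a ^ l)" using b by (rule boxed_power)
      show "m + l * b \<le> m * (b + 1)" using mult_right_mono[OF that(2), of b] by simp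
    qed
    then show "\<forall>t\<in>M \<times> {..m}. boxed (\<lambda>_. m * (b + 1)) (case t of (n, l) \<Rightarrow> single n 1 * a ^ l)"
      by auto
  qed
  then obtain x where x: "\<exists>t\<in>M \<times> {..m}. x t \<noteq> 0"
    "(\<Sum>t\<in>M \<times> {..m}. Const (x t) * (case t of (n, l) \<Rightarrow> single n 1 * a ^ l)) \<in> Q" by blast
  define C where "C l = (\<Sum>n\<in>M. single n (x (n, l)))" for l
  have "(\<Sum>t\<in>M \<times> {..m}. Const (x t) * (case t of (n, l) \<Rightarrow> single n 1 * a ^ l))
      = (\<Sum>(n, l)\<in>M \<times> {..m}. single n (x (n, l)) * a ^ l)"
    by (intro sum.cong) (auto simp: Const_mult simp flip: mult.assoc)
  also have "\<dots> = (\<Sum>l\<le>m. C l * a ^ l)"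
    unfolding C_def sum_distrib_right by (subst sum.swap) (simp add: sum.cartesian_product)
  finally have CQ: "(\<Sum>l\<le>m. C l * a ^ l) \<in> Q" using x(2) by simp
  have CS: "in_vars S (C l)" for l
    unfolding C_def by (intro in_vars_sum in_vars_single) (auto simp: M_def)
  obtain n0 l0 where nl: "n0 \<in> M" "l0 \<le> m" "x (n0, l0) \<noteq> 0" using x(1) by auto
  have "lookup (C l0) n0 = x (n0, l0)"
    using nl M(1) by (simp add: C_def lookup_sum lookup_single when_def)
  then have "C l0 \<noteq> 0" using nl by auto
  \<comment> \<open>Divide the equation \<open>\<Sum>l. C l * a ^ l\<close> by the lowest power of \<open>a\<close> that occurs, so that its constant term is nonzero.\<close>
  define l where "l = (LEAST l. C l \<noteq> 0)"
  have l: "C l \<noteq> 0" unfolding l_def using \<open>C l0 \<noteq> 0\<close> by (rule LeastI)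
  have l': "C i = 0" if "i < l" for i using not_less_Least[of i "\<lambda>l. C l \<noteq> 0"] that unfolding l_def by blast
  have "l \<le> m" unfolding l_def using \<open>C l0 \<noteq> 0\<close> nl(2) by (meson Least_le order_trans)
  define R where "R = (\<Sum>i\<in>{l<..m}. C i * a ^ (i - l - 1))"
  have "(\<Sum>i\<le>m. C i * a ^ i) = (\<Sum>i\<in>{l..m}. C i * a ^ i)"
    by (rule sum.mono_neutral_right) (auto simp: l')
  also have "\<dots> = C l * a ^ l + (\<Sum>i\<in>{l<..m}. C i * a ^ i)"
    using \<open>l \<le> m\<close> by (rule sum.head)
  also have "(\<Sum>i\<in>{l<..m}. C i * a ^ i) = (\<Sum>i\<in>{l<..m}. a ^ l * (a * (C i * a ^ (i - l - 1))))"
  proof (rule sum.cong)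
    fix i assume "i \<in> {l<..m}"
    then have "i = l + (1 + (i - l - 1))" by auto
    then have "a ^ i = a ^ (l + (1 + (i - l - 1)))" by simp
    then have "a ^ i = a ^ l * (a * a ^ (i - l - 1))" by (simp only: power_add power_one_right)
    then show "C i * a ^ i = a ^ l * (a * (C i * a ^ (i - l - 1)))" by (simp add: mult_ac)
  qed simp
  also have "\<dots> = a ^ l * (a * R)" by (simp add: R_def sum_distrib_left)
  also have "C l * a ^ l + a ^ l * (a * R) = a ^ l * (C l + a * R)" by (simp add: algebra_simps)
  finally have "a ^ l * (C l + a * R) \<in> Q" using CQ by simp
  then have "C l + a * R \<in> Q" using Q.prime Q.power_mem aQ by blast
  then have "C l + a * R \<in> P" using QP by blast
  from P.diff[OF this P.mult_right[OF a, of R]] have "C l \<in> P" by simp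
  then show False using ind CS l by (auto simp: P.independent_def)
qed

end

section \<open>Closed sets of projective space\<close>

lemma pt_cases:
  fixes P :: "('i::finite) proj"
  obtains v where "v \<noteq> 0" "P = pt v"
proof -
  have "proj_rel (rep_proj P) (rep_proj P)"
    by (rule Quotient_rep_reflp[OF Quotient_proj])
  then have "rep_proj P \<noteq> 0" by (simp add: proj_rel_def)
  moreover have "P = pt (rep_proj P)"
    unfolding pt_def by (rule Quotient_abs_rep[OF Quotient_proj, symmetric])
  ultimately show ?thesis by (rule that)
qed

lemma subset_iff_reps: "A \<subseteq> B \<longleftrightarrow> reps A \<subseteq> reps B"
proof
  assume "reps A \<subseteq> reps B"
  show "A \<subseteq> B"
  proof
    fix P assume "P \<in> A"
    obtain v where v: "v \<noteq> 0" "P = pt v" by (rule pt_cases)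
    then have "v \<in> reps A" using \<open>P \<in> A\<close> by (simp add: reps_def)
    then have "v \<in> reps B" using \<open>reps A \<subseteq> reps B\<close> by blast
    then show "P \<in> B" using v by (simp add: reps_def)
  qed
qed (auto simp: reps_def)

lemma eq_iff_reps: "A = B \<longleftrightarrow> reps A = reps B"
  using subset_iff_reps by (metis subset_antisym order_refl)

lemma reps_Int: "reps (A \<inter> B) = reps A \<inter> reps B"
  by (auto simp: reps_def)

lemma reps_Un: "reps (A \<union> B) = reps A \<union> reps B"
  by (auto simp: reps_def)

lemma reps_empty_iff: "reps A = {} \<longleftrightarrow> A = {}"
proof -
  have "reps {} = {}" by (simp add: reps_def)
  then show ?thesis by (metis eq_iff_reps)
qed

lemma reps_nonzero: "v \<in> reps A \<Longrightarrow> v \<noteq> 0"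
  by (simp add: reps_def)

lemma pt_scale: "v \<noteq> 0 \<Longrightarrow> c \<noteq> 0 \<Longrightarrow> pt (c *s v) = pt v"
  by (subst eq_commute, subst pt_eq_iff) auto

lemma reps_scale: "v \<in> reps A \<Longrightarrow> c \<noteq> 0 \<Longrightarrow> c *s v \<in> reps A"
  by (auto simp: reps_def pt_scale)

lemma pt_eqE:
  assumes "pt v = pt w" "v \<noteq> 0" "w \<noteq> 0"
  obtains c where "c \<noteq> 0" "w = c *s v"
proof -
  obtain c where "w = c *s v" using assms pt_eq_iff by blast
  then show ?thesis using assms(3) by (intro that[of c]) auto
qed

text \<open>Homogeneity makes vanishing independent of the representative; from here on, projective sets are
  handled through their cones.\<close>

lemma reps_zero_set:
  assumes "\<forall>f\<in>F. \<exists>d. homog_in UNIV d f"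
  shows "reps {pt p |p. p \<noteq> 0 \<and> (\<forall>f\<in>F. peval (($) p) f = 0)}
       = {v. v \<noteq> 0 \<and> (\<forall>f\<in>F. peval (($) v) f = 0)}" (is "reps ?C = ?R")
proof
  show "reps ?C \<subseteq> ?R"
  proof
    fix v assume "v \<in> reps ?C"
    then obtain p where v: "v \<noteq> 0" and p: "pt v = pt p" "p \<noteq> 0" "\<forall>f\<in>F. peval (($) p) f = 0"
      by (auto simp: reps_def)
    obtain c where c: "c \<noteq> 0" "v = c *s p" by (rule pt_eqE[OF p(1)[symmetric] p(2) v])
    have "peval (($) v) f = 0" if "f \<in> F" for f
    proof -
      from assms that obtain d where "homog_in UNIV d f" by blast
      then show ?thesis using p(3) that by (simp add: c peval_scale)
    qed
    then show "v \<in> ?R" using v by simp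
  qed
qed (auto simp: reps_def)

lemma zclosed_iff_reps:
  "zclosed C \<longleftrightarrow> (\<exists>F. (\<forall>f\<in>F. \<exists>d. homog_in UNIV d f) \<and>
     reps C = {v. v \<noteq> 0 \<and> (\<forall>f\<in>F. peval (($) v) f = 0)})"
proof -
  have "zclosed C \<longleftrightarrow> (\<exists>F. (\<forall>f\<in>F. \<exists>d. homog_in UNIV d f) \<and>
     reps C = reps {pt p |p. p \<noteq> 0 \<and> (\<forall>f\<in>F. peval (($) p) f = 0)})"
    unfolding zclosed_def by (simp only: eq_iff_reps[of C])
  then show ?thesis by (simp only: reps_zero_set cong: conj_cong)
qed

lemma zclosed_Int:
  assumes "zclosed A" "zclosed B" shows "zclosed (A \<inter> B)"
proof -
  obtain F G where "\<forall>f\<in>F. \<exists>d. homog_in UNIV d f" "\<forall>f\<in>G. \<exists>d. homog_in UNIV d f"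
    "reps A = {v. v \<noteq> 0 \<and> (\<forall>f\<in>F. peval (($) v) f = 0)}"
    "reps B = {v. v \<noteq> 0 \<and> (\<forall>f\<in>G. peval (($) v) f = 0)}"
    using assms by (auto simp: zclosed_iff_reps)
  then show ?thesis unfolding zclosed_iff_reps
    by (intro exI[of _ "F \<union> G"]) (auto simp: reps_Int)
qed

definition zero_locus :: "'i cpoly \<Rightarrow> ('i::finite) proj set" where
  "zero_locus f = {pt p |p. p \<noteq> 0 \<and> peval (($) p) f = 0}"

lemma reps_zero_locus:
  "homog_in UNIV d f \<Longrightarrow> reps (zero_locus f) = {v. v \<noteq> 0 \<and> peval (($) v) f = 0}"
  using reps_zero_set[of "{f}"] unfolding zero_locus_def by auto

lemma zclosed_zero_locus: "homog_in UNIV d f \<Longrightarrow> zclosed (zero_locus f)"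
  unfolding zclosed_def zero_locus_def by (rule exI[of _ "{f}"]) auto

lemma vanishing_idealD: "f \<in> vanishing_ideal X \<Longrightarrow> v \<in> reps X \<Longrightarrow> peval (($) v) f = 0"
  by (simp add: vanishing_ideal_def)

lemma vanishing_idealI: "(\<And>v. v \<in> reps X \<Longrightarrow> peval (($) v) f = 0) \<Longrightarrow> f \<in> vanishing_ideal X"
  by (simp add: vanishing_ideal_def)

lemma vanishing_ideal_antimono: "A \<subseteq> B \<Longrightarrow> vanishing_ideal B \<subseteq> vanishing_ideal A"
  by (auto simp: vanishing_ideal_def subset_iff_reps)

lemma zclosed_separate:
  assumes "zclosed C" "v \<noteq> 0" "v \<notin> reps C"
  obtains f d where "homog_in UNIV d f" "f \<in> vanishing_ideal C" "peval (($) v) f \<noteq> 0"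
proof -
  obtain F where F: "\<forall>f\<in>F. \<exists>d. homog_in UNIV d f"
     "reps C = {v. v \<noteq> 0 \<and> (\<forall>f\<in>F. peval (($) v) f = 0)}"
    using assms(1) by (auto simp: zclosed_iff_reps)
  then obtain f where f: "f \<in> F" "peval (($) v) f \<noteq> 0" using assms by auto
  then have "f \<in> vanishing_ideal C" using F(2) by (auto intro: vanishing_idealI)
  then show ?thesis using F(1) f that by blast
qed

section \<open>Homogeneous parts and primality of vanishing ideals\<close>

definition mdegree :: "('v::finite \<Rightarrow>\<^sub>0 nat) \<Rightarrow> nat" where
  "mdegree m = (\<Sum>i\<in>UNIV. lookup m i)"

definition hpart :: "nat \<Rightarrow> 'v::finite cpoly \<Rightarrow> 'v cpoly" where
  "hpart n f = (\<Sum>m\<in>{m \<in> keys f. mdegree m = n}. single m (lookup f m))"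

lemma homog_in_hpart: "homog_in UNIV n (hpart n f)"
  unfolding hpart_def by (intro homog_in_sum homog_in_single) (auto simp: mdegree_def)

lemma sum_hpart: "\<exists>N. f = (\<Sum>n\<le>N. hpart n f)"
proof -
  define N where "N = Max (insert 0 (mdegree ` keys f))"
  have N: "mdegree m \<le> N" if "m \<in> keys f" for m
    unfolding N_def using that by (intro Max_ge) auto
  have "f = (\<Sum>m\<in>keys f. single m (lookup f m))" by (rule sum_single)
  also have "\<dots> = (\<Sum>n\<le>N. hpart n f)"
    unfolding hpart_def by (rule sum.group[symmetric]) (auto simp: N)
  finally show ?thesis by blast
qed

lemma peval_hpart_scale: "peval (($) (t *s v)) (hpart n f) = t ^ n * peval (($) v) (hpart n f)"
  by (rule peval_scale[OF homog_in_hpart])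

lemma polynomial_zero_off_0:
  fixes a b :: "nat \<Rightarrow> complex"
  assumes "\<And>t. t \<noteq> 0 \<Longrightarrow> (\<Sum>n\<le>N. a n * t ^ n) * (\<Sum>n\<le>M. b n * t ^ n) = 0"
  shows "(\<forall>n\<le>N. a n = 0) \<or> (\<forall>n\<le>M. b n = 0)"
proof (rule ccontr)
  assume "\<not> ?thesis"
  then have "finite {t. (\<Sum>n\<le>N. a n * t ^ n) = 0}" "finite {t. (\<Sum>n\<le>M. b n * t ^ n) = 0}"
    by (auto simp: polyfun_finite_roots)
  moreover have "UNIV \<subseteq> insert 0 ({t. (\<Sum>n\<le>N. a n * t ^ n) = 0} \<union> {t. (\<Sum>n\<le>M. b n * t ^ n) = 0})"
    using assms by auto
  ultimately have "finite (UNIV :: complex set)"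
    by (meson finite_UnI finite_insert rev_finite_subset)
  then show False by (simp add: infinite_UNIV_char_0)
qed

lemma polynomial_zero_off_0':
  fixes a :: "nat \<Rightarrow> complex"
  assumes "\<And>t. t \<noteq> 0 \<Longrightarrow> (\<Sum>n\<le>N. a n * t ^ n) = 0" "n \<le> N"
  shows "a n = 0"
  using polynomial_zero_off_0[where N = N and a = a and M = 0 and b = "\<lambda>_. 1"] assms by auto

text \<open>Along a line through the origin, a polynomial becomes a polynomial in one variable whose
  coefficients are the values of the homogeneous parts.\<close>

lemma peval_scale_hparts:
  assumes "f = (\<Sum>n\<le>N. hpart n f)"
  shows "peval (($) (t *s v)) f = (\<Sum>n\<le>N. peval (($) v) (hpart n f) * t ^ n)"
proof -
  have "peval (($) (t *s v)) f = (\<Sum>n\<le>N. peval (($) (t *s v)) (hpart n f))"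
    by (subst assms) simp
  then show ?thesis by (simp only: peval_hpart_scale mult.commute)
qed

lemma zirreducible_prime_homog:
  assumes Z: "zirreducible Z" and "homog_in UNIV d a" "homog_in UNIV e b"
    and "\<And>v. v \<in> reps Z \<Longrightarrow> peval (($) v) a = 0 \<or> peval (($) v) b = 0"
  shows "a \<in> vanishing_ideal Z \<or> b \<in> vanishing_ideal Z"
proof -
  have "reps Z = reps (Z \<inter> zero_locus a) \<union> reps (Z \<inter> zero_locus b)"
    using assms(2-4) reps_nonzero by (auto simp: reps_Int reps_zero_locus)
  then have "Z = (Z \<inter> zero_locus a) \<union> (Z \<inter> zero_locus b)"
    by (simp add: eq_iff_reps[of Z] reps_Un)
  moreover have "zclosed (Z \<inter> zero_locus a)" "zclosed (Z \<inter> zero_locus b)"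
    using Z assms(2,3) unfolding zirreducible_def
    by (blast intro: zclosed_Int zclosed_zero_locus)+
  ultimately have "Z = Z \<inter> zero_locus a \<or> Z = Z \<inter> zero_locus b"
    using Z unfolding zirreducible_def by blast
  then have "reps Z \<subseteq> reps (zero_locus a) \<or> reps Z \<subseteq> reps (zero_locus b)"
    by (metis inf.cobounded2 subset_iff_reps)
  then show ?thesis using assms(2,3) by (auto simp: reps_zero_locus intro!: vanishing_idealI)
qed

text \<open>Irreducibility speaks of homogeneous polynomials only. For arbitrary factors \<open>a\<close>, \<open>b\<close> one restricts
  to the line through a point of the cone: there one of the two restrictions vanishes, hence any
  chosen homogeneous part of \<open>a\<close> or any chosen one of \<open>b\<close> vanishes at that point, and the
  homogeneous case applies to this pair of parts.\<close>

lemma vanishing_ideal_prime: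
  assumes Z: "zirreducible Z"
  shows "prime_cpoly_ideal (vanishing_ideal Z)"
proof
  have "reps Z \<noteq> {}" using Z by (simp add: reps_empty_iff zirreducible_def)
  then show "1 \<notin> vanishing_ideal Z" by (auto simp: vanishing_ideal_def)
next
  fix a b assume ab: "a * b \<in> vanishing_ideal Z"
  show "a \<in> vanishing_ideal Z \<or> b \<in> vanishing_ideal Z"
  proof (rule ccontr)
    assume contra: "\<not> ?thesis"
    obtain N where N: "a = (\<Sum>n\<le>N. hpart n a)" using sum_hpart by blast
    obtain M where M: "b = (\<Sum>n\<le>M. hpart n b)" using sum_hpart by blast
    obtain n where n: "n \<le> N" "hpart n a \<notin> vanishing_ideal Z"
    proof (rule ccontr)
      assume "\<not> thesis"
      then have "\<forall>n\<le>N. hpart n a \<in> vanishing_ideal Z" using that by blast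
      then have "(\<Sum>n\<le>N. hpart n a) \<in> vanishing_ideal Z" by (auto simp: vanishing_ideal_def)
      then show False using contra N by simp
    qed
    obtain m where m: "m \<le> M" "hpart m b \<notin> vanishing_ideal Z"
    proof (rule ccontr)
      assume "\<not> thesis"
      then have "\<forall>n\<le>M. hpart n b \<in> vanishing_ideal Z" using that by blast
      then have "(\<Sum>n\<le>M. hpart n b) \<in> vanishing_ideal Z" by (auto simp: vanishing_ideal_def)
      then show False using contra M by simp
    qed
    have "peval (($) v) (hpart n a) = 0 \<or> peval (($) v) (hpart m b) = 0" if v: "v \<in> reps Z" for v
    proof -
      have "(\<Sum>n\<le>N. peval (($) v) (hpart n a) * t ^ n) * (\<Sum>n\<le>M. peval (($) v) (hpart n b) * t ^ n) = 0"
        if "t \<noteq> 0" for t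
        using vanishing_idealD[OF ab reps_scale[OF v that]]
        unfolding peval_mult peval_scale_hparts[OF N] peval_scale_hparts[OF M] .
      from polynomial_zero_off_0[OF this] show ?thesis using n(1) m(1) by blast
    qed
    from zirreducible_prime_homog[OF Z homog_in_hpart homog_in_hpart this]
    show False using n(2) m(2) by blast
  qed
qed (auto simp: vanishing_ideal_def)

lemma hpart_vanishing:
  assumes "f \<in> vanishing_ideal X" "v \<in> reps X"
  shows "peval (($) v) (hpart n f) = 0"
proof -
  obtain N where N: "f = (\<Sum>n\<le>N. hpart n f)" using sum_hpart by blast
  have *: "peval (($) v) (hpart n f) = 0" if "n \<le> N" for n
  proof (rule polynomial_zero_off_0'[OF _ that])
    fix t :: complex assume "t \<noteq> 0"
    from vanishing_idealD[OF assms(1) reps_scale[OF assms(2) this]]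
    show "(\<Sum>n\<le>N. peval (($) v) (hpart n f) * t ^ n) = 0"
      unfolding peval_scale_hparts[OF N] .
  qed
  show ?thesis
  proof (cases "n \<le> N")
    case False
    have "m \<notin> keys f" if m: "mdegree m = n" for m
    proof
      assume "m \<in> keys f"
      then have "m \<in> keys (\<Sum>n\<le>N. hpart n f)" using N by simp
      then obtain k where "k \<le> N" "m \<in> keys (hpart k f)" by (auto elim: keys_sum_cases)
      then have "mdegree m = k" using homog_in_hpart[of k f] by (simp add: homog_in_def mdegree_def)
      then show False using m False \<open>k \<le> N\<close> by simp
    qed
    then have "hpart n f = 0" unfolding hpart_def by (intro sum.neutral) auto
    then show ?thesis by simp
  qed (rule *)
qed

section \<open>Noetherianity and irreducible open subsets\<close>

primrec lexless :: "'v list \<Rightarrow> ('v \<Rightarrow>\<^sub>0 nat) \<Rightarrow> ('v \<Rightarrow>\<^sub>0 nat) \<Rightarrow> bool" where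
  "lexless [] m n \<longleftrightarrow> False"
| "lexless (i # vs) m n \<longleftrightarrow> lookup m i < lookup n i \<or> (lookup m i = lookup n i \<and> lexless vs m n)"

lemma wf_lexless: "wf {(m, n). lexless vs m n}"
proof (induction vs)
  case (Cons i vs)
  have "{(m, n). lexless (i # vs) m n} \<subseteq>
      inv_image (less_than <*lex*> {(m, n). lexless vs m n}) (\<lambda>m. (lookup m i, m))"
    by auto
  then show ?case
    by (rule wf_subset[rotated]) (intro wf_inv_image wf_lex_prod wf_less_than Cons)
qed auto

lemma lexless_trans: "lexless vs m n \<Longrightarrow> lexless vs n k \<Longrightarrow> lexless vs m k"
  by (induction vs) auto

lemma lexless_add: "lexless vs (m + k) (n + k) \<longleftrightarrow> lexless vs m n"
  by (induction vs) (auto simp: lookup_add)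

lemma lexless_total:
  assumes "\<not> lexless vs m n" "\<not> lexless vs n m" "set vs = UNIV"
  shows "m = n"
proof -
  have "\<forall>i\<in>set vs. lookup m i = lookup n i" using assms(1,2) by (induction vs) auto
  then show ?thesis using assms(3) by (intro poly_mapping_eqI) auto
qed

definition leading :: "'v list \<Rightarrow> ('v \<Rightarrow>\<^sub>0 nat) \<Rightarrow> 'v cpoly \<Rightarrow> bool" where
  "leading vs m f \<longleftrightarrow> m \<in> keys f \<and> (\<forall>n\<in>keys f. n = m \<or> lexless vs n m)"

lemma leading_exists:
  assumes "set vs = UNIV" "f \<noteq> 0" shows "\<exists>m. leading vs m f"
proof -
  have "\<exists>m\<in>K. \<forall>n\<in>K. n = m \<or> lexless vs n m" if "finite K" "K \<noteq> {}" for K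
    using that
  proof (induction K rule: finite_ne_induct)
    case (insert k K)
    then obtain m where m: "m \<in> K" "\<forall>n\<in>K. n = m \<or> lexless vs n m" by blast
    have "k = m \<or> lexless vs k m \<or> lexless vs m k" using lexless_total assms(1) by blast
    then show ?case
    proof (elim disjE)
      assume "lexless vs m k"
      then have "\<forall>n\<in>insert k K. n = k \<or> lexless vs n k" 
        using m(2) lexless_trans[of vs _ m k] by auto
      then show ?thesis by blast
    qed (use m in auto)
  qed auto
  moreover have "keys f \<noteq> {}" using assms(2) by (metis sum_single sum.empty)
  ultimately show ?thesis unfolding leading_def by (meson finite_keys)
qed

lemma lookup_mult_single: "lookup (f * single k c) (m + k) = lookup f m * (c :: complex)"
  for m :: "'v \<Rightarrow>\<^sub>0 nat"
  by (induction f rule: cpoly_induct)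
    (auto simp: mult_single lookup_single when_def distrib_right lookup_add[of "_ * _"] lookup_add[of _ _ m])

lemma leading_shift:
  assumes "leading vs m f" shows "leading vs (m + k) (f * single k 1)"
  unfolding leading_def
proof
  show "m + k \<in> keys (f * single k 1)"
    using assms by (simp add: leading_def in_keys_iff lookup_mult_single)
  show "\<forall>n\<in>keys (f * single k 1). n = m + k \<or> lexless vs n (m + k)"
    using assms by (auto simp: leading_def lexless_add elim!: keys_mult_cases split: if_splits)
qed

text \<open>Division with remainder: a smallest counterexample would lose its leading monomial after
  subtraction of a multiple of an element of \<open>I\<close>.\<close>

lemma ideal_eq_if_leading_subset:
  assumes vs: "set vs = UNIV"
    and I: "\<And>f g. f \<in> I \<Longrightarrow> g \<in> I \<Longrightarrow> f + g \<in> I" "\<And>f c. f \<in> I \<Longrightarrow> c * f \<in> I" "0 \<in> I"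
    and J: "\<And>f g. f \<in> J \<Longrightarrow> g \<in> J \<Longrightarrow> f + g \<in> J" "\<And>f c. f \<in> J \<Longrightarrow> c * f \<in> J"
    and IJ: "I \<subseteq> J"
    and lead: "\<And>m f. f \<in> J \<Longrightarrow> leading vs m f \<Longrightarrow> \<exists>g\<in>I. leading vs m g"
  shows "J \<subseteq> I"
proof -
  have "f \<in> J \<Longrightarrow> leading vs m f \<Longrightarrow> f \<in> I" for m f
  proof (induction m arbitrary: f rule: wf_induct_rule[OF wf_lexless[of vs]])
    case (1 m f)
    obtain g where g: "g \<in> I" "leading vs m g" using lead 1 by blast
    define h where "h = f + Const (- (lookup f m / lookup g m)) * g"
    have h: "f = h + Const (lookup f m / lookup g m) * g"
      unfolding h_def by (simp add: Const_def single_uminus)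
    have "h \<in> J" unfolding h_def using g IJ 1 by (intro J) auto
    have "lookup h m = 0"
      using g(2) by (simp add: h_def lookup_add lookup_Const_mult leading_def in_keys_iff)
    have "lexless vs n m" if "n \<in> keys h" for n
    proof -
      have "lookup h n \<noteq> 0" using that by (simp add: in_keys_iff)
      then have "n \<noteq> m" "n \<in> keys f \<or> n \<in> keys g"
        using \<open>lookup h m = 0\<close> by (auto simp: h_def lookup_add lookup_Const_mult in_keys_iff)
      then show ?thesis using g(2) 1(3) by (auto simp: leading_def)
    qed
    then have "h \<in> I"
      using leading_exists[OF vs, of h] 1(1) \<open>h \<in> J\<close> I(3)
      by (cases "h = 0") (auto simp: leading_def)
    then show ?case by (subst h) (intro I g)
  qed
  then show ?thesis using leading_exists[OF vs] I(3) by (metis subsetI)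
qed

text \<open>Every sequence has a monotone subsequence, and a decreasing sequence of natural numbers is
  eventually constant.\<close>

lemma nondecreasing_subsequence:
  fixes s :: "nat \<Rightarrow> nat"
  shows "\<exists>r :: nat \<Rightarrow> nat. strict_mono r \<and> mono (\<lambda>n. s (r n))"
proof -
  obtain f where f: "strict_mono f" "monoseq (\<lambda>n. s (f n))" using seq_monosub by blast
  show ?thesis
  proof (cases "mono (\<lambda>n. s (f n))")
    case False
    then have dec: "\<And>m n. m \<le> n \<Longrightarrow> s (f n) \<le> s (f m)"
      using f(2) by (auto simp: monoseq_def mono_def)
    define k where "k = (LEAST k. \<exists>n. s (f n) = k)"
    have "\<exists>n. s (f n) = k" unfolding k_def by (rule LeastI_ex) auto
    then obtain n0 where n0: "s (f n0) = k" by blast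
    have "k \<le> s (f n)" for n unfolding k_def by (rule Least_le) auto
    then have "s (f (n0 + n)) = k" for n using dec[of n0 "n0 + n"] n0 by (simp add: le_antisym)
    then show ?thesis using f(1)
      by (intro exI[of _ "\<lambda>n. f (n0 + n)"]) (auto simp: strict_mono_def mono_def)
  qed (use f in blast)
qed

text \<open>The lemma of Dickson, by passing to nondecreasing subsequences for one coordinate after the
  other.\<close>

lemma dickson:
  fixes g :: "nat \<Rightarrow> ('v::finite \<Rightarrow>\<^sub>0 nat)"
  shows "\<exists>i j. i < j \<and> (\<forall>v. lookup (g i) v \<le> lookup (g j) v)"
proof -
  have "\<exists>r :: nat \<Rightarrow> nat. strict_mono r \<and> (\<forall>v\<in>S. mono (\<lambda>n. lookup (g (r n)) v))" if "finite S" for S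
    using that
  proof (induction S rule: finite_induct)
    case empty
    show ?case by (intro exI[of _ id]) (auto simp: strict_mono_def)
  next
    case (insert v S)
    then obtain r :: "nat \<Rightarrow> nat" where r: "strict_mono r" "\<forall>v\<in>S. mono (\<lambda>n. lookup (g (r n)) v)" by blast
    obtain q :: "nat \<Rightarrow> nat" where q: "strict_mono q" "mono (\<lambda>n. lookup (g (r (q n))) v)"
      using nondecreasing_subsequence[of "\<lambda>n. lookup (g (r n)) v"] by blast
    have "mono (\<lambda>n. lookup (g (r (q n))) w)" if "w \<in> S" for w
      using r(2) that q(1) by (auto simp: mono_def strict_mono_less_eq)
    then show ?case using q r by (intro exI[of _ "r \<circ> q"]) (auto simp: strict_mono_def)
  qed
  from this[of UNIV] obtain r :: "nat \<Rightarrow> nat" where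
    r: "strict_mono r" "\<And>v. mono (\<lambda>n. lookup (g (r n)) v)" by auto
  have "r 0 < r 1" using r(1) by (simp add: strict_mono_def)
  moreover have "lookup (g (r 0)) v \<le> lookup (g (r 1)) v" for v
    using r(2)[of v] by (simp add: mono_def)
  ultimately show ?thesis by blast
qed

text \<open>The Hilbert basis theorem in the form used here. Along a strictly descending chain of closed sets,
  the leading monomials of the vanishing ideals would grow strictly; picking a new one at each step
  contradicts the lemma of Dickson, as the leading monomials of an ideal are
  closed under multiplication by monomials.\<close>

lemma wf_zclosed: "wf {(A, B :: ('i::finite) proj set). zclosed A \<and> zclosed B \<and> A \<subset> B}"
  unfolding wf_iff_no_infinite_down_chain
proof
  assume "\<exists>C. \<forall>n. (C (Suc n), C n) \<in> {(A, B :: 'i proj set). zclosed A \<and> zclosed B \<and> A \<subset> B}"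
  then obtain C :: "nat \<Rightarrow> 'i proj set" where "\<forall>n. (C (Suc n), C n) \<in> {(A, B). zclosed A \<and> zclosed B \<and> A \<subset> B}"
    by (rule exE)
  then have C: "\<And>n. zclosed (C n)" "\<And>n. C (Suc n) \<subset> C n" by simp_all
  define I where "I n = vanishing_ideal (C n)" for n
  obtain vs :: "'i list" where vs: "set vs = UNIV" using finite_list[OF finite[of UNIV]] by blast
  have anti: "I i \<subseteq> I j" if "i \<le> j" for i j
    using that unfolding I_def
    by (intro vanishing_ideal_antimono) (metis C(2) lift_Suc_antimono_le psubset_imp_subset)
  \<comment> \<open>Equal sets of leading monomials would make the ideals equal, but closed sets are separated by their ideals.\<close>
  have "\<exists>m. (\<exists>f\<in>I (Suc n). leading vs m f) \<and> \<not> (\<exists>f\<in>I n. leading vs m f)" for n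
  proof (rule ccontr)
    assume "\<not> ?thesis"
    then have *: "\<And>m f. f \<in> I (Suc n) \<Longrightarrow> leading vs m f \<Longrightarrow> \<exists>g\<in>I n. leading vs m g" by blast
    have "I (Suc n) \<subseteq> I n"
      by (rule ideal_eq_if_leading_subset[OF vs _ _ _ _ _ anti[OF le_SucI[OF order_refl]]])
        (use * in \<open>auto simp: I_def vanishing_ideal_def\<close>)
    obtain v where v: "v \<in> reps (C n)" "v \<notin> reps (C (Suc n))"
      using C(2)[of n] subset_iff_reps by blast
    obtain f d where "f \<in> I (Suc n)" "peval (($) v) f \<noteq> 0"
      using zclosed_separate[OF C(1) reps_nonzero[OF v(1)] v(2)] unfolding I_def by blast
    then show False using \<open>I (Suc n) \<subseteq> I n\<close> v(1) by (auto simp: I_def vanishing_ideal_def)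
  qed
  then obtain m where m: "\<And>n. \<exists>f\<in>I (Suc n). leading vs (m n) f" "\<And>n. \<not> (\<exists>f\<in>I n. leading vs (m n) f)"
    by metis
  obtain i j where ij: "i < j" "\<And>v. lookup (m i) v \<le> lookup (m j) v" using dickson[of m] by blast
  have mj: "m j = m i + (m j - m i)"
    using ij(2) by (intro poly_mapping_eqI) (simp add: lookup_add lookup_minus)
  obtain f where f: "f \<in> I (Suc i)" "leading vs (m i) f" using m(1) by blast
  have "single (m j - m i) 1 * f \<in> I (Suc i)" using f(1) by (auto simp: I_def vanishing_ideal_def)
  then have "f * single (m j - m i) 1 \<in> I j"
    using anti[of "Suc i" j] ij(1) by (auto simp: mult.commute)
  then show False using leading_shift[OF f(2), of "m j - m i"] mj m(2) by metis
qed

text \<open>Noetherian induction: if \<open>X\<close> is the union of two smaller closed sets \<open>A\<close> and \<open>B\<close>, then the given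
  open set either meets \<open>X\<close> inside \<open>A\<close> only, or it can be shrunk by an equation of \<open>A\<close> so that it
  meets \<open>X\<close> inside \<open>B\<close> only.\<close>

lemma irreducible_open_subset:
  fixes X :: "('i::finite) proj set"
  assumes "zclosed X" "homog_in UNIV d f" "\<exists>v\<in>reps X. peval (($) v) f \<noteq> 0"
  shows "\<exists>Z g e. zirreducible Z \<and> Z \<subseteq> X \<and> homog_in UNIV e g \<and>
    (\<exists>v\<in>reps X. peval (($) v) g \<noteq> 0) \<and>
    (\<forall>v\<in>reps X. peval (($) v) g \<noteq> 0 \<longrightarrow> v \<in> reps Z \<and> peval (($) v) f \<noteq> 0)"
  using assms
proof (induction X arbitrary: d f rule: wf_induct_rule[OF wf_zclosed])
  case (1 X)
  show ?case
  proof (cases "zirreducible X")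
    case True
    then show ?thesis using 1(3,4) by (intro exI[of _ X] exI[of _ f] exI[of _ d]) auto
  next
    case False
    have "X \<noteq> {}" using 1(4) by (auto simp: reps_def)
    then obtain A B where AB: "zclosed A" "zclosed B" "X = A \<union> B" "A \<subset> X" "B \<subset> X"
      using False 1(2) unfolding zirreducible_def by blast
    show ?thesis
    proof (cases "\<exists>v\<in>reps X. v \<notin> reps A \<and> peval (($) v) f \<noteq> 0")
      case False
      then have "\<exists>v\<in>reps A. peval (($) v) f \<noteq> 0" using 1(4) by blast
      then obtain Z g e where Z: "zirreducible Z" "Z \<subseteq> A" "homog_in UNIV e g"
        "\<exists>v\<in>reps A. peval (($) v) g \<noteq> 0"
        "\<forall>v\<in>reps A. peval (($) v) g \<noteq> 0 \<longrightarrow> v \<in> reps Z \<and> peval (($) v) f \<noteq> 0"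
        using 1(1)[of A d f] AB 1(2,3) by auto
      have "A \<subseteq> X" "reps A \<subseteq> reps X" using AB subset_iff_reps by blast+
      then show ?thesis using Z False 1(3)
        by (intro exI[of _ Z] exI[of _ "g * f"] exI[of _ "e + d"])
          (auto intro!: homog_in_mult)
    next
      case True
      then obtain v where v: "v \<in> reps X" "v \<notin> reps A" "peval (($) v) f \<noteq> 0" by blast
      obtain h k where h: "homog_in UNIV k h" "h \<in> vanishing_ideal A" "peval (($) v) h \<noteq> 0"
        using zclosed_separate[OF AB(1) reps_nonzero[OF v(1)] v(2)] by blast
      have vB: "v \<in> reps B" using v AB(3) by (auto simp: reps_Un)
      have "\<exists>v\<in>reps B. peval (($) v) (f * h) \<noteq> 0" using vB v h by auto
      then obtain Z g e where Z: "zirreducible Z" "Z \<subseteq> B" "homog_in UNIV e g"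
        "\<exists>v\<in>reps B. peval (($) v) g \<noteq> 0"
        "\<forall>v\<in>reps B. peval (($) v) g \<noteq> 0 \<longrightarrow> v \<in> reps Z \<and> peval (($) v) (f * h) \<noteq> 0"
        using 1(1)[of B "d + k" "f * h"] AB 1(2,3) h homog_in_mult by blast
      have "B \<subseteq> X" "reps B \<subseteq> reps X" using AB subset_iff_reps by blast+
      moreover have "v \<in> reps B" if "v \<in> reps X" "peval (($) v) h \<noteq> 0" for v
        using that h(2) AB(3) by (auto simp: reps_Un vanishing_ideal_def)
      ultimately show ?thesis using Z h(1)
        by (intro exI[of _ Z] exI[of _ "g * h"] exI[of _ "e + k"])
          (auto intro!: homog_in_mult)
    qed
  qed
qed

section \<open>Tangent spaces at general points\<close>

context prime_cpoly_ideal
begin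

lemma maximal_independent:
  assumes "finite (UNIV :: 'v set)"
  obtains S where "independent S" "\<And>j. j \<notin> S \<Longrightarrow> \<not> independent (insert j S)"
proof -
  have "independent {}"
    unfolding independent_def
  proof (intro allI impI)
    fix F assume F: "in_vars {} F" "F \<in> Q"
    have const: "single m (lookup F m) = Const (lookup F m)" if "m \<in> keys F" for m
    proof -
      have "keys m = {}" using F(1) that by (auto simp: in_vars_def)
      then show ?thesis by (simp add: Const_def)
    qed
    have "F = (\<Sum>m\<in>keys F. single m (lookup F m))" by (rule sum_single)
    also have "\<dots> = (\<Sum>m\<in>keys F. Const (lookup F m))"
      by (intro sum.cong refl const)
    also have "\<dots> = Const (\<Sum>m\<in>keys F. lookup F m)" by (rule Const_sum)
    finally have eq: "F = Const (\<Sum>m\<in>keys F. lookup F m)" .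
    then have "Const (\<Sum>m\<in>keys F. lookup F m) \<in> Q" using F(2) by (simp only: flip: eq)
    then have "(\<Sum>m\<in>keys F. lookup F m) = 0" by (rule Const_mem)
    then show "F = 0" by (subst eq) simp
  qed
  moreover have "\<forall>T. independent T \<longrightarrow> card T < card (UNIV :: 'v set) + 1"
    using card_mono[OF assms subset_UNIV] by (simp add: less_Suc_eq_le)
  ultimately have "\<exists>S. independent S \<and> (\<forall>T. independent T \<longrightarrow> card T \<le> card S)"
    by (rule ex_has_greatest_nat)
  then obtain S where S: "independent S" "\<forall>T. independent T \<longrightarrow> card T \<le> card S"
    by blast
  have fin: "finite S" by (rule finite_subset[OF subset_UNIV assms])
  show ?thesis
  proof (rule that[OF S(1)])
    fix j assume "j \<notin> S"
    then have "\<not> card (insert j S) \<le> card S" using fin by simp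
    then show "\<not> independent (insert j S)" using S(2) by blast
  qed
qed

end

definition total_degree :: "'v::finite cpoly \<Rightarrow> nat" where
  "total_degree f = Max (insert 0 (mdegree ` keys f))"

lemma total_degree_pdiff:
  assumes "pdiff j f \<noteq> 0" shows "total_degree (pdiff j f) < total_degree f"
proof -
  have *: "mdegree n + 1 \<le> total_degree f" if "n \<in> keys (pdiff j f)" for n
  proof -
    have "n + single j 1 \<in> keys f" using that by (auto simp: in_keys_iff lookup_pdiff)
    then have "mdegree (n + single j 1) \<in> insert 0 (mdegree ` keys f)" by blast
    moreover have "mdegree (n + single j 1) = mdegree n + 1"
      by (simp add: mdegree_def lookup_add sum.distrib lookup_single when_def)
    ultimately have "mdegree n + 1 \<in> insert 0 (mdegree ` keys f)" by (simp only:)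
    then show ?thesis unfolding total_degree_def by (intro Max_ge) auto
  qed
  have "keys (pdiff j f) \<noteq> {}" using assms by (metis sum_single sum.empty)
  then obtain n where "n \<in> keys (pdiff j f)" by blast
  from *[OF this] have "0 < total_degree f" by simp
  moreover have "mdegree n < total_degree f" if "n \<in> keys (pdiff j f)" for n
    using *[OF that] by simp
  ultimately show ?thesis unfolding total_degree_def[of "pdiff j f"]
    by (subst Max_less_iff) auto
qed

lemma in_vars_if_pdiff_0:
  assumes "in_vars (insert j S) G" "pdiff j G = 0" shows "in_vars S G"
proof -
  have "lookup m j = 0" if "m \<in> keys G" for m
  proof (rule ccontr)
    assume "lookup m j \<noteq> 0"
    then have "m - single j 1 + single j 1 = m"
      by (intro poly_mapping_eqI) (auto simp: lookup_add lookup_minus lookup_single when_def)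
    then have "lookup (pdiff j G) (m - single j 1) = of_nat (lookup (m - single j 1) j + 1) * lookup G m"
      by (simp only: lookup_pdiff)
    then show False using assms(2) that by (simp add: in_keys_iff del: of_nat_add of_nat_Suc)
  qed
  then have "j \<notin> keys m" if "m \<in> keys G" for m using that by (simp add: in_keys_iff)
  then show ?thesis using assms(1) unfolding in_vars_def by blast
qed

text \<open>A relation of minimal degree is separable: its derivative is a smaller relation unless it is zero,
  and in characteristic zero it is zero only if the variable does not occur.\<close>

lemma separable_relation:
  fixes P :: "'v::finite cpoly set"
  assumes "prime_cpoly_ideal P" "prime_cpoly_ideal.independent P S"
    and "\<not> prime_cpoly_ideal.independent P (insert j S)"
  shows "\<exists>G\<in>P. in_vars (insert j S) G \<and> G \<noteq> 0 \<and> pdiff j G \<notin> P"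
proof -
  define R where "R G \<longleftrightarrow> G \<in> P \<and> in_vars (insert j S) G \<and> G \<noteq> 0" for G
  obtain G0 where "R G0"
    using assms(3) unfolding prime_cpoly_ideal.independent_def[OF assms(1)] R_def by blast
  from ex_has_least_nat[of R, OF this, of total_degree]
  obtain G where "R G \<and> (\<forall>H. R H \<longrightarrow> total_degree G \<le> total_degree H)" by (rule exE)
  then have "R G" and least: "R H \<Longrightarrow> total_degree G \<le> total_degree H" for H by simp_all
  then have G: "G \<in> P" "in_vars (insert j S) G" "G \<noteq> 0" by (simp_all add: R_def)
  have "pdiff j G \<notin> P"
  proof
    assume *: "pdiff j G \<in> P"
    show False
    proof (cases "pdiff j G = 0")
      case True
      have "in_vars S G" by (rule in_vars_if_pdiff_0[OF G(2) True])
      then show False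
        using G(1,3) assms(2) unfolding prime_cpoly_ideal.independent_def[OF assms(1)] by blast
    next
      case False
      have "R (pdiff j G)" unfolding R_def using * False in_vars_pdiff[OF G(2)] by simp
      then show False using least[of "pdiff j G"] total_degree_pdiff[OF False] by simp
    qed
  qed
  with G show ?thesis by (intro bexI[of _ G]) simp_all
qed

text \<open>The relations \<open>G j\<close> alone show that a tangent vector is determined by its coordinates in \<open>S\<close>.
  Conversely, for each \<open>i \<in> S\<close> the derivation \<open>D i\<close> that differentiates in the
  direction \<open>i\<close> and kills all \<open>G j\<close> preserves the vanishing ideal, so its value at the point is a
  tangent vector \<open>u i\<close>.\<close>

lemma cone_tangent_dim:
  fixes Z :: "('i::finite) proj set"
  assumes prime: "prime_cpoly_ideal (vanishing_ideal Z)"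
    and ind: "prime_cpoly_ideal.independent (vanishing_ideal Z) S"
    and G: "\<And>j. j \<notin> S \<Longrightarrow> G j \<in> vanishing_ideal Z \<and> in_vars (insert j S) (G j) \<and> G j \<noteq> 0"
    and q: "q \<in> reps Z" "\<And>j. j \<notin> S \<Longrightarrow> peval (($) q) (pdiff j (G j)) \<noteq> 0"
  shows "vec.dim (cone_tangent Z q) = card S"
proof -
  define T where "T = cone_tangent Z q"
  \<comment> \<open>The coefficients of \<open>D i\<close> come from implicit differentiation of \<open>G j\<close>, multiplied by the common denominator \<open>h (- S)\<close>.\<close>
  define h where "h I = (\<Prod>j\<in>I. pdiff j (G j))" for I
  define w where "w i l = (if l \<in> S then if l = i then h (- S) else 0
      else - (pdiff i (G l)) * h (- S - {l}))" for i l
  define D where "D i f = (\<Sum>l\<in>UNIV. w i l * pdiff l f)" for i f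
  define u where "u i = (\<chi> l. peval (($) q) (w i l))" for i
  define H where "H = peval (($) q) (h (- S))"
  have H: "H \<noteq> 0" using q(2) by (simp add: H_def h_def)
  have pd0: "pdiff l (G j) = 0" if "j \<notin> S" "l \<noteq> j" "l \<notin> S" for j l
    using G[OF that(1)] that(2,3) by (intro pdiff_not_in_vars) (auto simp: in_vars_def in_keys_iff subset_iff)
  have DG: "D i (G j) = 0" if i: "i \<in> S" and j: "j \<notin> S" for i j
  proof -
    have "D i (G j) = (\<Sum>l\<in>{i, j}. w i l * pdiff l (G j))"
      unfolding D_def using i j pd0[of j] by (intro sum.mono_neutral_right) (auto simp: w_def)
    also have "\<dots> = h (- S) * pdiff i (G j) - pdiff i (G j) * h (- S - {j}) * pdiff j (G j)"
    proof -
      have "i \<noteq> j" using i j by blast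
      then show ?thesis using i j by (simp add: w_def)
    qed
    also have "h (- S) = pdiff j (G j) * h (- S - {j})"
      unfolding h_def using j by (intro prod.remove) auto
    finally show ?thesis by (simp add: mult_ac)
  qed
  have der: "cpoly_derivation (D i)" for i
    by unfold_locales (simp_all add: D_def algebra_simps sum.distrib sum_distrib_left)
  have stable: "D i f \<in> vanishing_ideal Z" if "i \<in> S" "f \<in> vanishing_ideal Z" for i f
    by (rule cpoly_derivation.stable_prime[OF der _ prime ind, of G]) (use G DG that in auto)
  have uT: "u i \<in> T" if "i \<in> S" for i
    unfolding T_def cone_tangent_def
  proof (intro CollectI ballI)
    fix f assume "f \<in> vanishing_ideal Z"
    from vanishing_idealD[OF stable[OF that this] q(1)]
    show "(\<Sum>l\<in>UNIV. peval (($) q) (pdiff l f) * u i $ l) = 0"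
      by (simp add: D_def u_def mult.commute)
  qed
  have u: "u i $ l = (if l = i then H else 0)" if "l \<in> S" for i l
    using that by (simp add: u_def w_def H_def)
  have comb: "(\<Sum>i\<in>S. c i *s u i) $ l = c l * H" if "l \<in> S" for c l
  proof -
    have "(\<Sum>i\<in>S. c i *s u i) $ l = (\<Sum>i\<in>S. if l = i then c i * H else 0)"
      unfolding sum_component using that by (intro sum.cong) (auto simp: u)
    also have "\<dots> = c l * H" using that by simp
    finally show ?thesis .
  qed
  have inj: "inj_on u S"
  proof (rule inj_onI)
    fix i j assume ij: "i \<in> S" "j \<in> S" "u i = u j"
    then have "u j $ i = H" using u[of i i] by simp
    then show "i = j" using u[of i j] ij H by (auto split: if_splits)
  qed
  have "vec.independent (u ` S)"
  proof (rule vec.independent_if_scalars_zero)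
    fix f x assume f: "(\<Sum>x\<in>u ` S. f x *s x) = 0" and "x \<in> u ` S"
    then obtain l where l: "l \<in> S" "x = u l" by blast
    have "(\<Sum>i\<in>S. f (u i) *s u i) = 0" using f inj by (simp add: sum.reindex)
    then have "f (u l) * H = 0" using comb[OF l(1), of "\<lambda>i. f (u i)"] by simp
    then show "f x = 0" using H l by simp
  qed simp
  moreover have "T \<subseteq> vec.span (u ` S)"
  proof
    fix v assume v: "v \<in> T"
    define y where "y = (\<Sum>i\<in>S. (v $ i / H) *s u i)"
    have zS: "(v - y) $ l = 0" if "l \<in> S" for l
      using comb[OF that, of "\<lambda>i. v $ i / H"] H by (simp add: y_def)
    have zT: "(\<Sum>l\<in>UNIV. peval (($) q) (pdiff l f) * (v - y) $ l) = 0" if f: "f \<in> vanishing_ideal Z" for f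
    proof -
      have "(\<Sum>l\<in>UNIV. peval (($) q) (pdiff l f) * y $ l)
          = (\<Sum>i\<in>S. (v $ i / H) * (\<Sum>l\<in>UNIV. peval (($) q) (pdiff l f) * u i $ l))"
        unfolding y_def sum_component sum_distrib_left
        by (subst sum.swap) (simp add: mult_ac)
      also have "\<dots> = 0"
        using uT f unfolding T_def cone_tangent_def by (intro sum.neutral) auto
      finally have "(\<Sum>l\<in>UNIV. peval (($) q) (pdiff l f) * y $ l) = 0" .
      moreover have "(\<Sum>l\<in>UNIV. peval (($) q) (pdiff l f) * v $ l) = 0"
        using v f unfolding T_def cone_tangent_def by auto
      ultimately show ?thesis by (simp add: right_diff_distrib sum_subtractf)
    qed
    have "(v - y) $ j = 0" for j
    proof (cases "j \<in> S")
      case False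
      have "(\<Sum>l\<in>UNIV. peval (($) q) (pdiff l (G j)) * (v - y) $ l)
          = (\<Sum>l\<in>{j}. peval (($) q) (pdiff l (G j)) * (v - y) $ l)"
        using zS pd0[OF False] by (intro sum.mono_neutral_right) (auto, metis peval_0 diff_0_eq_0)
      then have "peval (($) q) (pdiff j (G j)) * (v - y) $ j = 0"
        using zT[of "G j"] G[OF False] by simp
      then show ?thesis using q(2)[OF False] by simp
    qed (rule zS)
    then have "v = y" by (simp add: vec_eq_iff)
    also have "y \<in> vec.span (u ` S)" unfolding y_def
      by (intro vec.span_sum vec.span_scale vec.span_base) auto
    finally show "v \<in> vec.span (u ` S)" .
  qed
  moreover have "u ` S \<subseteq> T" using uT by blast
  ultimately have "vec.dim T = card (u ` S)" by (intro vec.dim_unique) auto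
  then show ?thesis using inj by (simp add: T_def card_image)
qed

section \<open>Dimension and density of the nonsingular points\<close>

lemma zirreducible_zclosed: "zirreducible Z \<Longrightarrow> zclosed Z"
  unfolding zirreducible_def by (elim conjE)

lemma zirreducible_split:
  "zirreducible Z \<Longrightarrow> zclosed A \<Longrightarrow> zclosed B \<Longrightarrow> Z = A \<union> B \<Longrightarrow> Z = A \<or> Z = B"
  unfolding zirreducible_def by blast

lemma alg_indep_fractions_mono:
  assumes "alg_indep_fractions Z r f g" "s \<le> r"
  shows "alg_indep_fractions Z s f g"
  unfolding alg_indep_fractions_def
proof (intro conjI allI impI)
  fix i assume "i < s"
  then have "i < r" using assms(2) by simp
  then show "\<exists>d. homog_in UNIV d (f i) \<and> homog_in UNIV d (g i)"
    "\<exists>p\<in>reps Z. peval (($) p) (g i) \<noteq> 0"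
    using assms(1) unfolding alg_indep_fractions_def by blast+
next
  fix F :: "nat cpoly"
  assume F: "(\<forall>m\<in>keys F. keys m \<subseteq> {..<s}) \<and> (\<forall>p\<in>reps Z. (\<forall>i<s. peval (($) p) (g i) \<noteq> 0) \<longrightarrow>
     peval (\<lambda>i. peval (($) p) (f i) / peval (($) p) (g i)) F = 0)"
  have "\<forall>m\<in>keys F. keys m \<subseteq> {..<r}" using F assms(2) by fastforce
  moreover have "\<forall>p\<in>reps Z. (\<forall>i<r. peval (($) p) (g i) \<noteq> 0) \<longrightarrow>
     peval (\<lambda>i. peval (($) p) (f i) / peval (($) p) (g i)) F = 0"
    using F assms(2) by auto
  ultimately show "F = 0" using assms(1) unfolding alg_indep_fractions_def by blast
qed

text \<open>An algebraic relation between the quotients becomes, after homogenization with the common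
  denominator, a relation between the coordinates in \<open>S\<close> on the cone.\<close>

lemma coordinate_fractions_alg_indep:
  fixes Z :: "('i::finite) proj set"
  assumes prime: "prime_cpoly_ideal (vanishing_ideal Z)"
    and ind: "prime_cpoly_ideal.independent (vanishing_ideal Z) S"
    and i0: "i0 \<in> S"
    and \<sigma>: "inj_on \<sigma> {..<r}" "\<sigma> ` {..<r} \<subseteq> S - {i0}"
  shows "alg_indep_fractions Z r (\<lambda>i. Var (\<sigma> i)) (\<lambda>_. Var i0)"
  unfolding alg_indep_fractions_def
proof (intro conjI allI impI)
  interpret P: prime_cpoly_ideal "vanishing_ideal Z" by fact
  have V0: "Var i0 \<notin> vanishing_ideal Z" by (rule P.independent_Var[OF ind i0])
  {
    fix i
    show "\<exists>d. homog_in UNIV d (Var (\<sigma> i)) \<and> homog_in UNIV d (Var i0)"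
      by (intro exI[of _ 1] conjI homog_in_Var_UNIV)
    show "\<exists>p\<in>reps Z. peval (($) p) (Var i0) \<noteq> 0"
      using V0 unfolding vanishing_ideal_def by blast
  }
  fix F :: "nat cpoly"
  assume F: "(\<forall>m\<in>keys F. keys m \<subseteq> {..<r}) \<and> (\<forall>p\<in>reps Z. (\<forall>i<r. peval (($) p) (Var i0) \<noteq> 0) \<longrightarrow>
     peval (\<lambda>i. peval (($) p) (Var (\<sigma> i)) / peval (($) p) (Var i0)) F = 0)"
  \<comment> \<open>\<open>H\<close> is the homogenization of \<open>F\<close> in degree \<open>N\<close>.\<close>
  define td where "td m = (\<Sum>i<r. lookup m i)" for m :: "nat \<Rightarrow>\<^sub>0 nat"
  define N where "N = Max (insert 0 (td ` keys F))"
  have N: "td m \<le> N" if "m \<in> keys F" for m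
    unfolding N_def using that by (intro Max_ge) auto
  define \<tau> where "\<tau> m = (\<Sum>i<r. single (\<sigma> i) (lookup m i)) + single i0 (N - td m)" for m
  define H where "H = (\<Sum>m\<in>keys F. single (\<tau> m) (lookup F m))"
  have \<tau>: "lookup (\<tau> m) (\<sigma> i) = lookup m i" if "i < r" for m i
  proof -
    have "\<sigma> i \<noteq> i0" using \<sigma>(2) that by auto
    then have "lookup (\<tau> m) (\<sigma> i) = (\<Sum>j<r. if \<sigma> j = \<sigma> i then lookup m j else 0)"
      by (simp add: \<tau>_def lookup_add lookup_sum lookup_single when_def)
    also have "\<dots> = (\<Sum>j<r. if j = i then lookup m j else 0)"
      using inj_on_eq_iff[OF \<sigma>(1)] that by (intro sum.cong) auto
    finally show ?thesis using that by simp
  qed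
  have eqF: "m = m'" if "m \<in> keys F" "m' \<in> keys F" "\<tau> m = \<tau> m'" for m m'
  proof (rule poly_mapping_eqI)
    fix i
    show "lookup m i = lookup m' i"
    proof (cases "i < r")
      case False
      have "keys m \<subseteq> {..<r}" "keys m' \<subseteq> {..<r}" using F that by auto
      then have "i \<notin> keys m" "i \<notin> keys m'" using False by auto
      then show ?thesis by (simp add: in_keys_iff)
    qed (metis \<tau> that(3))
  qed
  have pH: "peval (($) p) H = p $ i0 ^ N * peval (\<lambda>i. p $ \<sigma> i / p $ i0) F" if p: "p $ i0 \<noteq> 0" for p
  proof -
    have "meval (($) p) (\<tau> m) = p $ i0 ^ N * meval (\<lambda>i. p $ \<sigma> i / p $ i0) m" if m: "m \<in> keys F" for m
    proof -
      have "meval (\<lambda>i. p $ \<sigma> i / p $ i0) m = (\<Prod>i<r. (p $ \<sigma> i / p $ i0) ^ lookup m i)"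
        using F m by (intro meval_superset) auto
      also have "\<dots> = (\<Prod>i<r. p $ \<sigma> i ^ lookup m i) / p $ i0 ^ td m"
        by (simp add: power_divide prod_dividef td_def power_sum)
      finally have "p $ i0 ^ N * meval (\<lambda>i. p $ \<sigma> i / p $ i0) m
          = (\<Prod>i<r. p $ \<sigma> i ^ lookup m i) * (p $ i0 ^ N / p $ i0 ^ td m)" by simp
      also have "p $ i0 ^ N / p $ i0 ^ td m = p $ i0 ^ (N - td m)"
        using p N[OF m] by (simp add: power_diff)
      finally show ?thesis by (simp add: \<tau>_def meval_add meval_sum)
    qed
    then show ?thesis
      by (simp add: H_def peval_single peval_superset[OF finite_keys subset_refl, of _ F]
            sum_distrib_left mult_ac)
  qed
  \<comment> \<open>The factor \<open>Var i0\<close> takes care of the points where the fractions are undefined.\<close>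
  have "Var i0 * H \<in> vanishing_ideal Z"
  proof (rule vanishing_idealI)
    fix p assume "p \<in> reps Z"
    then show "peval (($) p) (Var i0 * H) = 0"
      using F pH[of p] by (cases "p $ i0 = 0") auto
  qed
  then have "H \<in> vanishing_ideal Z" using V0 P.prime by blast
  moreover have "in_vars S H"
    unfolding H_def
  proof (intro in_vars_sum in_vars_single)
    fix m
    show "keys (\<tau> m) \<subseteq> S"
      using \<sigma>(2) i0 unfolding \<tau>_def
      by (auto dest!: keys_add_cases elim!: keys_sum_cases split: if_splits)
  qed
  ultimately have H0: "H = 0" using ind by (auto simp: P.independent_def)
  show "F = 0"
  proof (rule poly_mapping_eqI, rule ccontr)
    fix m assume "lookup F m \<noteq> lookup 0 m"
    then have m: "m \<in> keys F" by (simp add: in_keys_iff)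
    have "lookup H (\<tau> m) = (\<Sum>n\<in>keys F. if n = m then lookup F n else 0)"
      unfolding H_def lookup_sum lookup_single when_def
      using eqF m by (intro sum.cong) auto
    then show False using H0 m by (simp add: in_keys_iff)
  qed
qed

text \<open>The function field of the cone has one transcendental more than that of \<open>Z\<close>, for instance a
  coordinate \<open>i0\<close>. So if \<open>card S\<close> independent fractions existed, their monomials with cleared
  denominators, multiplied by powers of this coordinate, would be more numerous than the growth of
  the coordinate ring admits. A dependence among them splits by degree under scaling, and each part
  is a relation between the fractions.\<close>

lemma alg_indep_fractions_bound:
  fixes Z :: "('i::finite) proj set"
  assumes prime: "prime_cpoly_ideal (vanishing_ideal Z)"
    and ind: "prime_cpoly_ideal.independent (vanishing_ideal Z) S"
    and i0: "i0 \<in> S"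
    and alg: "\<And>j. j \<notin> S \<Longrightarrow> \<exists>G\<in>vanishing_ideal Z. in_vars (insert j S) G \<and> G \<noteq> 0"
    and fg: "alg_indep_fractions Z r f g"
  shows "r < card S"
proof (rule ccontr)
  assume "\<not> r < card S"
  define s where "s = card S"
  interpret P: prime_cpoly_ideal "vanishing_ideal Z" by fact
  have fg: "alg_indep_fractions Z s f g"
    using alg_indep_fractions_mono[OF fg] \<open>\<not> r < card S\<close> by (simp add: s_def)
  have V0: "Var i0 \<notin> vanishing_ideal Z" by (rule P.independent_Var[OF ind i0])
  have "\<forall>i. \<exists>d. i < s \<longrightarrow> homog_in UNIV d (f i) \<and> homog_in UNIV d (g i)"
    using fg by (auto simp: alg_indep_fractions_def)
  then obtain d where d: "\<And>i. i < s \<Longrightarrow> homog_in UNIV (d i) (f i) \<and> homog_in UNIV (d i) (g i)"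
    by metis
  have "\<forall>i. \<exists>b. boxed (\<lambda>_. b) (f i) \<and> boxed (\<lambda>_. b) (g i)"
  proof
    fix i
    obtain b b' where "boxed (\<lambda>_. b) (f i)" "boxed (\<lambda>_. b') (g i)" using boxed_exists by metis
    then have "boxed (\<lambda>_. max b b') (f i) \<and> boxed (\<lambda>_. max b b') (g i)"
      by (auto elim: boxed_mono)
    then show "\<exists>b. boxed (\<lambda>_. b) (f i) \<and> boxed (\<lambda>_. b) (g i)" by blast
  qed
  then obtain b where b: "\<And>i. boxed (\<lambda>_. b i) (f i) \<and> boxed (\<lambda>_. b i) (g i)" by metis
  define B where "B = (\<Sum>i<s. b i) + 1"
  from P.dependence_by_counting[OF finite ind alg, of B]
  obtain m where m: "\<forall>T (p :: (nat \<Rightarrow>\<^sub>0 nat) \<times> nat \<Rightarrow> 'i cpoly). finite T \<longrightarrow> card T = (m + 1) ^ (card S + 1) \<longrightarrow>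
      (\<forall>t\<in>T. boxed (\<lambda>_. m * B) (p t)) \<longrightarrow>
      (\<exists>x. (\<exists>t\<in>T. x t \<noteq> 0) \<and> (\<Sum>t\<in>T. Const (x t) * p t) \<in> vanishing_ideal Z)"
    by (rule exE)
  define M where "M = {\<alpha> :: nat \<Rightarrow>\<^sub>0 nat. keys \<alpha> \<subseteq> {..<s} \<and> (\<forall>i\<in>{..<s}. lookup \<alpha> i \<le> m)}"
  have M: "finite M" "card M = (m + 1) ^ s"
    using monomials_in_box[of "{..<s}" "\<lambda>_. m"] by (simp_all add: M_def)
  \<comment> \<open>The monomial \<open>\<alpha>\<close> in the fractions, times the \<open>m\<close>-th power of every denominator; this has the
    same degree \<open>e\<close> for every \<open>\<alpha>\<close>.\<close>
  define num where "num \<alpha> = (\<Prod>i<s. f i ^ lookup \<alpha> i * g i ^ (m - lookup \<alpha> i))" for \<alpha>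
  define e where "e = (\<Sum>i<s. m * d i)"
  have le: "lookup \<alpha> i \<le> m" if "\<alpha> \<in> M" "i < s" for \<alpha> i using that by (auto simp: M_def)
  have hom: "homog_in UNIV e (num \<alpha>)" if "\<alpha> \<in> M" for \<alpha>
    unfolding num_def e_def
  proof (intro homog_in_prod)
    fix i assume i: "i \<in> {..<s}"
    then have "homog_in UNIV (lookup \<alpha> i * d i + (m - lookup \<alpha> i) * d i)
        (f i ^ lookup \<alpha> i * g i ^ (m - lookup \<alpha> i))"
      using d by (intro homog_in_mult homog_in_power) auto
    then show "homog_in UNIV (m * d i) (f i ^ lookup \<alpha> i * g i ^ (m - lookup \<alpha> i))"
      using le[OF that, of i] i by (simp flip: distrib_right)
  qed
  have "\<exists>x. (\<exists>t\<in>M \<times> {..m}. x t \<noteq> 0) \<and>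
     (\<Sum>t\<in>M \<times> {..m}. Const (x t) * (case t of (\<alpha>, l) \<Rightarrow> num \<alpha> * Var i0 ^ l)) \<in> vanishing_ideal Z"
  proof (rule m[THEN spec, THEN spec, THEN mp, THEN mp, THEN mp])
    show "finite (M \<times> {..m})" using M by simp
    show "card (M \<times> {..m}) = (m + 1) ^ (card S + 1)"
      using M by (simp add: card_cartesian_product s_def)
    have "boxed (\<lambda>_. m * B) (num \<alpha> * Var i0 ^ l)" if "\<alpha> \<in> M" "l \<le> m" for \<alpha> l
    proof (rule boxed_mult')
      show "boxed (\<lambda>_. \<Sum>i<s. m * b i) (num \<alpha>)"
        unfolding num_def
      proof (rule boxed_prod)
        fix i assume i: "i \<in> {..<s}"
        show "boxed (\<lambda>_. m * b i) (f i ^ lookup \<alpha> i * g i ^ (m - lookup \<alpha> i))"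
        proof (rule boxed_mult'[OF boxed_power boxed_power])
          show "lookup \<alpha> i * b i + (m - lookup \<alpha> i) * b i \<le> m * b i"
            using le[OF that(1), of i] i by (simp flip: distrib_right)
        qed (use b in auto)
      qed
      show "boxed (\<lambda>_. m) (Var i0 ^ l)"
        unfolding Var_power using that(2) by (intro boxed_single) (auto simp: lookup_single when_def)
      show "(\<Sum>i<s. m * b i) + m \<le> m * B" by (simp add: B_def algebra_simps sum_distrib_left)
    qed
    then show "\<forall>t\<in>M \<times> {..m}. boxed (\<lambda>_. m * B) (case t of (\<alpha>, l) \<Rightarrow> num \<alpha> * Var i0 ^ l)"
      by auto
  qed
  then obtain x where x: "\<exists>t\<in>M \<times> {..m}. x t \<noteq> 0"
     "(\<Sum>t\<in>M \<times> {..m}. Const (x t) * (case t of (\<alpha>, l) \<Rightarrow> num \<alpha> * Var i0 ^ l)) \<in> vanishing_ideal Z"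
    by blast
  define A where "A l = (\<Sum>\<alpha>\<in>M. Const (x (\<alpha>, l)) * num \<alpha>)" for l
  have A_hom: "homog_in UNIV e (A l)" for l
    unfolding A_def
  proof (intro homog_in_sum)
    fix \<alpha> assume "\<alpha> \<in> M"
    from homog_in_mult[OF homog_in_Const hom[OF this]]
    show "homog_in UNIV e (Const (x (\<alpha>, l)) * num \<alpha>)" by simp
  qed
  have "(\<Sum>t\<in>M \<times> {..m}. Const (x t) * (case t of (\<alpha>, l) \<Rightarrow> num \<alpha> * Var i0 ^ l))
      = (\<Sum>(\<alpha>, l)\<in>M \<times> {..m}. Const (x (\<alpha>, l)) * num \<alpha> * Var i0 ^ l)"
    by (intro sum.cong) (auto simp: mult.assoc)
  also have "\<dots> = (\<Sum>l\<le>m. A l * Var i0 ^ l)"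
    unfolding A_def sum_distrib_right by (subst sum.swap) (simp add: sum.cartesian_product)
  finally have AP: "(\<Sum>l\<le>m. A l * Var i0 ^ l) \<in> vanishing_ideal Z" using x(2) by simp
  have A0: "A l \<in> vanishing_ideal Z" if l: "l \<le> m" for l
  proof -
    have "A l * Var i0 ^ l \<in> vanishing_ideal Z"
    proof (rule vanishing_idealI)
      fix v assume v: "v \<in> reps Z"
      have "peval (($) v) (A l) * v $ i0 ^ l = 0"
      proof (rule polynomial_zero_off_0'[OF _ l])
        fix t :: complex assume t: "t \<noteq> 0"
        have "0 = (\<Sum>l\<le>m. peval (($) (t *s v)) (A l) * (t * v $ i0) ^ l)"
          using vanishing_idealD[OF AP reps_scale[OF v t]] by simp
        also have "\<dots> = t ^ e * (\<Sum>l\<le>m. peval (($) v) (A l) * v $ i0 ^ l * t ^ l)"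
          by (simp add: peval_scale[OF A_hom] sum_distrib_left power_mult_distrib mult_ac)
        finally show "(\<Sum>l\<le>m. peval (($) v) (A l) * v $ i0 ^ l * t ^ l) = 0" using t by simp
      qed
      then show "peval (($) v) (A l * Var i0 ^ l) = 0" by simp
    qed
    then show ?thesis using P.prime P.power_mem V0 by blast
  qed
  obtain \<alpha>0 l where al: "\<alpha>0 \<in> M" "l \<le> m" "x (\<alpha>0, l) \<noteq> 0" using x(1) by auto
  define F where "F = (\<Sum>\<alpha>\<in>M. single \<alpha> (x (\<alpha>, l)))"
  have "F = 0"
  proof -
    have "\<forall>n\<in>keys F. keys n \<subseteq> {..<s}"
      unfolding F_def by (auto elim!: keys_sum_cases simp: M_def split: if_splits)
    moreover have "peval (\<lambda>i. peval (($) p) (f i) / peval (($) p) (g i)) F = 0"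
      if p: "p \<in> reps Z" "\<forall>i<s. peval (($) p) (g i) \<noteq> 0" for p
    proof -
      let ?y = "\<lambda>i. peval (($) p) (f i) / peval (($) p) (g i)"
      have num: "peval (($) p) (num \<alpha>) = (\<Prod>i<s. peval (($) p) (g i) ^ m) * meval ?y \<alpha>" if \<alpha>: "\<alpha> \<in> M" for \<alpha>
      proof -
        have "meval ?y \<alpha> = (\<Prod>i<s. ?y i ^ lookup \<alpha> i)"
          using \<alpha> by (intro meval_superset) (auto simp: M_def)
        then have "(\<Prod>i<s. peval (($) p) (g i) ^ m) * meval ?y \<alpha>
            = (\<Prod>i<s. peval (($) p) (g i) ^ m * ?y i ^ lookup \<alpha> i)" by (simp add: prod.distrib)
        also have "\<dots> = (\<Prod>i<s. peval (($) p) (f i) ^ lookup \<alpha> i * peval (($) p) (g i) ^ (m - lookup \<alpha> i))"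
          using p(2) le[OF \<alpha>] by (intro prod.cong) (auto simp: power_divide power_diff)
        finally show ?thesis by (simp add: num_def)
      qed
      have "0 = peval (($) p) (A l)" using vanishing_idealD[OF A0[OF al(2)] p(1)] by simp
      also have "\<dots> = (\<Sum>\<alpha>\<in>M. x (\<alpha>, l) * ((\<Prod>i<s. peval (($) p) (g i) ^ m) * meval ?y \<alpha>))"
        by (simp add: A_def num)
      also have "\<dots> = (\<Prod>i<s. peval (($) p) (g i) ^ m) * peval ?y F"
        by (simp add: F_def peval_single sum_distrib_left mult_ac)
      finally show ?thesis using p(2) by simp
    qed
    ultimately show ?thesis using fg unfolding alg_indep_fractions_def by blast
  qed
  moreover have "lookup F \<alpha>0 = x (\<alpha>0, l)"
    using al(1) M(1) by (simp add: F_def lookup_sum lookup_single when_def)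
  ultimately show False using al(3) by simp
qed

text \<open>The summand \<open>1\<close> accounts for the passage from \<open>Z\<close> to its cone. The set \<open>S\<close> is nonempty: a relation in a
  single coordinate would, by homogeneity, force that coordinate to vanish on \<open>Z\<close>.\<close>

lemma irred_dim_eq:
  fixes Z :: "('i::finite) proj set"
  assumes Z: "zirreducible Z"
    and ind: "prime_cpoly_ideal.independent (vanishing_ideal Z) S"
    and alg: "\<And>j. j \<notin> S \<Longrightarrow> \<exists>G\<in>vanishing_ideal Z. in_vars (insert j S) G \<and> G \<noteq> 0"
  shows "irred_dim Z + 1 = enat (card S)"
proof -
  have prime: "prime_cpoly_ideal (vanishing_ideal Z)" by (rule vanishing_ideal_prime[OF Z])
  interpret P: prime_cpoly_ideal "vanishing_ideal Z" by fact
  have "S \<noteq> {}"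
  proof
    assume S: "S = {}"
    have "Z \<noteq> {}" using Z unfolding zirreducible_def by (elim conjE)
    then have "reps Z \<noteq> {}" by (simp add: reps_empty_iff)
    then obtain v where v: "v \<in> reps Z" by blast
    obtain j where j: "v $ j \<noteq> 0" using reps_nonzero[OF v] unfolding vec_eq_iff by auto
    obtain G where G: "G \<in> vanishing_ideal Z" "in_vars {j} G" "G \<noteq> 0"
      using alg[of j] unfolding S by blast
    have "keys G \<noteq> {}" using G(3) by (metis sum_single sum.empty)
    then obtain m where m: "m \<in> keys G" by blast
    have mono: "n = single j (lookup n j)" if "n \<in> keys G" for n
    proof (rule poly_mapping_eqI)
      fix i
      have "keys n \<subseteq> {j}" using that G(2) by (simp add: in_vars_def)
      then have "lookup n i = 0" if "i \<noteq> j" using that by (auto simp flip: not_in_keys_iff_lookup_eq_zero)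
      then show "lookup n i = lookup (single j (lookup n j)) i" by (simp add: lookup_single when_def)
    qed
    have deg: "mdegree n = lookup n j" if "n \<in> keys G" for n
      by (subst mono[OF that]) (simp add: mdegree_def lookup_single when_def)
    have "n = m" if n: "n \<in> keys G" "mdegree n = lookup m j" for n
    proof -
      have "n = single j (mdegree n)" by (subst deg[OF n(1)]) (rule mono[OF n(1)])
      also have "\<dots> = m" unfolding n(2) by (rule mono[OF m, symmetric])
      finally show ?thesis .
    qed
    then have "{n \<in> keys G. mdegree n = lookup m j} = {m}"
      using m deg by blast
    then have "hpart (lookup m j) G = single m (lookup G m)" by (simp add: hpart_def)
    moreover have "meval (($) v) m = v $ j ^ lookup m j"
      by (subst mono[OF m]) simp
    then have "peval (($) v) (single m (lookup G m)) = lookup G m * v $ j ^ lookup m j"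
      by (simp only: peval_single)
    ultimately have "lookup G m * v $ j ^ lookup m j = 0"
      using hpart_vanishing[OF G(1) v, of "lookup m j"] by simp
    then show False using j m by (simp add: in_keys_iff)
  qed
  then obtain i0 where i0: "i0 \<in> S" by blast
  define r where "r = card S - 1"
  have "card S > 0" using i0 card_gt_0_iff[of S] finite[of S] by blast
  then have r: "card S = r + 1" by (simp add: r_def)
  have "card (S - {i0}) = r" using i0 r by simp
  then have "\<exists>\<sigma>. bij_betw \<sigma> {0..<r} (S - {i0})"
    using ex_bij_betw_nat_finite[of "S - {i0}"] by simp
  then obtain \<sigma> where "bij_betw \<sigma> {0..<r} (S - {i0})" by (rule exE)
  then have "inj_on \<sigma> {..<r}" "\<sigma> ` {..<r} \<subseteq> S - {i0}"
    by (auto simp: bij_betw_def atLeast0LessThan)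
  from coordinate_fractions_alg_indep[OF prime ind i0 this]
  have low: "enat r \<in> {enat r |r. \<exists>f g. alg_indep_fractions Z r f g}" by blast
  have up: "x \<le> enat r" if x: "x \<in> {enat r |r. \<exists>f g. alg_indep_fractions Z r f g}" for x
  proof -
    obtain k f g where k: "x = enat k" "alg_indep_fractions Z k f g" using x by blast
    have "k < card S" by (rule alg_indep_fractions_bound[OF prime ind i0 alg k(2)])
    then show ?thesis using r k by simp
  qed
  have "irred_dim Z = enat r"
    unfolding irred_dim_def using low up by (intro antisym Sup_least Sup_upper)
  then show ?thesis using r by (simp add: one_enat_def)
qed

text \<open>A component through a point of the open part is covered by \<open>Z\<close> and the complement of the open part,
  hence is contained in \<open>Z\<close>.\<close>

lemma local_dim_irreducible_open:
  fixes X :: "('i::finite) proj set"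
  assumes Z: "zirreducible Z" "Z \<subseteq> X" and g: "homog_in UNIV e g"
    and open_part: "\<forall>v\<in>reps X. peval (($) v) g \<noteq> 0 \<longrightarrow> v \<in> reps Z"
    and q: "q \<in> reps X" "peval (($) q) g \<noteq> 0"
  shows "local_dim X (pt q) = irred_dim Z"
proof -
  have sub: "W \<subseteq> Z" if W: "zirreducible W" "W \<subseteq> X" "pt q \<in> W" for W
  proof -
    have "reps W \<subseteq> reps X" using W(2) subset_iff_reps by blast
    then have "reps W = reps (W \<inter> zero_locus g) \<union> reps (W \<inter> Z)"
      using open_part reps_nonzero by (auto simp: reps_Int reps_zero_locus[OF g])
    then have "W = (W \<inter> zero_locus g) \<union> (W \<inter> Z)"
      by (simp add: eq_iff_reps[of W] reps_Un)
    moreover have "zclosed (W \<inter> zero_locus g)" "zclosed (W \<inter> Z)"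
      using W(1) Z(1) zclosed_zero_locus[OF g]
      by (intro zclosed_Int; simp add: zirreducible_zclosed)+
    ultimately have "W = W \<inter> zero_locus g \<or> W = W \<inter> Z"
      using W(1) by (intro zirreducible_split)
    moreover have "q \<in> reps W" using W(3) q(1) by (simp add: reps_def)
    then have "q \<notin> reps (W \<inter> zero_locus g)" using q(2) by (simp add: reps_Int reps_zero_locus[OF g])
    ultimately show ?thesis using \<open>q \<in> reps W\<close> by auto
  qed
  have qZ: "pt q \<in> Z" using open_part q by (auto simp: reps_def)
  have "Z \<in> zcomponents X"
    unfolding zcomponents_def using Z sub qZ by blast
  moreover have "W = Z" if "W \<in> zcomponents X" "pt q \<in> W" for W
    using that sub[of W] Z unfolding zcomponents_def by blast
  ultimately have "{irred_dim W |W. W \<in> zcomponents X \<and> pt q \<in> W} = {irred_dim Z}"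
    using qZ by blast
  then show ?thesis by (simp add: local_dim_def)
qed

text \<open>Multiplication by \<open>g\<close> carries equations of \<open>Z\<close> to equations of \<open>X\<close>, and by the product rule it only
  rescales their differentials at points of \<open>Z\<close>.\<close>

lemma cone_tangent_open:
  assumes "Z \<subseteq> X"
    and open_part: "\<forall>v\<in>reps X. peval (($) v) g \<noteq> 0 \<longrightarrow> v \<in> reps Z"
    and q: "q \<in> reps X" "peval (($) q) g \<noteq> 0"
  shows "cone_tangent X q = cone_tangent Z q"
proof
  show "cone_tangent Z q \<subseteq> cone_tangent X q"
    using vanishing_ideal_antimono[OF assms(1)] by (auto simp: cone_tangent_def)
  show "cone_tangent X q \<subseteq> cone_tangent Z q"
  proof
    fix v assume v: "v \<in> cone_tangent X q"
    have qZ: "q \<in> reps Z" using open_part q by blast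
    show "v \<in> cone_tangent Z q"
      unfolding cone_tangent_def
    proof (intro CollectI ballI)
      fix f assume f: "f \<in> vanishing_ideal Z"
      have "g * f \<in> vanishing_ideal X"
      proof (rule vanishing_idealI)
        fix w assume "w \<in> reps X"
        then show "peval (($) w) (g * f) = 0"
          using open_part vanishing_idealD[OF f, of w] by (cases "peval (($) w) g = 0") auto
      qed
      then have "(\<Sum>i\<in>UNIV. peval (($) q) (pdiff i (g * f)) * v $ i) = 0"
        using v unfolding cone_tangent_def by blast
      then have "peval (($) q) g * (\<Sum>i\<in>UNIV. peval (($) q) (pdiff i f) * v $ i) = 0"
        using vanishing_idealD[OF f qZ] by (simp add: sum_distrib_left mult.assoc)
      then show "(\<Sum>i\<in>UNIV. peval (($) q) (pdiff i f) * v $ i) = 0" using q(2) by simp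
    qed
  qed
qed

text \<open>The generic smoothness of varieties in characteristic zero. On the open subset where only one
  irreducible \<open>Z\<close> matters, both the tangent space and the local dimension of \<open>X\<close> are those of \<open>Z\<close>,
  and at a point where in addition the derivatives of the separable relations are nonzero, the
  dimensions agree.\<close>

theorem regular_points_dense:
  fixes X :: "('i::finite) proj set"
  assumes X: "zclosed X" and f: "homog_in UNIV d f" and p: "p \<in> reps X" "peval (($) p) f \<noteq> 0"
  obtains q where "q \<in> reps (reg_points X)" "peval (($) q) f \<noteq> 0"
proof -
  obtain Z g e where Z: "zirreducible Z" "Z \<subseteq> X" and g: "homog_in UNIV e g"
    "\<exists>v\<in>reps X. peval (($) v) g \<noteq> 0"
    "\<forall>v\<in>reps X. peval (($) v) g \<noteq> 0 \<longrightarrow> v \<in> reps Z \<and> peval (($) v) f \<noteq> 0"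
    using irreducible_open_subset[OF X f] p by blast
  have prime: "prime_cpoly_ideal (vanishing_ideal Z)" by (rule vanishing_ideal_prime[OF Z(1)])
  interpret P: prime_cpoly_ideal "vanishing_ideal Z" by fact
  obtain S where S: "P.independent S" "\<And>j. j \<notin> S \<Longrightarrow> \<not> P.independent (insert j S)"
    using P.maximal_independent[OF finite] by blast
  have "\<forall>j. \<exists>G. j \<notin> S \<longrightarrow> G \<in> vanishing_ideal Z \<and> in_vars (insert j S) G \<and> G \<noteq> 0 \<and>
      pdiff j G \<notin> vanishing_ideal Z"
    using separable_relation[OF prime S(1) S(2)] by blast
  then obtain G where G: "\<forall>j. j \<notin> S \<longrightarrow> G j \<in> vanishing_ideal Z \<and> in_vars (insert j S) (G j) \<and>
      G j \<noteq> 0 \<and> pdiff j (G j) \<notin> vanishing_ideal Z"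
    by (rule choice[THEN exE])
  have "g \<notin> vanishing_ideal Z" using g(2,3) by (auto simp: vanishing_ideal_def)
  moreover have "(\<Prod>j\<in>-S. pdiff j (G j)) \<notin> vanishing_ideal Z"
    using P.prod_mem[of "\<lambda>j. pdiff j (G j)" "- S"] G by auto
  ultimately have "g * (\<Prod>j\<in>-S. pdiff j (G j)) \<notin> vanishing_ideal Z" using P.prime by blast
  then obtain q where q: "q \<in> reps Z" "peval (($) q) (g * (\<Prod>j\<in>-S. pdiff j (G j))) \<noteq> 0"
    unfolding vanishing_ideal_def by blast
  have qX: "q \<in> reps X" using q(1) Z(2) subset_iff_reps by blast
  have qg: "peval (($) q) g \<noteq> 0" and qG: "\<And>j. j \<notin> S \<Longrightarrow> peval (($) q) (pdiff j (G j)) \<noteq> 0"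
    using q(2) by (simp_all del: peval_prod add: peval_prod)
  have op: "\<forall>v\<in>reps X. peval (($) v) g \<noteq> 0 \<longrightarrow> v \<in> reps Z" using g(3) by blast
  have "vec.dim (cone_tangent X q) = card S"
    unfolding cone_tangent_open[OF Z(2) op qX qg]
    by (rule cone_tangent_dim[OF prime S(1) _ q(1) qG]) (use G in blast)
  moreover have "local_dim X (pt q) + 1 = enat (card S)"
    unfolding local_dim_irreducible_open[OF Z g(1) op qX qg]
    by (rule irred_dim_eq[OF Z(1) S(1)]) (use G in blast)
  ultimately have "pt q \<in> reg_points X"
    unfolding reg_points_def using qX by (intro CollectI exI[of _ q]) simp
  then have "q \<in> reps (reg_points X)" using reps_nonzero[OF qX] by (simp add: reps_def)
  moreover have "peval (($) q) f \<noteq> 0" using g(3) qX qg by blast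
  ultimately show ?thesis by (rule that)
qed

section \<open>Euler relation\<close>

lemma euler_monomial:
  fixes x :: "'v::finite \<Rightarrow> complex"
  shows "(\<Sum>i\<in>UNIV. peval x (pdiff i (single m c)) * x i) = of_nat (mdegree m) * peval x (single m c)"
proof -
  have "peval x (pdiff i (single m c)) * x i = of_nat (lookup m i) * peval x (single m c)" for i
  proof (cases "lookup m i = 0")
    case False
    then have "m = (m - single i 1) + single i 1"
      by (intro poly_mapping_eqI) (auto simp: lookup_add lookup_minus lookup_single when_def)
    then have "meval x m = meval x (m - single i 1) * x i"
      by (metis meval_add meval_single power_one_right)
    then show ?thesis by (simp add: pdiff_single peval_single mult_ac)
  qed (simp add: pdiff_single)
  then show ?thesis by (simp add: mdegree_def sum_distrib_right)
qed

lemma euler: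
  fixes x :: "'v::finite \<Rightarrow> complex"
  assumes "homog_in UNIV d f"
  shows "(\<Sum>i\<in>UNIV. peval x (pdiff i f) * x i) = of_nat d * peval x f"
proof -
  have f: "f = (\<Sum>m\<in>keys f. single m (lookup f m))" by (rule sum_single)
  have "(\<Sum>i\<in>UNIV. peval x (pdiff i f) * x i)
      = (\<Sum>i\<in>UNIV. \<Sum>m\<in>keys f. peval x (pdiff i (single m (lookup f m))) * x i)"
    by (subst (1) f) (simp only: pdiff_sum peval_sum sum_distrib_right)
  also have "\<dots> = (\<Sum>m\<in>keys f. \<Sum>i\<in>UNIV. peval x (pdiff i (single m (lookup f m))) * x i)"
    by (rule sum.swap)
  also have "\<dots> = (\<Sum>m\<in>keys f. of_nat d * peval x (single m (lookup f m)))"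
    using assms by (intro sum.cong) (auto simp: euler_monomial homog_in_def mdegree_def)
  also have "\<dots> = of_nat d * peval x (\<Sum>m\<in>keys f. single m (lookup f m))"
    by (simp only: peval_sum sum_distrib_left)
  finally show ?thesis by (simp only: flip: f)
qed

text \<open>The radial direction is tangent to a cone: apply the relation of Euler to the homogeneous parts of an
  equation, which vanish on the cone one by one.\<close>

lemma mem_cone_tangent_self:
  assumes "p \<in> reps X" shows "p \<in> cone_tangent X p"
  unfolding cone_tangent_def
proof (intro CollectI ballI)
  fix f assume f: "f \<in> vanishing_ideal X"
  obtain N where N: "f = (\<Sum>n\<le>N. hpart n f)" using sum_hpart by blast
  have "(\<Sum>i\<in>UNIV. peval (($) p) (pdiff i f) * p $ i)
      = (\<Sum>i\<in>UNIV. \<Sum>n\<le>N. peval (($) p) (pdiff i (hpart n f)) * p $ i)"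
    by (subst (1) N) (simp only: pdiff_sum peval_sum sum_distrib_right)
  also have "\<dots> = (\<Sum>n\<le>N. \<Sum>i\<in>UNIV. peval (($) p) (pdiff i (hpart n f)) * p $ i)"
    by (rule sum.swap)
  also have "\<dots> = 0"
    by (rule sum.neutral) (simp add: euler[OF homog_in_hpart] hpart_vanishing[OF f assms])
  finally show "(\<Sum>i\<in>UNIV. peval (($) p) (pdiff i f) * p $ i) = 0" .
qed

section \<open>Conormal variety and likelihood correspondence\<close>

definition zero_set2 :: "('i + 'j) cpoly set \<Rightarrow> (('i::finite) proj \<times> ('j::finite) proj) set" where
  "zero_set2 F = {(pt p, pt b) |p b. p \<noteq> 0 \<and> b \<noteq> 0 \<and>
              (\<forall>f\<in>F. peval (case_sum (($) p) (($) b)) f = 0)}"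

definition bihomogeneous :: "('i + 'j) cpoly \<Rightarrow> bool" where
  "bihomogeneous f \<longleftrightarrow> (\<exists>d e. homog_in (range Inl) d f \<and> homog_in (range Inr) e f)"

lemma peval_bihomogeneous_scale:
  fixes f :: "('i::finite + 'j::finite) cpoly"
  assumes "bihomogeneous f" "peval (case_sum (($) p) (($) b)) f = 0"
  shows "peval (case_sum (($) (s *s p)) (($) (t *s b))) f = 0"
proof -
  obtain d e where de: "homog_in (range Inl) d f" "homog_in (range Inr) e f"
    using assms(1) by (auto simp: bihomogeneous_def)
  let ?x = "case_sum (($) p) (($) b)"
  let ?y = "\<lambda>i. if i \<in> range Inr then t * ?x i else ?x i"
  have "case_sum (($) (s *s p)) (($) (t *s b)) = (\<lambda>i. if i \<in> range Inl then s * ?y i else ?y i)"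
    by (auto simp: fun_eq_iff split: sum.splits)
  then show ?thesis
    using peval_homog_scale[OF _ de(1), of s ?y] peval_homog_scale[OF _ de(2), of t ?x] assms(2)
    by simp
qed

lemma mem_zero_set2:
  assumes F: "\<forall>f\<in>F. bihomogeneous f" and "p \<noteq> 0" "b \<noteq> 0"
  shows "(pt p, pt b) \<in> zero_set2 F \<longleftrightarrow> (\<forall>f\<in>F. peval (case_sum (($) p) (($) b)) f = 0)"
proof
  assume "(pt p, pt b) \<in> zero_set2 F"
  then obtain p' b' where pb: "p' \<noteq> 0" "b' \<noteq> 0" "pt p' = pt p" "pt b' = pt b"
    and F': "\<forall>f\<in>F. peval (case_sum (($) p') (($) b')) f = 0"
    unfolding zero_set2_def by auto
  obtain s where s: "s \<noteq> 0" "p = s *s p'" by (rule pt_eqE[OF pb(3,1) assms(2)])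
  obtain t where t: "t \<noteq> 0" "b = t *s b'" by (rule pt_eqE[OF pb(4,2) assms(3)])
  show "\<forall>f\<in>F. peval (case_sum (($) p) (($) b)) f = 0"
    unfolding s(2) t(2) using F F' by (intro ballI peval_bihomogeneous_scale) simp_all
next
  assume "\<forall>f\<in>F. peval (case_sum (($) p) (($) b)) f = 0"
  then show "(pt p, pt b) \<in> zero_set2 F" using assms(2,3) unfolding zero_set2_def by blast
qed

lemma zclosed2_iff: "zclosed2 C \<longleftrightarrow> (\<exists>F. (\<forall>f\<in>F. bihomogeneous f) \<and> C = zero_set2 F)"
  unfolding zclosed2_def bihomogeneous_def zero_set2_def ..

text \<open>Equations in the first two groups of variables are read as equations in all three, of degree zero in
  the last group.\<close>

lemma zclosed3_cylinder:
  fixes C :: "(('i::finite) proj \<times> ('j::finite) proj) set"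
  assumes "zclosed2 C"
  shows "zclosed3 {(P, B, U :: ('k::finite) proj). (P, B) \<in> C}"
proof -
  obtain F where F: "\<forall>f\<in>F. bihomogeneous f" "C = zero_set2 F"
    using assms zclosed2_iff by blast
  define \<phi> :: "'i + 'j \<Rightarrow> ('i + 'j + 'k) cpoly" where
    "\<phi> = (\<lambda>i. Var (case_sum Inl (Inr \<circ> Inl) i))"
  have ev: "peval (case_sum (($) p) (case_sum (($) b) (($) u))) (psubst \<phi> f)
      = peval (case_sum (($) p) (($) b)) f" for p b u f
  proof -
    have "(\<lambda>i. peval (case_sum (($) p) (case_sum (($) b) (($) u))) (\<phi> i)) = case_sum (($) p) (($) b)"
      by (auto simp: \<phi>_def fun_eq_iff split: sum.splits)
    then show ?thesis by (simp add: peval_psubst)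
  qed
  have hom: "\<exists>d e h. homog_in (range Inl) d (psubst \<phi> f) \<and> homog_in (range (Inr \<circ> Inl)) e (psubst \<phi> f) \<and>
      homog_in (range (Inr \<circ> Inr)) h (psubst \<phi> f)" if "f \<in> F" for f
  proof -
    have "bihomogeneous f" using F(1) that by blast
    then obtain d e where de: "homog_in (range Inl) d f" "homog_in (range Inr) e f"
      by (auto simp: bihomogeneous_def)
    have V: "homog_in A k (Var i)" if "k = (if i \<in> A then 1 else 0)" for k and i :: "'i + 'j + 'k" and A
      unfolding that by (rule homog_in_Var) simp
    have "homog_in (range Inl) d (psubst \<phi> f)"
      by (rule homog_in_psubst[OF de(1)]) (auto simp: \<phi>_def intro!: V split: sum.splits)
    moreover have "homog_in (range (Inr \<circ> Inl)) e (psubst \<phi> f)"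
      by (rule homog_in_psubst[OF de(2)]) (auto simp: \<phi>_def intro!: V split: sum.splits)
    moreover have "homog_in {} 0 f" by (simp add: homog_in_def)
    then have "homog_in (range (Inr \<circ> Inr)) 0 (psubst \<phi> f)"
      by (rule homog_in_psubst) (auto simp: \<phi>_def intro!: V split: sum.splits)
    ultimately show ?thesis by blast
  qed
  have "{(P, B, U :: 'k proj). (P, B) \<in> C} = {(pt p, pt b, pt u) |p b u. p \<noteq> 0 \<and> b \<noteq> 0 \<and> u \<noteq> 0 \<and>
      (\<forall>f\<in>psubst \<phi> ` F. peval (case_sum (($) p) (case_sum (($) b) (($) u))) f = 0)}" (is "?L = ?R")
  proof
    show "?L \<subseteq> ?R"
    proof clarify
      fix P B and U :: "'k proj" assume "(P, B) \<in> C"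
      moreover obtain u where "u \<noteq> 0" "U = pt u" by (rule pt_cases)
      ultimately show "\<exists>p b u. (P, B, U) = (pt p, pt b, pt u) \<and> p \<noteq> 0 \<and> b \<noteq> 0 \<and> u \<noteq> 0 \<and>
        (\<forall>f\<in>psubst \<phi> ` F. peval (case_sum (($) p) (case_sum (($) b) (($) u))) f = 0)"
        unfolding F(2) zero_set2_def ball_simps ev by blast
    qed
    show "?R \<subseteq> ?L" unfolding F(2) zero_set2_def ball_simps ev by blast
  qed
  then show ?thesis unfolding zclosed3_def using hom
    by (intro exI[of _ "psubst \<phi> ` F"] conjI) blast+
qed

lemma ext_likelihood_conormal:
  assumes "(P, B, U) \<in> ext_likelihood X" shows "(P, B) \<in> conormal X"
proof -
  have "(P, B) \<in> C" if C: "zclosed2 C" and sub: "{(pt p, pt b) |p b. p \<in> reps (reg_points X) \<and> b \<noteq> 0 \<and>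
     (\<forall>v\<in>cone_tangent X p. (\<Sum>i\<in>UNIV. b $ i * v $ i) = 0)} \<subseteq> C" for C
  proof -
    have "conormal X \<subseteq> C" unfolding conormal_def by (rule hull_minimal, rule sub, rule C)
    then have "ext_likelihood X \<subseteq> {(P, B, U). (P, B) \<in> C}"
      unfolding ext_likelihood_def by (intro hull_minimal zclosed3_cylinder[OF C]) blast
    then show ?thesis using assms by blast
  qed
  then show ?thesis unfolding conormal_def hull_def by blast
qed

text \<open>The condition that \<open>u\<close> is proportional to the product of \<open>p\<close> and \<open>b\<close> is expressed by minors, which are
  homogeneous in each group of variables, hence it passes to the closure. It is stated without
  division because the product may vanish at boundary points.\<close>

lemma ext_likelihood_proportional:
  assumes "(P, B, U) \<in> ext_likelihood X"
  obtains p b u where "p \<noteq> 0" "b \<noteq> 0" "u \<noteq> 0" "P = pt p" "B = pt b" "U = pt u"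
    "\<forall>i j. p $ i * b $ i * u $ j = p $ j * b $ j * u $ i"
proof -
  define minor :: "'a \<times> 'a \<Rightarrow> ('a + 'a + 'a) cpoly" where
    "minor = (\<lambda>(i, j). Var (Inl i) * Var (Inr (Inl i)) * Var (Inr (Inr j))
        - Var (Inl j) * Var (Inr (Inl j)) * Var (Inr (Inr i)))"
  define C where "C = {(pt p, pt b, pt u) |p b u. p \<noteq> 0 \<and> b \<noteq> 0 \<and> u \<noteq> 0 \<and>
      (\<forall>f\<in>range minor. peval (case_sum (($) p) (case_sum (($) b) (($) u))) f = 0)}"
  have ev: "peval (case_sum (($) p) (case_sum (($) b) (($) u))) (minor (i, j))
      = p $ i * b $ i * u $ j - p $ j * b $ j * u $ i" for p b u i j
    by (simp add: minor_def)
  have V: "homog_in A ((if Inl i \<in> A then 1 else 0) + (if Inr (Inl i) \<in> A then 1 else 0) + (if Inr (Inr j) \<in> A then 1 else 0))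
      (Var (Inl i) * Var (Inr (Inl i)) * Var (Inr (Inr j)))" for A and i j :: 'a
    by (intro homog_in_mult homog_in_Var) simp_all
  have "homog_in (range Inl) 1 (minor (i, j)) \<and> homog_in (range (Inr \<circ> Inl)) 1 (minor (i, j)) \<and>
      homog_in (range (Inr \<circ> Inr)) 1 (minor (i, j))" for i j
    unfolding minor_def prod.case
    using V[of "range Inl" i j] V[of "range Inl" j i] V[of "range (Inr \<circ> Inl)" i j]
      V[of "range (Inr \<circ> Inl)" j i] V[of "range (Inr \<circ> Inr)" i j] V[of "range (Inr \<circ> Inr)" j i]
    by (intro conjI homog_in_diff) (auto simp: image_iff)
  then have "zclosed3 C"
    unfolding zclosed3_def C_def by (intro exI[of _ "range minor"]) fast
  moreover have "{(pt p, pt b, pt u) |p b u. p \<noteq> 0 \<and> b \<noteq> 0 \<and> u \<noteq> 0 \<and>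
     (pt p, pt b) \<in> conormal X \<and> p * b \<noteq> 0 \<and> pt (p * b) = pt u} \<subseteq> C"
  proof clarify
    fix p b u :: "complex ^ 'a"
    assume *: "p \<noteq> 0" "b \<noteq> 0" "u \<noteq> 0" "p * b \<noteq> 0" "pt (p * b) = pt u"
    obtain c where "c \<noteq> 0" "u = c *s (p * b)" by (rule pt_eqE[OF *(5,4,3)])
    then have "peval (case_sum (($) p) (case_sum (($) b) (($) u))) (minor (i, j)) = 0" for i j
      unfolding ev by simp
    then show "(pt p, pt b, pt u) \<in> C" unfolding C_def using * by auto
  qed
  ultimately have "ext_likelihood X \<subseteq> C"
    unfolding ext_likelihood_def by (intro hull_minimal)
  then have "(P, B, U) \<in> C" using assms by blast
  then obtain p b u where *: "p \<noteq> 0" "b \<noteq> 0" "u \<noteq> 0" "P = pt p" "B = pt b" "U = pt u"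
    "\<forall>f\<in>range minor. peval (case_sum (($) p) (case_sum (($) b) (($) u))) f = 0"
    unfolding C_def by blast
  have "\<forall>i j. p $ i * b $ i * u $ j = p $ j * b $ j * u $ i"
  proof (intro allI)
    fix i j
    have "peval (case_sum (($) p) (case_sum (($) b) (($) u))) (minor (i, j)) = 0" using *(7) by blast
    then show "p $ i * b $ i * u $ j = p $ j * b $ j * u $ i" unfolding ev by simp
  qed
  with *(1-6) show ?thesis by (rule that)
qed

text \<open>At a nonsingular point \<open>p\<close> the vector \<open>p\<close> itself is tangent, so \<open>b\<close> is orthogonal to it; this
  bihomogeneous equation passes to the closure.\<close>

lemma conormal_incidence:
  assumes "(pt p, pt b) \<in> conormal X" "p \<noteq> 0" "b \<noteq> 0"
  shows "(\<Sum>i\<in>UNIV. p $ i * b $ i) = 0"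
proof -
  define f :: "('a + 'a) cpoly" where "f = (\<Sum>i\<in>UNIV. Var (Inl i) * Var (Inr i))"
  have ev: "peval (case_sum (($) p) (($) b)) f = (\<Sum>i\<in>UNIV. p $ i * b $ i)" for p b
    by (simp add: f_def)
  have V: "homog_in A ((if Inl i \<in> A then 1 else 0) + (if Inr i \<in> A then 1 else 0))
      (Var (Inl i) * Var (Inr i))" for A and i :: 'a
    by (intro homog_in_mult homog_in_Var) simp_all
  have "homog_in (range Inl) 1 f" "homog_in (range Inr) 1 f"
    unfolding f_def using V[of "range Inl"] V[of "range Inr"]
    by (intro homog_in_sum; simp add: image_iff)+
  then have bi: "\<forall>f\<in>{f}. bihomogeneous f" unfolding bihomogeneous_def by blast
  then have "zclosed2 (zero_set2 {f})" unfolding zclosed2_iff by blast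
  moreover have "{(pt p, pt b) |p b. p \<in> reps (reg_points X) \<and> b \<noteq> 0 \<and>
     (\<forall>v\<in>cone_tangent X p. (\<Sum>i\<in>UNIV. b $ i * v $ i) = 0)} \<subseteq> zero_set2 {f}"
  proof clarify
    fix p b :: "complex ^ 'a"
    assume *: "p \<in> reps (reg_points X)" "b \<noteq> 0" "\<forall>v\<in>cone_tangent X p. (\<Sum>i\<in>UNIV. b $ i * v $ i) = 0"
    have "reg_points X \<subseteq> X" unfolding reg_points_def reps_def by blast
    then have "p \<in> reps X" using *(1) subset_iff_reps by blast
    then have "(\<Sum>i\<in>UNIV. b $ i * p $ i) = 0" using *(3) mem_cone_tangent_self by blast
    then show "(pt p, pt b) \<in> zero_set2 {f}"
      using mem_zero_set2[OF bi reps_nonzero[OF *(1)] *(2)] by (simp add: ev mult.commute)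
  qed
  ultimately have "conormal X \<subseteq> zero_set2 {f}"
    unfolding conormal_def by (intro hull_minimal)
  then have "(pt p, pt b) \<in> zero_set2 {f}" using assms(1) by blast
  then show ?thesis using mem_zero_set2[OF bi assms(2,3)] by (simp add: ev)
qed

text \<open>A fixed \<open>b\<close> orthogonal to all tangent spaces pairs with every nonsingular point inside the conormal
  variety. A bihomogeneous equation of the conormal variety, specialized at \<open>b\<close>, is a homogeneous
  equation that vanishes at all nonsingular points, hence on all of \<open>X\<close> by density.\<close>

lemma conormal_if_perp_everywhere:
  assumes X: "zclosed X" and p: "p \<in> reps X" and b: "b \<noteq> 0"
    and perp: "\<And>q v. q \<in> reps X \<Longrightarrow> v \<in> cone_tangent X q \<Longrightarrow> (\<Sum>i\<in>UNIV. b $ i * v $ i) = 0"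
  shows "(pt p, pt b) \<in> conormal X"
proof -
  have "(pt p, pt b) \<in> C" if C: "zclosed2 C" and sub: "{(pt p, pt b) |p b. p \<in> reps (reg_points X) \<and> b \<noteq> 0 \<and>
     (\<forall>v\<in>cone_tangent X p. (\<Sum>i\<in>UNIV. b $ i * v $ i) = 0)} \<subseteq> C" for C
  proof -
    obtain F where F: "\<forall>f\<in>F. bihomogeneous f" "C = zero_set2 F" using C zclosed2_iff by blast
    have "peval (case_sum (($) p) (($) b)) f = 0" if f: "f \<in> F" for f
    proof (rule ccontr)
      assume nz: "peval (case_sum (($) p) (($) b)) f \<noteq> 0"
      \<comment> \<open>The equation \<open>f\<close> with the coordinates of \<open>b\<close> substituted.\<close>
      define f' where "f' = psubst (case_sum Var (\<lambda>j. Const (b $ j))) f"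
      have ev: "peval (($) q) f' = peval (case_sum (($) q) (($) b)) f" for q
      proof -
        have "(\<lambda>i. peval (($) q) (case_sum Var (\<lambda>j. Const (b $ j)) i)) = case_sum (($) q) (($) b)"
          by (auto simp: fun_eq_iff split: sum.splits)
        then show ?thesis by (simp add: f'_def peval_psubst)
      qed
      have "bihomogeneous f" using F(1) f by blast
      then obtain d where "homog_in (range Inl) d f" unfolding bihomogeneous_def by blast
      then have "homog_in UNIV d f'"
        unfolding f'_def by (rule homog_in_psubst) (auto split: sum.splits simp del: One_nat_def)
      moreover have "peval (($) p) f' \<noteq> 0" using nz ev by simp
      ultimately obtain q where q: "q \<in> reps (reg_points X)" "peval (($) q) f' \<noteq> 0"
        using regular_points_dense[OF X _ p] by blast
      have "reg_points X \<subseteq> X" unfolding reg_points_def reps_def by blast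
      then have "q \<in> reps X" using q(1) subset_iff_reps by blast
      then have "(pt q, pt b) \<in> C" using sub perp q(1) b by blast
      then show False
        using mem_zero_set2[OF F(1) reps_nonzero[OF q(1)] b] F(2) f q(2) ev by simp
    qed
    then show ?thesis using mem_zero_set2[OF F(1) reps_nonzero[OF p] b] F(2) by blast
  qed
  then show ?thesis unfolding conormal_def hull_def by blast
qed

definition ones :: "complex ^ ('n::finite) option" where
  "ones = (\<chi> i. case i of Some _ \<Rightarrow> 1 | None \<Rightarrow> - 1)"

lemma sum_ones: "(\<Sum>i\<in>UNIV. ones $ i * v $ i) = (\<Sum>i\<in>UNIV. v $ Some i) - v $ None"
  for v :: "complex ^ ('n::finite) option"
proof -
  have "(\<Sum>i\<in>UNIV. ones $ i * v $ i)
      = (ones :: complex ^ 'n option) $ None * v $ None + (\<Sum>i\<in>range Some. ones $ i * v $ i)"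
    unfolding UNIV_option_conv by (subst sum.insert) auto
  also have "(\<Sum>i\<in>range Some. ones $ i * v $ i) = (\<Sum>i\<in>UNIV. v $ Some i)"
    by (subst sum.reindex) (auto simp: ones_def)
  finally show ?thesis by (simp add: ones_def)
qed

lemma ones_nonzero: "ones \<noteq> 0"
proof
  assume "ones = (0 :: complex ^ 'a option)"
  then have "(ones :: complex ^ 'a option) $ None = 0" by simp
  then show False by (simp add: ones_def)
qed

text \<open>The linear form with coefficients \<open>ones\<close> is an equation of the model, and its gradient is constant.\<close>

lemma stat_model_perp_ones:
  fixes X :: "('n::finite) option proj set"
  assumes X: "stat_model X" and "v \<in> cone_tangent X q"
  shows "(\<Sum>i\<in>UNIV. ones $ i * v $ i) = 0"
proof -
  define L :: "'n option cpoly" where "L = (\<Sum>j\<in>UNIV. Const (ones $ j) * Var j)"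
  have "L \<in> vanishing_ideal X"
  proof (rule vanishing_idealI)
    fix w assume w: "w \<in> reps X"
    then have "pt w \<in> {pt p |p. p \<noteq> 0 \<and> (\<Sum>i\<in>UNIV. p $ Some i) - p $ None = 0}"
      using X unfolding stat_model_def reps_def by blast
    then obtain p where p: "pt p = pt w" "p \<noteq> 0" "(\<Sum>i\<in>UNIV. p $ Some i) - p $ None = 0" by auto
    obtain c where c: "c \<noteq> 0" "w = c *s p" by (rule pt_eqE[OF p(1,2) reps_nonzero[OF w]])
    have "peval (($) w) L = (\<Sum>i\<in>UNIV. w $ Some i) - w $ None"
      by (simp add: L_def sum_ones)
    also have "\<dots> = c * ((\<Sum>i\<in>UNIV. p $ Some i) - p $ None)"
      by (simp add: c(2) sum_distrib_left right_diff_distrib)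
    finally show "peval (($) w) L = 0" using p(3) by simp
  qed
  then have "(\<Sum>i\<in>UNIV. peval (($) q) (pdiff i L) * v $ i) = 0"
    using assms(2) unfolding cone_tangent_def by blast
  moreover have "pdiff i L = Const (ones $ i)" for i
  proof -
    have "pdiff i L = (\<Sum>j\<in>UNIV. if i = j then Const (ones $ j) else 0)"
      unfolding L_def pdiff_sum by (intro sum.cong) (auto simp: pdiff_Var)
    then show ?thesis by simp
  qed
  ultimately show ?thesis by simp
qed

text \<open>A singular point \<open>p\<close> paired with the vector of the hyperplane lies in the conormal variety, although
  only nonsingular points enter its definition; the triple with the product as data vector is then one
  of the generators of the likelihood correspondence.\<close>

lemma hadamard_ones_subset_data_singular_locus:
  fixes X :: "('n::finite) option proj set"
  assumes "stat_model X"
  shows "hadamard (sing_points X - coord_hyperplanes) {ones_point} \<subseteq> data_singular_locus X"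
proof
  fix U assume "U \<in> hadamard (sing_points X - coord_hyperplanes) {ones_point}"
  then obtain p b where U: "U = pt (p * b)" and p: "p \<in> reps (sing_points X - coord_hyperplanes)"
    and b: "b \<in> reps {ones_point}" and pb: "p * b \<noteq> 0"
    unfolding hadamard_def by blast
  have b0: "b \<noteq> 0" and p0: "p \<noteq> 0" using b p reps_nonzero by blast+
  have "pt ones = pt b" using b by (simp add: reps_def ones_point_def ones_def)
  then obtain c where c: "c \<noteq> 0" "b = c *s ones" by (rule pt_eqE[OF _ ones_nonzero b0])
  have pX: "p \<in> reps X" using p by (simp add: reps_def sing_points_def)
  have "(\<Sum>i\<in>UNIV. b $ i * v $ i) = 0" if "v \<in> cone_tangent X q" for q v
  proof -
    have "(\<Sum>i\<in>UNIV. b $ i * v $ i) = c * (\<Sum>i\<in>UNIV. ones $ i * v $ i)"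
      by (simp add: c(2) sum_distrib_left mult.assoc)
    then show ?thesis using stat_model_perp_ones[OF assms that] by simp
  qed
  then have con: "(pt p, pt b) \<in> conormal X"
    using assms pX b0 by (intro conormal_if_perp_everywhere) (simp_all add: stat_model_def)
  have "(pt p, pt b, U) \<in> {(pt p, pt b, pt u) |p b u. p \<noteq> 0 \<and> b \<noteq> 0 \<and> u \<noteq> 0 \<and>
      (pt p, pt b) \<in> conormal X \<and> p * b \<noteq> 0 \<and> pt (p * b) = pt u}"
    using con p0 b0 pb U by blast
  then have "(pt p, pt b, U) \<in> ext_likelihood X"
    unfolding ext_likelihood_def by (rule hull_inc)
  moreover have "pt p \<in> sing_points X - coord_hyperplanes" using p by (simp add: reps_def)
  ultimately show "U \<in> data_singular_locus X"
    unfolding data_singular_locus_def by (intro image_eqI[of _ _ "(pt p, pt b, U)"]) auto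
qed

text \<open>If no coordinate of \<open>p\<close> vanishes, the product of \<open>p\<close> and \<open>b\<close> is nonzero, so the closed conditions
  that hold on the whole likelihood correspondence determine \<open>u\<close> as this product.\<close>

lemma data_singular_locus_subset_hadamard_dual:
  "data_singular_locus X \<subseteq> hadamard (sing_points X - coord_hyperplanes) (dual_variety X)"
proof
  fix U assume "U \<in> data_singular_locus X"
  then obtain P B where P: "P \<in> sing_points X - coord_hyperplanes" and E: "(P, B, U) \<in> ext_likelihood X"
    unfolding data_singular_locus_def by auto
  obtain p b u where pbu: "p \<noteq> 0" "b \<noteq> 0" "u \<noteq> 0" "P = pt p" "B = pt b" "U = pt u"
    and minors: "\<forall>i j. p $ i * b $ i * u $ j = p $ j * b $ j * u $ i"
    by (rule ext_likelihood_proportional[OF E])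
  have con: "(pt p, pt b) \<in> conormal X" using ext_likelihood_conormal[OF E] pbu by simp
  have "pt p \<notin> coord_hyperplanes" using P pbu(4) by simp
  then have "(\<Prod>i\<in>UNIV. p $ i) \<noteq> 0" using pbu(1) unfolding coord_hyperplanes_def by blast
  then have pi: "p $ i \<noteq> 0" for i by simp
  obtain j where j: "b $ j \<noteq> 0" using pbu(2) unfolding vec_eq_iff by auto
  have "(p * b) $ j \<noteq> 0" using j pi by simp
  then have pb: "p * b \<noteq> 0" unfolding vec_eq_iff by auto
  have quotient: "u $ i = u $ j / (p $ j * b $ j) * (p * b) $ i" for i
  proof -
    have "u $ i * (p $ j * b $ j) = u $ j * (p $ i * b $ i)"
      using minors[rule_format, of i j] by (simp only: mult.commute)
    then have "u $ i = u $ j * (p $ i * b $ i) / (p $ j * b $ j)"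
      using j pi[of j] by (simp add: nonzero_eq_divide_eq)
    then show ?thesis by simp
  qed
  have "u = (u $ j / (p $ j * b $ j)) *s (p * b)"
    unfolding vec_eq_iff vector_smult_component by (intro allI quotient)
  then have "pt (p * b) = pt u" using pt_eq_iff[OF pb pbu(3)] by blast
  then have "U = pt (p * b)" using pbu(6) by simp
  moreover have "p \<in> reps (sing_points X - coord_hyperplanes)"
    using P pbu(1,4) by (simp add: reps_def)
  moreover have "b \<in> reps (dual_variety X)"
    using con pbu(2) imageI[OF con, of snd] by (simp add: reps_def dual_variety_def)
  moreover have "(\<Sum>i\<in>UNIV. p $ i * b $ i) = 0" by (rule conormal_incidence[OF con pbu(1,2)])
  ultimately show "U \<in> hadamard (sing_points X - coord_hyperplanes) (dual_variety X)"
    unfolding hadamard_def using pb by (intro CollectI exI[of _ p] exI[of _ b] conjI)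
qed

theorem theorem1:
  fixes X :: "('n::finite) option proj set"
  assumes "stat_model X"
  shows "hadamard (sing_points X - coord_hyperplanes) {ones_point} \<subseteq> data_singular_locus X
    \<and> data_singular_locus X \<subseteq> hadamard (sing_points X - coord_hyperplanes) (dual_variety X)"
  using hadamard_ones_subset_data_singular_locus[OF assms] data_singular_locus_subset_hadamard_dual
  by blast

end
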